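(* Let $\mathbb{F}$ be a field of characteristic zero and let $I\subset R=\mathbb{F}[x_1,x_2]$ be a height two ideal minimally generated by three homogeneous polynomials of the same degree $d$. Let $\mathcal{K}=\bigoplus_{p,q}\mathcal{K}_{p,q}$ be the bigraded kernel of the canonical map $\mathrm{Sym}(I)\to\mathrm{Rees}(I)$. For each integer $p\ge 2$ let $b_p(s)$ be the $b$-function of the left $D$-module $M=M_p$ defined in the context. Then $b_p(s)$ exists and is nonzero, and for every integer $q$ $$\mathcal{K}_{p,q}\neq 0\quad\Longleftrightarrow\quad b_p(-d+2+q)=0.$$ Moreover, these are the only possible roots of $b_p(s)$, that is, $$b_p(s)=\prod_{\{q\in\mathbb{Z}\,\mid\,\mathcal{K}_{p,q}\ne 0\}}(s+d-2-q).$$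
   Context: Setting. Write $I=(f_1,f_2,f_3)$ with $f_i$ homogeneous of degree $d$. By Hilbert–Burch $I$ has a graded free resolution $0\to R(-d-\mu)\oplus R(-2d+\mu)\xrightarrow{\varphi}R(-d)^3\xrightarrow{[f_1,f_2,f_3]}I\to 0$, where the first column of $\varphi$ has homogeneous entries of degree $\mu$ and the second of degree $d-\mu$ (one may order the columns so that $0<\mu\le d-\mu$). Let $S=R[T_1,T_2,T_3]$, bigraded by $\mathrm{bideg}(T_i)=(1,0)$, $\mathrm{bideg}(x_i)=(0,1)$, and $[g_1,g_2]=[T_1,T_2,T_3]\cdot\varphi$, so $\mathrm{Sym}(I)\cong S/(g_1,g_2)$ with $\mathrm{bideg}(g_1)=(1,\mu)$, $\mathrm{bideg}(g_2)=(1,d-\mu)$. $\mathrm{Rees}(I)=\bigoplus_{i\ge0}I^it^i$ is the quotient of $S$ via $T_i\mapsto f_it$ (with $\mathrm{bideg}(t)=(1,-d)$). Operators. $D=A_2(\mathbb{F})=\mathbb{F}\langle x_1,x_2,\partial_1,\partial_2\rangle$ is the Weyl algebra ($\partial_ix_j=x_j\partial_i+\delta_{ij}$, the $x$'s commute, the $\partial$'s commute), $\mathcal{T}=D[T_1,T_2,T_3]$ with central $T_i$, and $\mathcal{F}$ is the automorphism of $\mathcal{T}$ with $\mathcal{F}(x_i)=\partial_i$, $\mathcal{F}(\partial_i)=-x_i$, $\mathcal{F}(T_i)=T_i$. Put $L_i=\mathcal{F}(g_i)$, $i=1,2$. The module $M$. Fix $p\ge2$ and let $m=\binom p2$, $n=\binom{p+1}2$.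 Let $[L_i]\in D^{n\times m}$ be the matrix of multiplication by $L_i$ from the $D$-span of the monomials $\mathbf{T}^\gamma$ with $|\gamma|=p-2$ (indexing columns) to the $D$-span of the monomials with $|\gamma|=p-1$ (indexing rows): the entry in row $\mathbf{T}^\delta$ and column $\mathbf{T}^\gamma$ is the coefficient in $D$ of $\mathbf{T}^\delta$ in $L_i\mathbf{T}^\gamma$. Let $H\in D^{2n\times m}$ be obtained by stacking $[L_1]$ on top of $[L_2]$, let $N=D^{2n}\cdot H\subset D^m$ be the left $D$-submodule generated by the rows of $H$, and $M=D^m/N$. $b$-functions. For $0\ne\ell=\sum c_{\alpha,\beta}x^\alpha\partial^\beta\in D$, let $\mathrm{in}(\ell)$ be the sum of the terms $c_{\alpha,\beta}x^\alpha\partial^\beta$ ($c_{\alpha,\beta}\neq0$) for which $|\alpha|-|\beta|$ is maximal. For a left ideal $J\subset D$, $\mathrm{in}(J)$ is the $\mathbb{F}$-span of $\{\mathrm{in}(\ell)\mid\ell\in J\}$; it is a left ideal. A nonzero finitely generated left $D$-module is holonomic if its Bernstein dimension is $2$; a left ideal $J$ is holonomic if $D/J$ is. For a holonomic left ideal $J$, the $b$-function $b_J(s)$ is the (monic) generator of the principal ideal $\mathrm{in}(J)\cap\mathbb{F}[s]$ of $\mathbb{F}[s]$, where $s=-x_1\partial_1-x_2\partial_2$. For a holonomic left $D$-module $M'=D^r/N'$, put $J_i=\{\ell\in D\mid (0,\dots,\ell,\dots,0)\in N'\}$ ($\ell$ in position $i$) for $i=1,\dots,r$; the $b$-function of $M'$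 is $b_{M'}(s)=\mathrm{LCM}_{i=1,\dots,r}\,b_{J_i}(s)$ (taken monic). *)

theory Defs
  imports
    "HOL-Library.Poly_Mapping"
    "HOL-Library.Numeral_Type"
    "HOL-Library.Extended_Nat"
    "HOL-Library.FuncSet"
    "HOL-Library.Function_Algebras"
    "HOL-Computational_Algebra.Polynomial"
begin

section \<open>Polynomial rings\<close>

abbreviation lookup where "lookup \<equiv> Poly_Mapping.lookup"
abbreviation keys where "keys \<equiv> Poly_Mapping.keys"
abbreviation single where "single \<equiv> Poly_Mapping.single"

type_synonym 'v expo = "'v \<Rightarrow>\<^sub>0 nat"

text \<open>The rings \<open>R = F[x\<^sub>1,x\<^sub>2]\<close> and \<open>S = R[T\<^sub>1,T\<^sub>2,T\<^sub>3]\<close>. The variables are indexed by the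
  numeral types \<open>2\<close> and \<open>3\<close>, which have exactly two and three elements.\<close>

type_synonym 'a R2 = "2 expo \<Rightarrow>\<^sub>0 'a"
type_synonym 'a RT = "3 expo \<Rightarrow>\<^sub>0 'a R2"

definition tdeg :: "'v::finite expo \<Rightarrow> nat" where
  "tdeg \<alpha> = (\<Sum>i\<in>UNIV. lookup \<alpha> i)"

definition homogeneous :: "nat \<Rightarrow> 'a::zero R2 \<Rightarrow> bool" where
  "homogeneous n r \<longleftrightarrow> (\<forall>\<alpha>\<in>keys r. tdeg \<alpha> = n)"

definition linear_form :: "(3 \<Rightarrow> 'a::comm_ring_1 R2) \<Rightarrow> 'a RT" where
  "linear_form a = (\<Sum>i\<in>UNIV. single (single i 1) (a i))"

section \<open>Ideals and height\<close>

definition ideal_gen :: "'r::comm_ring_1 set \<Rightarrow> 'r set" where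
  "ideal_gen B = module.span (*) B"

definition is_prime_ideal :: "'r::comm_ring_1 set \<Rightarrow> bool" where
  "is_prime_ideal P \<longleftrightarrow> module.subspace (*) P \<and> P \<noteq> UNIV \<and>
     (\<forall>a b. a * b \<in> P \<longrightarrow> a \<in> P \<or> b \<in> P)"

definition prime_height :: "'r::comm_ring_1 set \<Rightarrow> enat" where
  "prime_height P = (SUP n \<in> {n. \<exists>C :: nat \<Rightarrow> 'r set.
      (\<forall>i\<le>n. is_prime_ideal (C i)) \<and> (\<forall>i<n. C i \<subset> C (Suc i)) \<and> C n = P}. enat n)"

definition ideal_height :: "'r::comm_ring_1 set \<Rightarrow> enat" where
  "ideal_height I = (INF P \<in> {P. is_prime_ideal P \<and> I \<subseteq> P}. prime_height P)"

section \<open>Symmetric algebra, Rees algebra and the kernel of the canonical map\<close>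

definition ring_hom :: "('r::ring_1 \<Rightarrow> 's::ring_1) \<Rightarrow> bool" where
  "ring_hom h \<longleftrightarrow> h 1 = 1 \<and> (\<forall>a b. h (a + b) = h a + h b) \<and> (\<forall>a b. h (a * b) = h a * h b)"

definition eval_RT :: "('a::comm_ring_1 R2 \<Rightarrow> 'b::comm_ring_1) \<Rightarrow> (3 \<Rightarrow> 'b) \<Rightarrow> 'a RT \<Rightarrow> 'b" where
  "eval_RT h v P = (\<Sum>\<gamma>\<in>keys P. h (lookup P \<gamma>) * (\<Prod>i\<in>UNIV. v i ^ lookup \<gamma> i))"

text \<open>\<open>Sym(I)\<close> for \<open>I = (f\<^sub>1,f\<^sub>2,f\<^sub>3)\<close> is \<open>S\<close> modulo the linear forms \<open>\<Sum> a\<^sub>i T\<^sub>i\<close> with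
  \<open>\<Sum> a\<^sub>i f\<^sub>i = 0\<close>; its universal property is \<open>sym_universal\<close> below. \<open>Rees(I)\<close> is the image of \<open>S\<close>
  in \<open>R[t]\<close> under \<open>T\<^sub>i \<mapsto> f\<^sub>i t\<close>.\<close>

definition sym_ideal :: "(3 \<Rightarrow> 'a::comm_ring_1 R2) \<Rightarrow> 'a RT set" where
  "sym_ideal f = ideal_gen {linear_form a | a. (\<Sum>i\<in>UNIV. a i * f i) = 0}"

definition sym_class :: "(3 \<Rightarrow> 'a::comm_ring_1 R2) \<Rightarrow> 'a RT \<Rightarrow> 'a RT set" where
  "sym_class f P = {Q. Q - P \<in> sym_ideal f}"

definition rees_map :: "(3 \<Rightarrow> 'a::comm_ring_1 R2) \<Rightarrow> 'a RT \<Rightarrow> 'a R2 poly" where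
  "rees_map f = eval_RT (\<lambda>r. [:r:]) (\<lambda>i. monom (f i) 1)"

definition bihomogeneous :: "nat \<Rightarrow> int \<Rightarrow> 'a::zero RT \<Rightarrow> bool" where
  "bihomogeneous p q P \<longleftrightarrow>
     (\<forall>\<gamma>\<in>keys P. tdeg \<gamma> = p \<and> (\<forall>\<alpha>\<in>keys (lookup P \<gamma>). int (tdeg \<alpha>) = q))"

text \<open>The bigraded piece \<open>\<K>\<^sub>p\<^sub>,\<^sub>q\<close>, as a subset of \<open>Sym(I)\<close>.\<close>

definition kernel_piece :: "(3 \<Rightarrow> 'a::comm_ring_1 R2) \<Rightarrow> nat \<Rightarrow> int \<Rightarrow> 'a RT set set" where
  "kernel_piece f p q = {sym_class f P | P. bihomogeneous p q P \<and> rees_map f P = 0}"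

definition kernel_piece_nonzero :: "(3 \<Rightarrow> 'a::comm_ring_1 R2) \<Rightarrow> nat \<Rightarrow> int \<Rightarrow> bool" where
  "kernel_piece_nonzero f p q \<longleftrightarrow> kernel_piece f p q \<noteq> {sym_class f 0}"

subsection \<open>The symmetric algebra has the expected universal property\<close>

interpretation self_module: module "(*) :: 'r::comm_ring_1 \<Rightarrow> 'r \<Rightarrow> 'r"
  by unfold_locales (auto simp: algebra_simps)

lemma ring_hom_simps:
  assumes "ring_hom h"
  shows "h 1 = 1" "h (a + b) = h a + h b" "h (a * b) = h a * h b" "h 0 = 0"
    "h (- a) = - h a" "h (a - b) = h a - h b"
proof -
  show *: "h 1 = 1" "h (a + b) = h a + h b" "h (a * b) = h a * h b" for a b
    using assms by (auto simp: ring_hom_def)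
  show 0: "h 0 = 0" using *(2)[of 0 0] by simp
  show m: "h (- a) = - h a" for a using *(2)[of a "- a"] 0 by (simp add: eq_neg_iff_add_eq_0 add.commute)
  show "h (a - b) = h a - h b" using *(2)[of a "- b"] m[of b] by simp
qed

lemma ring_hom_sum: "ring_hom h \<Longrightarrow> h (sum g A) = (\<Sum>i\<in>A. h (g i))"
  by (induction A rule: infinite_finite_induct) (auto simp: ring_hom_simps)

lemma ring_hom_power: "ring_hom h \<Longrightarrow> h (a ^ n) = h a ^ n"
  by (induction n) (auto simp: ring_hom_simps)

lemma poly_mapping_sum_single: "P = (\<Sum>k\<in>keys P. single k (lookup P k))"
  by (rule poly_mapping_eqI)
     (auto simp: lookup_sum lookup_single when_def in_keys_iff sum.delta)

lemma eval_RT_alt: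
  assumes "h 0 = 0" "finite A" "keys P \<subseteq> A"
  shows "eval_RT h v P = (\<Sum>\<gamma>\<in>A. h (lookup P \<gamma>) * (\<Prod>i\<in>UNIV. v i ^ lookup \<gamma> i))"
  unfolding eval_RT_def using assms by (intro sum.mono_neutral_left) (auto simp: in_keys_iff)

lemma eval_RT_add:
  assumes "ring_hom h" shows "eval_RT h v (P + Q) = eval_RT h v P + eval_RT h v Q"
proof -
  note h = ring_hom_simps[OF assms]
  have "keys (P + Q) \<subseteq> keys P \<union> keys Q" by (rule Poly_Mapping.keys_add)
  then show ?thesis
    by (simp add: eval_RT_alt[where A = "keys P \<union> keys Q"] h lookup_add sum.distrib algebra_simps)
qed

lemma eval_RT_zero [simp]: "eval_RT h v 0 = 0"
  by (simp add: eval_RT_def)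

lemma eval_RT_sum: "ring_hom h \<Longrightarrow> eval_RT h v (sum g A) = (\<Sum>i\<in>A. eval_RT h v (g i))"
  by (induction A rule: infinite_finite_induct) (auto simp: eval_RT_add)

lemma eval_RT_single:
  "ring_hom h \<Longrightarrow> eval_RT h v (single \<gamma> c) = h c * (\<Prod>i\<in>UNIV. v i ^ lookup \<gamma> i)"
  by (auto simp: eval_RT_def ring_hom_simps)

lemma eval_RT_mult:
  assumes h: "ring_hom h" shows "eval_RT h v (P * Q) = eval_RT h v P * eval_RT h v Q"
proof -
  have "P * Q = (\<Sum>k\<in>keys P. \<Sum>l\<in>keys Q. single (k + l) (lookup P k * lookup Q l))"
  proof -
    have "P * Q = (\<Sum>k\<in>keys P. single k (lookup P k)) * (\<Sum>l\<in>keys Q. single l (lookup Q l))"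
      by (simp only: poly_mapping_sum_single[symmetric])
    then show ?thesis by (simp only: sum_product mult_single)
  qed
  also have "eval_RT h v \<dots> = (\<Sum>k\<in>keys P. \<Sum>l\<in>keys Q.
      (h (lookup P k) * (\<Prod>i\<in>UNIV. v i ^ lookup k i)) *
      (h (lookup Q l) * (\<Prod>i\<in>UNIV. v i ^ lookup l i)))"
    by (simp only: eval_RT_sum[OF h] eval_RT_single[OF h] ring_hom_simps(3)[OF h]
        lookup_add power_add prod.distrib mult_ac)
  also have "\<dots> = eval_RT h v P * eval_RT h v Q"
    by (simp only: sum_product eval_RT_def)
  finally show ?thesis .
qed

lemma eval_RT_hom: "ring_hom h \<Longrightarrow> ring_hom (eval_RT h v)"
  unfolding ring_hom_def[of "eval_RT h v"]
  using eval_RT_add eval_RT_mult eval_RT_single[of h v 0 1]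
  by (auto simp: ring_hom_simps)

lemma eval_RT_linear_form:
  "ring_hom h \<Longrightarrow> eval_RT h v (linear_form a) = (\<Sum>i\<in>UNIV. h (a i) * v i)"
proof -
  assume h: "ring_hom h"
  have "(\<Prod>j\<in>UNIV. v j ^ lookup (single i 1) j) = v i" for i
  proof -
    have "(\<Prod>j\<in>UNIV. v j ^ lookup (single i 1) j) = (\<Prod>j\<in>UNIV. if j = i then v j else 1)"
      by (intro prod.cong) (auto simp: lookup_single when_def)
    then show ?thesis by simp
  qed
  then show ?thesis by (simp add: linear_form_def eval_RT_sum eval_RT_single h)
qed

lemma ring_hom_vanishes_ideal_gen:
  assumes h: "ring_hom h" and B: "\<And>b. b \<in> B \<Longrightarrow> h b = 0" and a: "a \<in> ideal_gen B"
  shows "h a = 0"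
  using a unfolding ideal_gen_def
  by (induction rule: self_module.span_induct_alt) (auto simp: ring_hom_simps[OF h] B)

lemma const_poly_hom: "ring_hom (\<lambda>r. [:r:])"
  by (auto simp: ring_hom_def one_pCons)

lemma rees_map_hom: "ring_hom (rees_map f)"
  unfolding rees_map_def by (intro eval_RT_hom const_poly_hom)

lemma rees_map_sym_ideal: "P \<in> sym_ideal f \<Longrightarrow> rees_map f P = 0"
  unfolding sym_ideal_def
proof (erule ring_hom_vanishes_ideal_gen[OF rees_map_hom, rotated], clarify)
  fix a assume *: "(\<Sum>i\<in>UNIV. a i * f i) = 0"
  have "rees_map f (linear_form a) = (\<Sum>i\<in>UNIV. monom (a i * f i) 1)"
    by (simp add: rees_map_def eval_RT_linear_form const_poly_hom smult_monom)
  also have "\<dots> = monom (\<Sum>i\<in>UNIV. a i * f i) 1" by (simp add: monom_sum)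
  finally show "rees_map f (linear_form a) = 0" by (simp add: *)
qed

lemma single_expo_prod:
  "single (\<gamma> :: 3 expo) (1 :: 'a::comm_ring_1 R2) = (\<Prod>i\<in>UNIV. single (single i 1) 1 ^ lookup \<gamma> i)"
proof -
  have pow: "single (single i (1::nat)) (1 :: 'a R2) ^ n = single (single i n) 1" for i :: 3 and n
  proof (induction n)
    case (Suc n)
    then show ?case
      by (simp only: power_Suc mult_single single_add[symmetric] plus_1_eq_Suc mult_1_left)
  qed simp
  have prod: "(\<Prod>i\<in>A. single (single i (lookup \<gamma> i)) (1 :: 'a R2)) = single (\<Sum>i\<in>A. single i (lookup \<gamma> i)) 1"
    if "finite A" for A
    using that by induction (auto simp: mult_single)
  have "(\<Sum>i\<in>UNIV. single i (lookup \<gamma> i)) = \<gamma>"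
    by (rule poly_mapping_eqI) (auto simp: lookup_sum lookup_single when_def)
  then show ?thesis by (simp only: pow prod[OF finite])
qed

lemma sym_universal:
  fixes f :: "3 \<Rightarrow> 'a::comm_ring_1 R2" and \<rho> :: "'a R2 \<Rightarrow> 'b::comm_ring_1"
    and h :: "'a R2 \<Rightarrow> 'b"
  defines "I \<equiv> ideal_gen (range f)"
  assumes \<rho>: "ring_hom \<rho>"
    and h_add: "\<And>a b. a \<in> I \<Longrightarrow> b \<in> I \<Longrightarrow> h (a + b) = h a + h b"
    and h_scale: "\<And>r a. a \<in> I \<Longrightarrow> h (r * a) = \<rho> r * h a"
  shows "\<exists>!\<Phi>. ring_hom \<Phi> \<and> (\<forall>r. \<Phi> (single 0 r) = \<rho> r) \<and> (\<forall>P\<in>sym_ideal f. \<Phi> P = 0) \<and>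
    (\<forall>a. \<Phi> (linear_form a) = h (\<Sum>i\<in>UNIV. a i * f i))"
proof
  define \<Phi> where "\<Phi> = eval_RT \<rho> (\<lambda>i. h (f i))"
  have fI: "f i \<in> I" for i unfolding I_def ideal_gen_def by (simp add: self_module.span_base)
  have I: "0 \<in> I" "a \<in> I \<Longrightarrow> b \<in> I \<Longrightarrow> a + b \<in> I" "a \<in> I \<Longrightarrow> r * a \<in> I" for a b r
    unfolding I_def ideal_gen_def
    by (auto simp: self_module.span_zero self_module.span_add self_module.span_scale)
  have h0: "h 0 = 0" using h_scale[OF I(1), of 0] by (simp add: ring_hom_simps[OF \<rho>])
  have hsum: "(\<Sum>i\<in>A. a i * f i) \<in> I \<and> h (\<Sum>i\<in>A. a i * f i) = (\<Sum>i\<in>A. \<rho> (a i) * h (f i))"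
    if "finite A" for A a
    using that by induction (auto simp: h0 I fI h_add h_scale)
  have hom: "ring_hom \<Phi>" unfolding \<Phi>_def by (rule eval_RT_hom[OF \<rho>])
  have lin: "\<Phi> (linear_form a) = h (\<Sum>i\<in>UNIV. a i * f i)" for a
    unfolding \<Phi>_def using hsum[of UNIV a] by (simp add: eval_RT_linear_form[OF \<rho>])
  have van: "\<Phi> P = 0" if "P \<in> sym_ideal f" for P
    using that unfolding sym_ideal_def
    by (rule ring_hom_vanishes_ideal_gen[OF hom, rotated]) (auto simp: lin h0)
  show "ring_hom \<Phi> \<and> (\<forall>r. \<Phi> (single 0 r) = \<rho> r) \<and> (\<forall>P\<in>sym_ideal f. \<Phi> P = 0) \<and>
    (\<forall>a. \<Phi> (linear_form a) = h (\<Sum>i\<in>UNIV. a i * f i))"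
    using hom lin van by (auto simp: \<Phi>_def eval_RT_single \<rho>)
  fix \<Psi> assume \<Psi>: "ring_hom \<Psi> \<and> (\<forall>r. \<Psi> (single 0 r) = \<rho> r) \<and> (\<forall>P\<in>sym_ideal f. \<Psi> P = 0) \<and>
    (\<forall>a. \<Psi> (linear_form a) = h (\<Sum>i\<in>UNIV. a i * f i))"
  have T: "\<Psi> (single (single i 1) 1) = h (f i)" for i
  proof -
    have "linear_form (\<lambda>j. if j = i then 1 else 0) = (single (single i 1) 1 :: 'a RT)"
      unfolding linear_form_def by (simp add: if_distrib[of "single _"] cong: if_cong)
    moreover have "(\<Sum>j\<in>UNIV. (if j = i then 1 else 0) * f j) = f i"
    proof -
      have "(\<Sum>j\<in>UNIV. (if j = i then 1 else 0) * f j) = (\<Sum>j\<in>UNIV. if j = i then f j else 0)"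
        by (intro sum.cong) auto
      then show ?thesis by simp
    qed
    moreover have "\<Psi> (linear_form (\<lambda>j. if j = i then 1 else 0))
        = h (\<Sum>j\<in>UNIV. (if j = i then 1 else 0) * f j)"
      using \<Psi> by blast
    ultimately show ?thesis by (simp only:)
  qed
  have \<Psi>prod: "\<Psi> (\<Prod>i\<in>A. g i) = (\<Prod>i\<in>A. \<Psi> (g i))" if "finite A" for A and g :: "3 \<Rightarrow> _"
    using that \<Psi> by induction (auto simp: ring_hom_simps)
  show "\<Psi> = \<Phi>"
  proof
    fix P
    have "\<Psi> (single \<gamma> c) = \<Phi> (single \<gamma> c)" for \<gamma> c
    proof -
      have "single \<gamma> c = single 0 c * single \<gamma> 1" by (simp add: mult_single)
      then have "\<Psi> (single \<gamma> c) = \<Psi> (single 0 c) * \<Psi> (single \<gamma> 1)"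
        using ring_hom_simps(3)[of \<Psi> "single 0 c" "single \<gamma> 1"] \<Psi> by simp
      also have "\<Psi> (single \<gamma> 1) = (\<Prod>i\<in>UNIV. \<Psi> (single (single i 1) 1 ^ lookup \<gamma> i))"
        by (subst single_expo_prod) (rule \<Psi>prod, simp)
      also have "\<dots> = (\<Prod>i\<in>UNIV. h (f i) ^ lookup \<gamma> i)"
        using \<Psi> T by (simp only: ring_hom_power)
      also have "\<Psi> (single 0 c) = \<rho> c" using \<Psi> by blast
      finally show ?thesis by (simp add: \<Phi>_def eval_RT_single \<rho>)
    qed
    then have "\<Psi> (\<Sum>k\<in>keys P. single k (lookup P k)) = \<Phi> (\<Sum>k\<in>keys P. single k (lookup P k))"
      using \<Psi> hom by (simp only: ring_hom_sum)
    then show "\<Psi> P = \<Phi> P" by (simp only: poly_mapping_sum_single[symmetric])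
  qed
qed

section \<open>The Weyl algebra\<close>

text \<open>An element of \<open>D = A\<^sub>2(F)\<close> is given by its coefficients \<open>c\<^sub>\<alpha>\<^sub>\<beta>\<close> with respect to the basis
  \<open>x\<^sup>\<alpha>\<partial>\<^sup>\<beta>\<close>, stored at the key \<open>(\<alpha>, \<beta>)\<close>. The product is the Leibniz rule
  \<open>\<partial>\<^sup>\<beta>x\<^sup>\<gamma> = (\<Sum>\<kappa>\<le>\<beta>,\<gamma>. (\<Prod>i. (\<beta>\<^sub>i choose \<kappa>\<^sub>i) (\<gamma>\<^sub>i choose \<kappa>\<^sub>i) \<kappa>\<^sub>i!) x\<^sup>\<gamma>\<^sup>-\<^sup>\<kappa>\<partial>\<^sup>\<beta>\<^sup>-\<^sup>\<kappa>)\<close>. Associativity is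
  obtained below from the faithful action on \<open>F[x\<^sub>1,x\<^sub>2]\<close>, the defining relations in
  \<open>weyl_relations\<close>.\<close>

type_synonym wexpo = "2 expo \<times> 2 expo"

typedef (overloaded) 'a weyl = "UNIV :: (wexpo \<Rightarrow>\<^sub>0 'a::zero) set"
  morphisms wcoeffs Weyl by simp

lemmas wcoeffs_Weyl [simp] = Weyl_inverse[OF UNIV_I]
lemmas Weyl_wcoeffs [simp] = wcoeffs_inverse

lemma weyl_eqI: "wcoeffs a = wcoeffs b \<Longrightarrow> a = b"
  by (simp add: wcoeffs_inject)

definition wmono :: "wexpo \<Rightarrow> 'a::zero \<Rightarrow> 'a weyl" where
  "wmono m c = Weyl (single m c)"

definition common_expos :: "2 expo \<Rightarrow> 2 expo \<Rightarrow> 2 expo set" where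
  "common_expos \<beta> \<gamma> = {\<kappa>. \<forall>i. lookup \<kappa> i \<le> lookup \<beta> i \<and> lookup \<kappa> i \<le> lookup \<gamma> i}"

definition leibniz_coeff :: "2 expo \<Rightarrow> 2 expo \<Rightarrow> 2 expo \<Rightarrow> nat" where
  "leibniz_coeff \<beta> \<gamma> \<kappa> =
     (\<Prod>i\<in>UNIV. (lookup \<beta> i choose lookup \<kappa> i) * (lookup \<gamma> i choose lookup \<kappa> i) * fact (lookup \<kappa> i))"

definition wmono_mult :: "wexpo \<Rightarrow> wexpo \<Rightarrow> 'a::comm_ring_1 \<Rightarrow> wexpo \<Rightarrow>\<^sub>0 'a" where
  "wmono_mult m n c = (case (m, n) of ((\<alpha>, \<beta>), (\<gamma>, \<delta>)) \<Rightarrow>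
     \<Sum>\<kappa>\<in>common_expos \<beta> \<gamma>.
       single (\<alpha> + (\<gamma> - \<kappa>), (\<beta> - \<kappa>) + \<delta>) (c * of_nat (leibniz_coeff \<beta> \<gamma> \<kappa>)))"

instantiation weyl :: (field_char_0) "{zero, one, plus, minus, uminus, times}"
begin

definition "0 = Weyl 0"
definition "1 = wmono (0, 0) 1"
definition "a + b = Weyl (wcoeffs a + wcoeffs b)"
definition "a - b = Weyl (wcoeffs a - wcoeffs b)"
definition "- a = Weyl (- wcoeffs a)"
definition "a * b = Weyl (\<Sum>m\<in>keys (wcoeffs a). \<Sum>n\<in>keys (wcoeffs b).
  wmono_mult m n (lookup (wcoeffs a) m * lookup (wcoeffs b) n))"

instance ..

end

lemma wcoeffs_simps [simp]:
  fixes a b :: "'a::field_char_0 weyl"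
  shows "wcoeffs (0 :: 'a weyl) = 0" "wcoeffs (1 :: 'a weyl) = single (0, 0) 1"
    "wcoeffs (a + b) = wcoeffs a + wcoeffs b"
    "wcoeffs (a - b) = wcoeffs a - wcoeffs b" "wcoeffs (- a) = - wcoeffs a"
    "wcoeffs (wmono m c) = single m c"
  by (simp_all add: zero_weyl_def one_weyl_def plus_weyl_def minus_weyl_def uminus_weyl_def wmono_def)

instance weyl :: (field_char_0) ab_group_add
  by intro_classes (auto intro!: weyl_eqI simp: algebra_simps)

lemma finite_common_expos [simp]: "finite (common_expos \<beta> \<gamma>)"
proof -
  have "common_expos \<beta> \<gamma> \<subseteq> Abs_poly_mapping ` (UNIV \<rightarrow>\<^sub>E {..Max (lookup \<beta> ` UNIV)})"
  proof
    fix \<kappa> assume "\<kappa> \<in> common_expos \<beta> \<gamma>"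
    then have "lookup \<kappa> i \<le> Max (lookup \<beta> ` UNIV)" for i
      by (auto simp: common_expos_def intro: order_trans Max_ge)
    then have "lookup \<kappa> \<in> UNIV \<rightarrow>\<^sub>E {..Max (lookup \<beta> ` UNIV)}" by auto
    then show "\<kappa> \<in> Abs_poly_mapping ` (UNIV \<rightarrow>\<^sub>E {..Max (lookup \<beta> ` UNIV)})"
      by (rule rev_image_eqI) simp
  qed
  then show ?thesis by (rule finite_subset) (auto intro!: finite_PiE)
qed

lemma wmono_mult_simps [simp]:
  "wmono_mult m n 0 = 0" "wmono_mult m n (c + d) = wmono_mult m n c + wmono_mult m n d"
  by (auto simp: wmono_mult_def algebra_simps single_add sum.distrib split: prod.splits)

lemma wcoeffs_mult_superset:
  assumes "finite A" "finite B" "keys (wcoeffs a) \<subseteq> A" "keys (wcoeffs b) \<subseteq> B"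
  shows "wcoeffs (a * b) = (\<Sum>m\<in>A. \<Sum>n\<in>B. wmono_mult m n (lookup (wcoeffs a) m * lookup (wcoeffs b) n))"
proof -
  have "wcoeffs (a * b) = (\<Sum>m\<in>keys (wcoeffs a). \<Sum>n\<in>B. wmono_mult m n (lookup (wcoeffs a) m * lookup (wcoeffs b) n))"
    unfolding times_weyl_def wcoeffs_Weyl using assms
    by (intro sum.cong sum.mono_neutral_left refl) (auto simp: in_keys_iff)
  also have "\<dots> = (\<Sum>m\<in>A. \<Sum>n\<in>B. wmono_mult m n (lookup (wcoeffs a) m * lookup (wcoeffs b) n))"
    using assms by (intro sum.mono_neutral_left) (auto simp: in_keys_iff)
  finally show ?thesis .
qed

lemma weyl_distribs:
  fixes a b c :: "'a::field_char_0 weyl"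
  shows "(a + b) * c = a * c + b * c" "a * (b + c) = a * b + a * c"
proof -
  have ab: "keys (wcoeffs (a + b)) \<subseteq> keys (wcoeffs a) \<union> keys (wcoeffs b)"
    and bc: "keys (wcoeffs (b + c)) \<subseteq> keys (wcoeffs b) \<union> keys (wcoeffs c)"
    by (simp_all add: Poly_Mapping.keys_add)
  show "(a + b) * c = a * c + b * c"
    using ab by (intro weyl_eqI)
      (simp add: wcoeffs_mult_superset[where A = "keys (wcoeffs a) \<union> keys (wcoeffs b)"
          and B = "keys (wcoeffs c)"] lookup_add algebra_simps sum.distrib)
  show "a * (b + c) = a * b + a * c"
    using bc by (intro weyl_eqI)
      (simp add: wcoeffs_mult_superset[where A = "keys (wcoeffs a)"
          and B = "keys (wcoeffs b) \<union> keys (wcoeffs c)"] lookup_add algebra_simps sum.distrib)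
qed

lemma weyl_mult_zero [simp]:
  fixes a :: "'a::field_char_0 weyl" shows "0 * a = 0" "a * 0 = 0"
  by (auto intro!: weyl_eqI simp: times_weyl_def)

lemma weyl_sum_mult:
  fixes a :: "'a::field_char_0 weyl"
  shows "(\<Sum>i\<in>A. g i) * a = (\<Sum>i\<in>A. g i * a)" "a * (\<Sum>i\<in>A. g i) = (\<Sum>i\<in>A. a * g i)"
  by (induction A rule: infinite_finite_induct) (auto simp: weyl_distribs)

lemma wcoeffs_sum: "wcoeffs (\<Sum>i\<in>A. g i) = (\<Sum>i\<in>A. wcoeffs (g i :: 'a::field_char_0 weyl))"
  by (induction A rule: infinite_finite_induct) auto

lemma weyl_eq_sum_wmono:
  "(a :: 'a::field_char_0 weyl) = (\<Sum>m\<in>keys (wcoeffs a). wmono m (lookup (wcoeffs a) m))"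
  by (rule weyl_eqI) (simp add: wcoeffs_sum flip: poly_mapping_sum_single)

lemma wmono_zero [simp]: "wmono m (0 :: 'a::field_char_0) = 0"
  by (auto intro!: weyl_eqI)

lemma wmono_times_wmono:
  fixes c d :: "'a::field_char_0"
  shows "wmono (\<alpha>, \<beta>) c * wmono (\<gamma>, \<delta>) d = (\<Sum>\<kappa>\<in>common_expos \<beta> \<gamma>.
    wmono (\<alpha> + (\<gamma> - \<kappa>), (\<beta> - \<kappa>) + \<delta>) (c * d * of_nat (leibniz_coeff \<beta> \<gamma> \<kappa>)))"
proof (rule weyl_eqI)
  have "wcoeffs (wmono (\<alpha>, \<beta>) c * wmono (\<gamma>, \<delta>) d) = wmono_mult (\<alpha>, \<beta>) (\<gamma>, \<delta>) (c * d)"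
    by (subst wcoeffs_mult_superset[where A = "{(\<alpha>, \<beta>)}" and B = "{(\<gamma>, \<delta>)}"]) auto
  then show "wcoeffs (wmono (\<alpha>, \<beta>) c * wmono (\<gamma>, \<delta>) d) = wcoeffs (\<Sum>\<kappa>\<in>common_expos \<beta> \<gamma>.
    wmono (\<alpha> + (\<gamma> - \<kappa>), (\<beta> - \<kappa>) + \<delta>) (c * d * of_nat (leibniz_coeff \<beta> \<gamma> \<kappa>)))"
    by (simp add: wmono_mult_def wcoeffs_sum)
qed

lemma weyl_induct [case_names add mono]:
  assumes "\<And>a b. P a \<Longrightarrow> P b \<Longrightarrow> P (a + b)" "\<And>m c. P (wmono m c)"
  shows "P (a :: 'a::field_char_0 weyl)"
proof -
  have P0: "P 0" using assms(2)[of _ 0] by simp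
  have "P (\<Sum>m\<in>A. wmono m (lookup (wcoeffs a) m))" if "finite A" for A
    using that by (induction rule: finite_induct) (auto simp: assms P0)
  then show ?thesis using weyl_eq_sum_wmono[of a] by (metis finite_keys)
qed

subsection \<open>The action on polynomials and associativity\<close>

definition ffac :: "nat \<Rightarrow> nat \<Rightarrow> nat" where
  "ffac n k = fact k * (n choose k)"

definition ffacs :: "2 expo \<Rightarrow> 2 expo \<Rightarrow> nat" where
  "ffacs \<epsilon> \<beta> = (\<Prod>i\<in>UNIV. ffac (lookup \<epsilon> i) (lookup \<beta> i))"

definition act_mono :: "wexpo \<Rightarrow> 2 expo \<Rightarrow> 'a::comm_ring_1 \<Rightarrow> 'a R2" where
  "act_mono m \<epsilon> c = single ((\<epsilon> - snd m) + fst m) (c * of_nat (ffacs \<epsilon> (snd m)))"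

definition weyl_act :: "'a::field_char_0 weyl \<Rightarrow> 'a R2 \<Rightarrow> 'a R2" where
  "weyl_act a r = (\<Sum>m\<in>keys (wcoeffs a). \<Sum>\<epsilon>\<in>keys r.
     act_mono m \<epsilon> (lookup (wcoeffs a) m * lookup r \<epsilon>))"

lemma act_mono_simps [simp]:
  "act_mono m \<epsilon> 0 = 0" "act_mono m \<epsilon> (c + d) = act_mono m \<epsilon> c + act_mono m \<epsilon> d"
  by (auto simp: act_mono_def algebra_simps single_add)

lemma weyl_act_superset:
  assumes "finite A" "finite B" "keys (wcoeffs a) \<subseteq> A" "keys r \<subseteq> B"
  shows "weyl_act a r = (\<Sum>m\<in>A. \<Sum>\<epsilon>\<in>B. act_mono m \<epsilon> (lookup (wcoeffs a) m * lookup r \<epsilon>))"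
proof -
  have "weyl_act a r = (\<Sum>m\<in>keys (wcoeffs a). \<Sum>\<epsilon>\<in>B. act_mono m \<epsilon> (lookup (wcoeffs a) m * lookup r \<epsilon>))"
    unfolding weyl_act_def using assms
    by (intro sum.cong sum.mono_neutral_left refl) (auto simp: in_keys_iff)
  also have "\<dots> = (\<Sum>m\<in>A. \<Sum>\<epsilon>\<in>B. act_mono m \<epsilon> (lookup (wcoeffs a) m * lookup r \<epsilon>))"
    using assms by (intro sum.mono_neutral_left) (auto simp: in_keys_iff)
  finally show ?thesis .
qed

lemma weyl_act_add:
  "weyl_act (a + b) r = weyl_act a r + weyl_act b r"
  "weyl_act a (r + s) = weyl_act a r + weyl_act a s"
proof -
  have ab: "keys (wcoeffs (a + b)) \<subseteq> keys (wcoeffs a) \<union> keys (wcoeffs b)"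
    and rs: "keys (r + s) \<subseteq> keys r \<union> keys s"
    by (simp_all add: Poly_Mapping.keys_add)
  show "weyl_act (a + b) r = weyl_act a r + weyl_act b r"
    using ab by (simp add: weyl_act_superset[where A = "keys (wcoeffs a) \<union> keys (wcoeffs b)"
          and B = "keys r"] lookup_add algebra_simps sum.distrib)
  show "weyl_act a (r + s) = weyl_act a r + weyl_act a s"
    using rs by (simp add: weyl_act_superset[where A = "keys (wcoeffs a)"
          and B = "keys r \<union> keys s"] lookup_add algebra_simps sum.distrib)
qed

lemma weyl_act_zero [simp]: "weyl_act 0 r = 0" "weyl_act a 0 = 0"
  by (auto simp: weyl_act_def)

lemma weyl_act_sum:
  "weyl_act (\<Sum>i\<in>A. g i) r = (\<Sum>i\<in>A. weyl_act (g i) r)"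
  "weyl_act a (\<Sum>i\<in>A. h i) = (\<Sum>i\<in>A. weyl_act a (h i))"
  by (induction A rule: infinite_finite_induct) (auto simp: weyl_act_add)

lemma weyl_act_mono:
  "weyl_act (wmono (\<alpha>, \<beta>) c) (single \<epsilon> d) = single ((\<epsilon> - \<beta>) + \<alpha>) (c * d * of_nat (ffacs \<epsilon> \<beta>))"
  by (subst weyl_act_superset[where A = "{(\<alpha>, \<beta>)}" and B = "{\<epsilon>}"]) (auto simp: act_mono_def)

lemma ffac_eq_0_iff [simp]: "ffac n k = 0 \<longleftrightarrow> n < k"
  by (auto simp: ffac_def binomial_eq_0_iff)

lemma ffac_add: "ffac n (k + l) = ffac n k * ffac (n - k) l"
proof (cases "k + l \<le> n")
  case True
  have f: "ffac n k * fact (n - k) = fact n" if "k \<le> n" for n k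
    using binomial_fact_lemma[OF that] by (simp add: ffac_def mult_ac)
  have "ffac n (k + l) * fact (n - (k + l)) = ffac n k * ffac (n - k) l * fact (n - (k + l))"
    using f[of "k + l" n] f[of k n] f[of l "n - k"] True by (simp add: mult.assoc)
  then show ?thesis by simp
next
  case False
  then have "ffac n (k + l) = 0" "ffac n k = 0 \<or> ffac (n - k) l = 0" by auto
  then show ?thesis by (auto simp del: ffac_eq_0_iff)
qed

lemma ffac_leibniz:
  "(\<Sum>k\<le>min b g. (b choose k) * (g choose k) * fact k * ffac e ((b - k) + d))
   = ffac e d * ffac (e - d + g) b"
proof -
  have K: "(b choose k) * (g choose k) * fact k * ffac e ((b - k) + d)
      = ffac e d * (fact b * ((g choose k) * ((e - d) choose (b - k))))" if "k \<le> b" for k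
  proof -
    have e: "(b choose k) * fact k * fact (b - k) = fact b"
      using binomial_fact_lemma[OF that] by (simp add: mult_ac)
    show ?thesis unfolding add.commute[of "b - k" d] ffac_add ffac_def[of "e - d" "b - k"]
      unfolding e[symmetric] by (simp only: mult_ac)
  qed
  have "(\<Sum>k\<le>min b g. (b choose k) * (g choose k) * fact k * ffac e ((b - k) + d))
    = ffac e d * (fact b * (\<Sum>k\<le>min b g. (g choose k) * ((e - d) choose (b - k))))"
    unfolding sum_distrib_left by (rule sum.cong[OF refl], rule K) simp
  also have "(\<Sum>k\<le>min b g. (g choose k) * ((e - d) choose (b - k)))
    = (\<Sum>k\<le>b. (g choose k) * ((e - d) choose (b - k)))"
    by (rule sum.mono_neutral_left) (auto simp: not_le)
  also have "\<dots> = (g + (e - d)) choose b" by (rule vandermonde)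
  finally show ?thesis by (simp add: ffac_def add.commute)
qed

lemma sum_common_expos:
  fixes F :: "2 \<Rightarrow> nat \<Rightarrow> nat"
  shows "(\<Sum>\<kappa>\<in>common_expos \<beta> \<gamma>. \<Prod>i\<in>UNIV. F i (lookup \<kappa> i))
    = (\<Prod>i\<in>UNIV. \<Sum>k\<le>min (lookup \<beta> i) (lookup \<gamma> i). F i k)"
proof -
  show ?thesis
    apply (subst prod_sum_PiE)
      apply simp
     apply simp
    apply (rule sum.reindex_bij_witness[where i = Abs_poly_mapping and j = lookup])
        apply (auto simp: common_expos_def PiE_iff)
    done
qed

lemma single_sum_distrib: "single k (\<Sum>i\<in>A. g i) = (\<Sum>i\<in>A. single k (g i :: 'a::comm_monoid_add))"
  by (induction A rule: infinite_finite_induct) (auto simp: single_add)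

lemma weyl_act_mult_mono:
  "weyl_act (wmono (\<alpha>, \<beta>) c * wmono (\<gamma>, \<delta>) d) (single \<epsilon> e)
   = weyl_act (wmono (\<alpha>, \<beta>) c) (weyl_act (wmono (\<gamma>, \<delta>) d) (single \<epsilon> e))"
proof -
  let ?T = "(\<epsilon> - \<delta> + \<gamma> - \<beta>) + \<alpha>"
  let ?n = "\<lambda>\<kappa>. leibniz_coeff \<beta> \<gamma> \<kappa> * ffacs \<epsilon> ((\<beta> - \<kappa>) + \<delta>)"
  have "single (\<epsilon> - ((\<beta> - \<kappa>) + \<delta>) + (\<alpha> + (\<gamma> - \<kappa>))) (c * d * of_nat (leibniz_coeff \<beta> \<gamma> \<kappa>) * e *
      of_nat (ffacs \<epsilon> ((\<beta> - \<kappa>) + \<delta>))) = single ?T (c * d * e * of_nat (?n \<kappa>))"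
    if \<kappa>: "\<kappa> \<in> common_expos \<beta> \<gamma>" for \<kappa>
  proof (cases "ffacs \<epsilon> ((\<beta> - \<kappa>) + \<delta>) = 0")
    case False
    then have *: "lookup \<beta> i - lookup \<kappa> i + lookup \<delta> i \<le> lookup \<epsilon> i" for i
      by (auto simp: ffacs_def lookup_add lookup_minus not_less)
    have T: "\<epsilon> - ((\<beta> - \<kappa>) + \<delta>) + (\<alpha> + (\<gamma> - \<kappa>)) = ?T"
    proof (rule poly_mapping_eqI)
      fix i
      show "lookup (\<epsilon> - ((\<beta> - \<kappa>) + \<delta>) + (\<alpha> + (\<gamma> - \<kappa>))) i = lookup ?T i"
        using *[of i] \<kappa> by (auto simp: common_expos_def lookup_add lookup_minus
            dest!: spec[of _ i])
    qed
    show ?thesis unfolding T by (simp only: of_nat_mult mult_ac)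
  qed auto
  then have "weyl_act (wmono (\<alpha>, \<beta>) c * wmono (\<gamma>, \<delta>) d) (single \<epsilon> e)
    = (\<Sum>\<kappa>\<in>common_expos \<beta> \<gamma>. single ?T (c * d * e * of_nat (?n \<kappa>)))"
    unfolding wmono_times_wmono weyl_act_sum weyl_act_mono by (intro sum.cong refl) simp
  also have "\<dots> = single ?T (c * d * e * of_nat (\<Sum>\<kappa>\<in>common_expos \<beta> \<gamma>. ?n \<kappa>))"
    by (simp only: single_sum_distrib[symmetric] of_nat_sum sum_distrib_left)
  also have "(\<Sum>\<kappa>\<in>common_expos \<beta> \<gamma>. ?n \<kappa>) = ffacs \<epsilon> \<delta> * ffacs (\<epsilon> - \<delta> + \<gamma>) \<beta>"
  proof -
    have "(\<Sum>\<kappa>\<in>common_expos \<beta> \<gamma>. ?n \<kappa>) = (\<Sum>\<kappa>\<in>common_expos \<beta> \<gamma>. \<Prod>i\<in>UNIV.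
       (\<lambda>i k. (lookup \<beta> i choose k) * (lookup \<gamma> i choose k) * fact k *
         ffac (lookup \<epsilon> i) ((lookup \<beta> i - k) + lookup \<delta> i)) i (lookup \<kappa> i))"
      by (simp only: leibniz_coeff_def ffacs_def lookup_add lookup_minus prod.distrib)
    also have "\<dots> = ffacs \<epsilon> \<delta> * ffacs (\<epsilon> - \<delta> + \<gamma>) \<beta>"
      by (subst sum_common_expos)
         (simp only: ffac_leibniz ffacs_def lookup_add lookup_minus prod.distrib)
    finally show ?thesis .
  qed
  finally show ?thesis by (simp only: weyl_act_mono of_nat_mult mult_ac)
qed

lemma weyl_act_mult: "weyl_act (a * b) r = weyl_act a (weyl_act b r)"
proof (induction a rule: weyl_induct)
  case (mono m c)
  show ?case
  proof (induction b rule: weyl_induct)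
    case (mono n d)
    have "weyl_act (wmono m c * wmono n d) (\<Sum>\<epsilon>\<in>keys r. single \<epsilon> (lookup r \<epsilon>))
      = weyl_act (wmono m c) (weyl_act (wmono n d) (\<Sum>\<epsilon>\<in>keys r. single \<epsilon> (lookup r \<epsilon>)))"
      by (cases m; cases n) (simp add: weyl_act_sum weyl_act_mult_mono)
    then show ?case by (simp flip: poly_mapping_sum_single)
  qed (auto simp: weyl_distribs weyl_act_add)
qed (auto simp: weyl_distribs weyl_act_add)

lemma weyl_act_faithful:
  assumes "\<And>r. weyl_act a r = 0" shows "a = 0"
proof (rule ccontr)
  assume "a \<noteq> 0"
  then have ne: "keys (wcoeffs a) \<noteq> {}" by (metis sum.empty weyl_eq_sum_wmono)
  define m where "m = arg_min_on (\<lambda>n. tdeg (snd n)) (keys (wcoeffs a))"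
  obtain \<alpha> \<beta> where m: "m = (\<alpha>, \<beta>)" by (cases m)
  have mk: "(\<alpha>, \<beta>) \<in> keys (wcoeffs a)" unfolding m[symmetric] m_def using ne by (intro arg_min_if_finite) auto
  have min: "tdeg \<beta> \<le> tdeg \<delta>" if "(\<gamma>, \<delta>) \<in> keys (wcoeffs a)" for \<gamma> \<delta>
    using arg_min_least[OF finite_keys ne that, of "\<lambda>n. tdeg (snd n)"] m by (simp add: m_def)
  have zero: "act_mono (\<gamma>, \<delta>) \<beta> (lookup (wcoeffs a) (\<gamma>, \<delta>)) =
      (if \<delta> = \<beta> then single \<gamma> (lookup (wcoeffs a) (\<gamma>, \<delta>) * of_nat (ffacs \<beta> \<beta>)) else 0)"
    if k: "(\<gamma>, \<delta>) \<in> keys (wcoeffs a)" for \<gamma> \<delta>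
  proof (cases "\<forall>i. lookup \<delta> i \<le> lookup \<beta> i")
    case True
    have "\<delta> = \<beta>"
    proof (rule ccontr)
      assume "\<delta> \<noteq> \<beta>"
      then obtain i where "lookup \<delta> i \<noteq> lookup \<beta> i" by (meson poly_mapping_eqI)
      then have "tdeg \<delta> < tdeg \<beta>" unfolding tdeg_def using True
        by (intro sum_strict_mono_ex1) (auto simp: le_less)
      then show False using min[OF k] by simp
    qed
    then show ?thesis by (simp add: act_mono_def)
  next
    case False
    then have "ffacs \<beta> \<delta> = 0" "\<delta> \<noteq> \<beta>" by (auto simp: ffacs_def not_le)
    then show ?thesis by (simp add: act_mono_def)
  qed
  have "0 = lookup (weyl_act a (single \<beta> 1)) \<alpha>" by (simp add: assms)
  also have "weyl_act a (single \<beta> 1) = (\<Sum>m\<in>keys (wcoeffs a). act_mono m \<beta> (lookup (wcoeffs a) m))"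
    by (subst weyl_act_superset[where A = "keys (wcoeffs a)" and B = "{\<beta>}"]) auto
  also have "\<dots> = (\<Sum>m\<in>keys (wcoeffs a). if snd m = \<beta> then
      single (fst m) (lookup (wcoeffs a) m * of_nat (ffacs \<beta> \<beta>)) else 0)"
    by (intro sum.cong refl) (auto simp: zero split: prod.splits)
  also have "lookup \<dots> \<alpha> = (\<Sum>m\<in>keys (wcoeffs a). if m = (\<alpha>, \<beta>) then
      lookup (wcoeffs a) m * of_nat (ffacs \<beta> \<beta>) else 0)"
    unfolding lookup_sum by (intro sum.cong refl) (auto simp: lookup_single when_def)
  also have "\<dots> = lookup (wcoeffs a) (\<alpha>, \<beta>) * of_nat (ffacs \<beta> \<beta>)"
    using mk by simp
  finally show False using mk by (auto simp: in_keys_iff ffacs_def)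
qed

lemma weyl_act_diff: "weyl_act (a - b) r = weyl_act a r - weyl_act b r"
  using weyl_act_add(1)[of "a - b" b r] by simp

lemma weyl_eqI_act: "(\<And>r. weyl_act a r = weyl_act b r) \<Longrightarrow> a = b"
  using weyl_act_faithful[of "a - b"] by (simp add: weyl_act_diff)

lemma weyl_act_one: "weyl_act 1 r = r"
proof -
  have "weyl_act 1 (\<Sum>\<epsilon>\<in>keys r. single \<epsilon> (lookup r \<epsilon>)) = (\<Sum>\<epsilon>\<in>keys r. single \<epsilon> (lookup r \<epsilon>))"
    by (simp add: weyl_act_sum one_weyl_def weyl_act_mono ffacs_def ffac_def)
  then show ?thesis by (simp flip: poly_mapping_sum_single)
qed

instance weyl :: (field_char_0) ring_1
proof
  fix a b c :: "'a weyl"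
  show "a * b * c = a * (b * c)" by (rule weyl_eqI_act) (simp add: weyl_act_mult)
  show "1 * a = a" "a * 1 = a" by (auto intro!: weyl_eqI_act simp: weyl_act_mult weyl_act_one)
  show "(a + b) * c = a * c + b * c" "a * (b + c) = a * b + a * c" by (rule weyl_distribs)+
  have "lookup (wcoeffs (1 :: 'a weyl)) (0, 0) \<noteq> lookup (wcoeffs 0) (0, 0)" by simp
  then show "(0 :: 'a weyl) \<noteq> 1" by metis
qed

subsection \<open>Generators and relations\<close>

definition weyl_const :: "'a::field_char_0 \<Rightarrow> 'a weyl" where
  "weyl_const c = wmono (0, 0) c"

definition weyl_x :: "2 \<Rightarrow> 'a::field_char_0 weyl" where
  "weyl_x i = wmono (single i 1, 0) 1"

definition weyl_d :: "2 \<Rightarrow> 'a::field_char_0 weyl" where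
  "weyl_d i = wmono (0, single i 1) 1"

lemma weyl_eqI_single:
  assumes "\<And>\<epsilon> e. weyl_act a (single \<epsilon> e) = weyl_act b (single \<epsilon> e)" shows "a = b"
proof (rule weyl_eqI_act)
  fix r
  have "weyl_act a (\<Sum>\<epsilon>\<in>keys r. single \<epsilon> (lookup r \<epsilon>)) = weyl_act b (\<Sum>\<epsilon>\<in>keys r. single \<epsilon> (lookup r \<epsilon>))"
    by (simp only: weyl_act_sum assms)
  then show "weyl_act a r = weyl_act b r" by (simp only: poly_mapping_sum_single[symmetric])
qed

lemma ffacs_zero [simp]: "ffacs \<epsilon> 0 = 1"
  by (simp add: ffacs_def ffac_def)

lemma ffacs_single [simp]: "ffacs \<epsilon> (single i (Suc 0)) = lookup \<epsilon> i"
proof -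
  have "ffacs \<epsilon> (single i (Suc 0)) = (\<Prod>j\<in>UNIV. if j = i then lookup \<epsilon> j else 1)"
    unfolding ffacs_def by (intro prod.cong) (auto simp: lookup_single when_def ffac_def)
  then show ?thesis by simp
qed

lemma weyl_act_gens:
  "weyl_act (weyl_const c) (single \<epsilon> e) = single \<epsilon> (c * e)"
  "weyl_act (weyl_x i) (single \<epsilon> e) = single (\<epsilon> + single i 1) e"
  "weyl_act (weyl_d i) (single \<epsilon> e) = single (\<epsilon> - single i 1) (e * of_nat (lookup \<epsilon> i))"
  by (simp_all add: weyl_const_def weyl_x_def weyl_d_def weyl_act_mono)

lemmas act_simps = weyl_act_mult weyl_act_gens weyl_act_mono ffacs_zero of_nat_1 of_nat_mult
  mult_1_right mult_1_left add_0_left add_0_right diff_zero diff_diff_add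

lemma weyl_relations:
  fixes a :: "'a::field_char_0 weyl"
  shows "weyl_d i * weyl_x j = weyl_x j * weyl_d i + (if i = j then 1 else 0 :: 'a weyl)"
    "weyl_x i * weyl_x j = (weyl_x j * weyl_x i :: 'a weyl)"
    "weyl_d i * weyl_d j = (weyl_d j * weyl_d i :: 'a weyl)"
    "weyl_const c * a = a * weyl_const c"
proof -
  show "weyl_d i * weyl_x j = weyl_x j * weyl_d i + (if i = j then 1 else 0 :: 'a weyl)"
  proof (rule weyl_eqI_single)
    fix \<epsilon> :: "2 expo" and e :: 'a
    show "weyl_act (weyl_d i * weyl_x j) (single \<epsilon> e)
      = weyl_act (weyl_x j * weyl_d i + (if i = j then 1 else 0)) (single \<epsilon> e)"
    proof (cases "lookup \<epsilon> i = 0")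
      case True
      then show ?thesis
        by (auto simp: weyl_act_mult weyl_act_add weyl_act_gens weyl_act_one lookup_add lookup_single)
    next
      case False
      then have "\<epsilon> + single j 1 - single i 1 = \<epsilon> - single i 1 + single j 1"
        by (intro poly_mapping_eqI) (auto simp: lookup_add lookup_minus lookup_single when_def)
      then have "\<epsilon> + single j (Suc 0) - single i (Suc 0) = \<epsilon> - single i (Suc 0) + single j (Suc 0)"
        by simp
      moreover have "i = j \<Longrightarrow> \<epsilon> - single i (Suc 0) + single j (Suc 0) = \<epsilon>"
        using False
        by (intro poly_mapping_eqI) (auto simp: lookup_add lookup_minus lookup_single when_def)
      ultimately show ?thesis
        by (auto simp: weyl_act_mult weyl_act_add weyl_act_gens weyl_act_one lookup_add lookup_single
            algebra_simps when_def simp flip: single_add)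
    qed
  qed
  show "weyl_x i * weyl_x j = (weyl_x j * weyl_x i :: 'a weyl)"
    by (rule weyl_eqI_single) (simp only: act_simps add_ac)
  show "weyl_d i * weyl_d j = (weyl_d j * weyl_d i :: 'a weyl)"
  proof (cases "i = j")
    case False
    then have "lookup (single i (1 :: nat)) j = 0" "lookup (single j (1 :: nat)) i = 0"
      by (simp_all add: lookup_single)
    then show ?thesis
      by (intro weyl_eqI_single) (simp only: act_simps lookup_minus mult_ac add_ac)
  qed simp
  show "weyl_const c * a = a * weyl_const c"
  proof (induction a rule: weyl_induct)
    case (mono m d)
    show ?case
      by (cases m; rule weyl_eqI_single)
         (simp only: act_simps mult_ac)
  qed (simp add: algebra_simps)
qed

lemma weyl_const_hom: "ring_hom weyl_const"
proof -
  have "weyl_const (c + d) = weyl_const c + weyl_const d" for c d :: 'a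
    by (rule weyl_eqI) (simp add: weyl_const_def single_add)
  moreover have "weyl_const (c * d) = weyl_const c * weyl_const d" for c d :: 'a
    by (rule weyl_eqI_single) (simp only: act_simps mult_ac)
  ultimately show ?thesis by (simp add: ring_hom_def) (simp add: weyl_const_def one_weyl_def)
qed

lemma wmono_factor:
  "wmono (\<alpha>, \<beta>) c = weyl_const c * wmono (\<alpha>, 0) 1 * wmono (0, \<beta>) 1"
  "wmono (\<alpha> + single i 1, 0) 1 = weyl_x i * wmono (\<alpha>, 0) 1"
  "wmono (0, \<beta> + single i 1) 1 = weyl_d i * wmono (0, \<beta>) 1"
proof -
  show "wmono (\<alpha>, \<beta>) c = weyl_const c * wmono (\<alpha>, 0) 1 * wmono (0, \<beta>) 1"
    by (rule weyl_eqI_single) (simp only: act_simps mult_ac add_ac)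
  show "wmono (\<alpha> + single i 1, 0) 1 = weyl_x i * wmono (\<alpha>, 0) 1"
    by (rule weyl_eqI_single) (simp only: act_simps mult_ac add_ac)
  have "ffacs \<epsilon> (\<beta> + single i 1) = ffacs \<epsilon> \<beta> * lookup (\<epsilon> - \<beta>) i" for \<epsilon>
  proof -
    have "ffacs \<epsilon> (\<beta> + single i 1) = ffacs \<epsilon> \<beta> * ffacs (\<epsilon> - \<beta>) (single i (Suc 0))"
      by (simp add: ffacs_def lookup_add lookup_minus ffac_add prod.distrib)
    then show ?thesis by simp
  qed
  then show "wmono (0, \<beta> + single i 1) 1 = weyl_d i * wmono (0, \<beta>) 1"
    by (intro weyl_eqI_single) (simp only: act_simps mult_ac)
qed

lemma expo_induct [case_names zero add]:
  fixes \<alpha> :: "'v::finite expo"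
  assumes "P 0" "\<And>\<alpha> i. P \<alpha> \<Longrightarrow> P (\<alpha> + single i 1)"
  shows "P \<alpha>"
proof (induction "tdeg \<alpha>" arbitrary: \<alpha> rule: less_induct)
  case less
  show ?case
  proof (cases "\<alpha> = 0")
    case False
    then obtain i where i: "lookup \<alpha> i \<noteq> 0" by (metis lookup_zero poly_mapping_eqI)
    define \<alpha>' where "\<alpha>' = \<alpha> - single i 1"
    have eq: "\<alpha> = \<alpha>' + single i 1" using i unfolding \<alpha>'_def
      by (intro poly_mapping_eqI) (auto simp: lookup_add lookup_minus lookup_single when_def)
    have "(\<Sum>j\<in>UNIV. lookup (single i 1) j) = (1::nat)" by (simp add: lookup_single when_def)
    then have "tdeg \<alpha> = tdeg \<alpha>' + 1" unfolding eq tdeg_def lookup_add by (simp add: sum.distrib)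
    then show ?thesis using less[of \<alpha>'] assms(2) eq by simp
  qed (simp add: assms)
qed

lemma weyl_gen_induct [case_names const x d add mult]:
  fixes a :: "'a::field_char_0 weyl"
  assumes "\<And>c. P (weyl_const c)" "\<And>i. P (weyl_x i)" "\<And>i. P (weyl_d i)"
    and "\<And>a b. P a \<Longrightarrow> P b \<Longrightarrow> P (a + b)" "\<And>a b. P a \<Longrightarrow> P b \<Longrightarrow> P (a * b)"
  shows "P a"
proof (induction a rule: weyl_induct)
  case (mono m c)
  obtain \<alpha> \<beta> where m: "m = (\<alpha>, \<beta>)" by (cases m)
  have one: "P (wmono (0, 0) 1)" using assms(1)[of 1] by (simp add: weyl_const_def)
  have "P (wmono (\<alpha>, 0) 1)"
    by (induction \<alpha> rule: expo_induct) (simp_all only: one wmono_factor(2,3) assms)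
  moreover have "P (wmono (0, \<beta>) 1)"
    by (induction \<beta> rule: expo_induct) (simp_all only: one wmono_factor(2,3) assms)
  ultimately show ?case unfolding m wmono_factor(1)[of \<alpha> \<beta> c] by (intro assms)
qed (rule assms)

subsection \<open>The Fourier automorphism\<close>

text \<open>\<open>\<F>(x\<^sup>\<alpha>\<partial>\<^sup>\<beta>) = \<partial>\<^sup>\<alpha>(-x)\<^sup>\<beta>\<close>, extended linearly.\<close>

definition fourier_mono :: "wexpo \<Rightarrow> 'a::field_char_0 \<Rightarrow> 'a weyl" where
  "fourier_mono m c = weyl_const c * wmono (0, fst m) 1 * wmono (snd m, 0) ((-1) ^ tdeg (snd m))"

definition fourier :: "'a::field_char_0 weyl \<Rightarrow> 'a weyl" where
  "fourier a = (\<Sum>m\<in>keys (wcoeffs a). fourier_mono m (lookup (wcoeffs a) m))"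

lemmas weyl_const_simps = ring_hom_simps[OF weyl_const_hom]

lemma fourier_mono_simps [simp]:
  "fourier_mono m 0 = 0" "fourier_mono m (c + d) = fourier_mono m c + fourier_mono m d"
  by (simp_all add: fourier_mono_def weyl_const_simps algebra_simps)

lemma fourier_superset:
  assumes "finite A" "keys (wcoeffs a) \<subseteq> A"
  shows "fourier a = (\<Sum>m\<in>A. fourier_mono m (lookup (wcoeffs a) m))"
  unfolding fourier_def using assms by (intro sum.mono_neutral_left) (auto simp: in_keys_iff)

lemma fourier_add: "fourier (a + b) = fourier a + fourier b"
proof -
  have "keys (wcoeffs (a + b)) \<subseteq> keys (wcoeffs a) \<union> keys (wcoeffs b)"
    by (simp add: Poly_Mapping.keys_add)
  then show ?thesis
    by (simp add: fourier_superset[where A = "keys (wcoeffs a) \<union> keys (wcoeffs b)"]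
        lookup_add sum.distrib)
qed

lemma fourier_wmono: "fourier (wmono m c) = fourier_mono m c"
  by (subst fourier_superset[where A = "{m}"]) auto

lemma tdeg_add_single: "tdeg (\<alpha> + single i 1) = Suc (tdeg \<alpha>)"
proof -
  have "(\<Sum>j\<in>UNIV. lookup (single i 1) j) = (1::nat)" by (simp add: lookup_single when_def)
  then show ?thesis by (simp add: tdeg_def lookup_add sum.distrib)
qed

lemma wmono_uminus: "wmono m (- c) = - wmono m (c :: 'a::field_char_0)"
  by (rule weyl_eqI) (simp add: single_uminus)

lemma fourier_gens:
  fixes c :: "'a::field_char_0"
  shows "fourier (weyl_const c) = weyl_const c" "fourier (weyl_x i) = (weyl_d i :: 'a weyl)"
    "fourier (weyl_d i) = (- weyl_x i :: 'a weyl)"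
proof -
  have 0: "tdeg (0 :: 2 expo) = 0" by (simp add: tdeg_def)
  have t: "tdeg (single i 1) = Suc 0" for i :: 2 using tdeg_add_single[of 0 i] 0 by simp
  have "fourier (weyl_const c) = weyl_const c * 1 * 1"
    by (simp only: weyl_const_def fourier_wmono fourier_mono_def one_weyl_def 0 fst_conv snd_conv power_0)
  then show "fourier (weyl_const c) = weyl_const c" by simp
  have "fourier (weyl_x i) = weyl_const 1 * weyl_d i * (1 :: 'a weyl)"
    by (simp only: weyl_x_def weyl_d_def fourier_wmono fourier_mono_def one_weyl_def 0 fst_conv
        snd_conv power_0)
  then show "fourier (weyl_x i) = (weyl_d i :: 'a weyl)" by (simp add: weyl_const_simps)
  have "fourier (weyl_d i) = weyl_const 1 * (1 :: 'a weyl) * (- weyl_x i)"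
    by (simp only: weyl_x_def weyl_d_def fourier_wmono fourier_mono_def one_weyl_def t fst_conv
        snd_conv power_Suc power_0 mult_1_right wmono_uminus)
  then show "fourier (weyl_d i) = (- weyl_x i :: 'a weyl)" by (simp add: weyl_const_simps)
qed

lemma ffacs_add_single: "ffacs \<epsilon> (\<beta> + single i 1) = ffacs \<epsilon> \<beta> * lookup (\<epsilon> - \<beta>) i"
proof -
  have "ffacs \<epsilon> (\<beta> + single i 1) = ffacs \<epsilon> \<beta> * ffacs (\<epsilon> - \<beta>) (single i (Suc 0))"
    by (simp add: ffacs_def lookup_add lookup_minus ffac_add prod.distrib)
  then show ?thesis by simp
qed

lemma weyl_d_times_wmono:
  "weyl_d i * wmono (\<alpha>, \<beta>) c = wmono (\<alpha>, \<beta> + single i 1) c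
     + wmono (\<alpha> - single i 1, \<beta>) (of_nat (lookup \<alpha> i) * c)"
proof (rule weyl_eqI_single)
  fix \<epsilon> e
  define \<eta> where "\<eta> = \<epsilon> - \<beta>"
  define k where "k = c * e * of_nat (ffacs \<epsilon> \<beta>)"
  let ?s = "single i 1 :: 2 expo"
  have 1: "single (\<eta> - ?s + \<alpha>) (k * of_nat (lookup \<eta> i)) = single (\<eta> + \<alpha> - ?s) (k * of_nat (lookup \<eta> i))"
  proof (cases "lookup \<eta> i = 0")
    case False
    then have "\<eta> - ?s + \<alpha> = \<eta> + \<alpha> - ?s"
      by (intro poly_mapping_eqI) (auto simp: lookup_add lookup_minus lookup_single when_def)
    then show ?thesis by (simp only:)
  qed simp
  have 2: "single (\<eta> + (\<alpha> - ?s)) (k * of_nat (lookup \<alpha> i)) = single (\<eta> + \<alpha> - ?s) (k * of_nat (lookup \<alpha> i))"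
  proof (cases "lookup \<alpha> i = 0")
    case False
    then have "\<eta> + (\<alpha> - ?s) = \<eta> + \<alpha> - ?s"
      by (intro poly_mapping_eqI) (auto simp: lookup_add lookup_minus lookup_single when_def)
    then show ?thesis by (simp only:)
  qed simp
  have "weyl_act (weyl_d i * wmono (\<alpha>, \<beta>) c) (single \<epsilon> e)
    = single (\<eta> + \<alpha> - ?s) (k * of_nat (lookup \<eta> i + lookup \<alpha> i))"
    by (simp only: weyl_act_mult weyl_act_mono weyl_act_gens lookup_add \<eta>_def k_def)
  also have "\<dots> = single (\<eta> - ?s + \<alpha>) (k * of_nat (lookup \<eta> i))
      + single (\<eta> + (\<alpha> - ?s)) (k * of_nat (lookup \<alpha> i))"
    by (simp only: of_nat_add distrib_left single_add 1 2)
  also have "\<dots> = weyl_act (wmono (\<alpha>, \<beta> + ?s) c + wmono (\<alpha> - ?s, \<beta>) (of_nat (lookup \<alpha> i) * c)) (single \<epsilon> e)"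
    by (simp only: weyl_act_add weyl_act_mono ffacs_add_single \<eta>_def k_def of_nat_mult mult_ac
        diff_diff_add)
  finally show "weyl_act (weyl_d i * wmono (\<alpha>, \<beta>) c) (single \<epsilon> e)
    = weyl_act (wmono (\<alpha>, \<beta> + ?s) c + wmono (\<alpha> - ?s, \<beta>) (of_nat (lookup \<alpha> i) * c)) (single \<epsilon> e)" .
qed

lemma weyl_d_swap:
  "wmono (0, \<alpha>) (1 :: 'a::field_char_0) * weyl_x i = weyl_x i * wmono (0, \<alpha>) 1
     + weyl_const (of_nat (lookup \<alpha> i)) * wmono (0, \<alpha> - single i 1) 1"
proof (induction \<alpha> rule: expo_induct)
  case zero
  show ?case by (simp add: weyl_const_simps flip: one_weyl_def)
next
  case (add \<alpha> j)
  let ?n = "weyl_const (of_nat (lookup \<alpha> i)) :: 'a weyl"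
  have "wmono (0, \<alpha> + single j 1) (1 :: 'a) * weyl_x i = weyl_d j * (wmono (0, \<alpha>) 1 * weyl_x i)"
    by (simp only: wmono_factor(3) mult.assoc)
  also have "\<dots> = (weyl_d j * weyl_x i) * wmono (0, \<alpha>) 1
     + (weyl_d j * ?n) * wmono (0, \<alpha> - single i 1) 1"
    by (simp only: add.IH distrib_left mult.assoc)
  also have "(weyl_d j * ?n) * wmono (0, \<alpha> - single i 1) 1
    = ?n * (weyl_d j * wmono (0, \<alpha> - single i 1) 1)"
    by (simp only: weyl_relations(4)[of _ "weyl_d j", symmetric] mult.assoc)
  also have "(weyl_d j * weyl_x i) * wmono (0, \<alpha>) (1 :: 'a)
     = weyl_x i * wmono (0, \<alpha> + single j 1) 1 + (if j = i then wmono (0, \<alpha>) 1 else 0)"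
    unfolding weyl_relations(1) wmono_factor(3) by (simp add: distrib_right mult.assoc)
  also have "?n * (weyl_d j * wmono (0, \<alpha> - single i 1) 1)
     = ?n * wmono (0, \<alpha> + single j 1 - single i 1) 1"
  proof (cases "lookup \<alpha> i = 0")
    case False
    then have "\<alpha> + single j 1 - single i 1 = \<alpha> - single i 1 + single j 1"
      by (intro poly_mapping_eqI) (auto simp: lookup_add lookup_minus lookup_single when_def)
    then show ?thesis by (simp only: wmono_factor(3))
  qed (simp add: weyl_const_simps)
  finally have *: "wmono (0, \<alpha> + single j 1) (1 :: 'a) * weyl_x i
    = weyl_x i * wmono (0, \<alpha> + single j 1) 1 + (if j = i then wmono (0, \<alpha>) 1 else 0)
      + ?n * wmono (0, \<alpha> + single j 1 - single i 1) 1" .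
  show ?case
  proof (cases "j = i")
    case True
    have "lookup (\<alpha> + single j 1) i = 1 + lookup \<alpha> i" by (simp add: True lookup_add)
    then show ?thesis unfolding *
      by (simp only: True of_nat_add of_nat_1 weyl_const_simps distrib_right add.assoc mult_1_left
          add_diff_cancel_right' if_True refl)
  next
    case False
    then have "lookup (\<alpha> + single j 1) i = lookup \<alpha> i" by (simp add: lookup_add lookup_single)
    then show ?thesis unfolding * using False by (simp only: if_False add_0_right)
  qed
qed

lemma fourier_mult: "fourier (a * b) = fourier a * fourier b"
proof -
  have c: "fourier (weyl_const c * b) = weyl_const c * fourier b" for c and b :: "'a weyl"
  proof (induction b rule: weyl_induct)
    case (mono m d)
    have "weyl_const c * wmono m d = wmono m (c * d)"
      by (cases m, rule weyl_eqI_single) (simp only: act_simps mult_ac)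
    then show ?case by (simp add: fourier_wmono fourier_mono_def weyl_const_simps mult.assoc)
  qed (simp add: distrib_left fourier_add)
  have x: "fourier (weyl_x i * b) = weyl_d i * fourier b" for i and b :: "'a weyl"
  proof (induction b rule: weyl_induct)
    case (mono m d)
    obtain \<alpha> \<beta> where m: "m = (\<alpha>, \<beta>)" by (cases m)
    have "weyl_x i * wmono m d = wmono (\<alpha> + single i 1, \<beta>) d" unfolding m
      by (rule weyl_eqI_single) (simp only: act_simps mult_ac add_ac)
    moreover have "weyl_const d * (weyl_d i * wmono (0, \<alpha>) 1) = weyl_d i * (weyl_const d * wmono (0, \<alpha>) 1)"
      by (simp only: mult.assoc[symmetric] weyl_relations(4)[of d "weyl_d i"])
    ultimately show ?case
      by (simp only: m fourier_wmono fourier_mono_def fst_conv snd_conv wmono_factor(3) mult.assoc)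
  qed (simp add: distrib_left fourier_add)
  have d: "fourier (weyl_d i * b) = - weyl_x i * fourier b" for i and b :: "'a weyl"
  proof (induction b rule: weyl_induct)
    case (mono m d)
    obtain \<alpha> \<beta> where m: "m = (\<alpha>, \<beta>)" by (cases m)
    let ?X = "wmono (\<beta>, 0) ((-1) ^ tdeg \<beta>) :: 'a weyl"
    have "wmono (\<beta> + single i 1, 0) c = weyl_x i * wmono (\<beta>, 0) c" for c :: 'a
      by (rule weyl_eqI_single) (simp only: act_simps mult_ac add_ac)
    then have X: "wmono (\<beta> + single i 1, 0) ((-1) ^ Suc (tdeg \<beta>)) = - (weyl_x i * ?X)"
      by (simp only: power_Suc mult_minus1 wmono_uminus mult_minus_right)
    note weyl_d_times_wmono[of i \<alpha> \<beta> d]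
    then have "fourier (weyl_d i * wmono m d)
      = weyl_const d * wmono (0, \<alpha>) 1 * (- (weyl_x i * ?X))
        + weyl_const (of_nat (lookup \<alpha> i)) * weyl_const d * wmono (0, \<alpha> - single i 1) 1 * ?X"
      by (simp only: m fourier_add fourier_wmono fourier_mono_def fst_conv snd_conv tdeg_add_single X
          weyl_const_simps)
    also have "\<dots> = - (weyl_const d * (wmono (0, \<alpha>) 1 * weyl_x i
        - weyl_const (of_nat (lookup \<alpha> i)) * wmono (0, \<alpha> - single i 1) 1) * ?X)"
      unfolding weyl_relations(4)[of "of_nat (lookup \<alpha> i)" "weyl_const d"]
      by (simp only: mult.assoc left_diff_distrib right_diff_distrib mult_minus_right minus_diff_eq
          uminus_add_conv_diff)
    also have "\<dots> = - (weyl_const d * weyl_x i * wmono (0, \<alpha>) 1 * ?X)"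
      by (simp only: weyl_d_swap add_diff_cancel_right' mult.assoc)
    also have "\<dots> = - weyl_x i * fourier (wmono m d)"
      by (simp only: fourier_wmono fourier_mono_def m fst_conv snd_conv weyl_relations(4)[of d "weyl_x i"]
          mult.assoc mult_minus_left)
    finally show ?case .
  qed (simp add: algebra_simps fourier_add)
  show ?thesis
  proof (induction a arbitrary: b rule: weyl_gen_induct)
    case (add a a')
    then show ?case by (simp add: distrib_right fourier_add)
  next
    case (mult a a')
    then show ?case by (simp add: mult.assoc)
  qed (simp_all add: c x d fourier_gens)
qed

lemma fourier_automorphism: "ring_hom (fourier :: 'a::field_char_0 weyl \<Rightarrow> _)"
    "bij (fourier :: 'a weyl \<Rightarrow> _)"
proof -
  show hom: "ring_hom (fourier :: 'a weyl \<Rightarrow> _)"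
    unfolding ring_hom_def using fourier_gens(1)[of 1]
    by (simp add: weyl_const_simps fourier_add fourier_mult)
  note h = ring_hom_simps[OF hom]
  have "fourier (fourier (fourier (fourier a))) = a" for a :: "'a weyl"
    by (induction a rule: weyl_gen_induct) (simp_all add: fourier_gens fourier_add fourier_mult h)
  then show "bij (fourier :: 'a weyl \<Rightarrow> _)" by (intro bij_betw_byWitness[of _ "fourier \<circ> fourier \<circ> fourier"]) auto
qed

section \<open>Holonomic modules and b-functions\<close>

text \<open>For a finite index set \<open>A\<close>, \<open>D\<^sup>A\<close> is the set of functions into \<open>D\<close> vanishing outside \<open>A\<close>,
  and a left module with a given presentation is \<open>D\<^sup>A/N\<close> for a left submodule \<open>N\<close> of \<open>D\<^sup>A\<close>.\<close>

definition free_module :: "'i set \<Rightarrow> ('i \<Rightarrow> 'a::field_char_0 weyl) set" where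
  "free_module A = {v. \<forall>i. i \<notin> A \<longrightarrow> v i = 0}"

definition left_span :: "('i \<Rightarrow> 'a::field_char_0 weyl) set \<Rightarrow> ('i \<Rightarrow> 'a weyl) set" where
  "left_span B = {(\<lambda>i. \<Sum>b\<in>C. c b * b i) | C c. finite C \<and> C \<subseteq> B}"

definition weyl_scale :: "'a::field_char_0 \<Rightarrow> 'a weyl \<Rightarrow> 'a weyl" where
  "weyl_scale c a = weyl_const c * a"

definition vec_scale :: "'a::field_char_0 \<Rightarrow> ('i \<Rightarrow> 'a weyl) \<Rightarrow> 'i \<Rightarrow> 'a weyl" where
  "vec_scale c v = (\<lambda>i. weyl_scale c (v i))"

interpretation weyl_vs: vector_space "weyl_scale :: 'a::field_char_0 \<Rightarrow> _"
  by unfold_locales (simp_all add: weyl_scale_def weyl_const_simps algebra_simps)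

interpretation vec_vs: vector_space "vec_scale :: 'a::field_char_0 \<Rightarrow> ('i \<Rightarrow> 'a weyl) \<Rightarrow> _"
  by unfold_locales
     (simp_all add: vec_scale_def fun_eq_iff weyl_vs.scale_right_distrib weyl_vs.scale_left_distrib)

text \<open>The filtration of \<open>D\<^sup>A/N\<close> induced by the Bernstein filtration of \<open>D\<close> (with respect to the
  generators given by the presentation) is good; its \<open>k\<close>-th step has dimension
  \<open>bernstein_hilbert A N k\<close>. The Bernstein dimension is the degree of the polynomial with which this
  function agrees for large \<open>k\<close>. Since \<open>A\<close> is finite, the subtraction of dimensions is not truncated.\<close>

definition bernstein_filtration :: "'i set \<Rightarrow> nat \<Rightarrow> ('i \<Rightarrow> 'a::field_char_0 weyl) set" where
  "bernstein_filtration A k = {v \<in> free_module A.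
     \<forall>i\<in>A. \<forall>(\<alpha>, \<beta>)\<in>keys (wcoeffs (v i)). tdeg \<alpha> + tdeg \<beta> \<le> k}"

definition bernstein_hilbert :: "'i set \<Rightarrow> ('i \<Rightarrow> 'a::field_char_0 weyl) set \<Rightarrow> nat \<Rightarrow> nat" where
  "bernstein_hilbert A N k =
     vector_space.dim vec_scale (bernstein_filtration A k :: ('i \<Rightarrow> 'a weyl) set)
     - vector_space.dim vec_scale (bernstein_filtration A k \<inter> N)"

definition has_bernstein_dim :: "'i set \<Rightarrow> ('i \<Rightarrow> 'a::field_char_0 weyl) set \<Rightarrow> nat \<Rightarrow> bool" where
  "has_bernstein_dim A N n \<longleftrightarrow> (\<exists>\<chi> :: rat poly. \<chi> \<noteq> 0 \<and> degree \<chi> = n \<and>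
     (\<forall>\<^sub>F k in sequentially. of_nat (bernstein_hilbert A N k) = poly \<chi> (of_nat k)))"

definition holonomic :: "'i set \<Rightarrow> ('i \<Rightarrow> 'a::field_char_0 weyl) set \<Rightarrow> bool" where
  "holonomic A N \<longleftrightarrow> \<not> free_module A \<subseteq> N \<and> has_bernstein_dim A N 2"

definition weyl_weight :: "wexpo \<Rightarrow> int" where
  "weyl_weight m = int (tdeg (fst m)) - int (tdeg (snd m))"

definition initial_form :: "'a::field_char_0 weyl \<Rightarrow> 'a weyl" where
  "initial_form l = (\<Sum>m \<in> {m \<in> keys (wcoeffs l). \<forall>n \<in> keys (wcoeffs l). weyl_weight n \<le> weyl_weight m}.
     wmono m (lookup (wcoeffs l) m))"

definition initial_ideal :: "'a::field_char_0 weyl set \<Rightarrow> 'a weyl set" where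
  "initial_ideal J = module.span weyl_scale (initial_form ` J)"

definition weyl_s :: "'a::field_char_0 weyl" where
  "weyl_s = (\<Sum>i\<in>UNIV. - (weyl_x i * weyl_d i))"

definition weyl_poly :: "'a::field_char_0 poly \<Rightarrow> 'a weyl" where
  "weyl_poly p = (\<Sum>k\<le>degree p. weyl_const (coeff p k) * weyl_s ^ k)"

definition monic :: "'a::field_char_0 poly \<Rightarrow> bool" where
  "monic b \<longleftrightarrow> lead_coeff b = 1"

definition is_ideal_b_function :: "'a::field_char_0 weyl set \<Rightarrow> 'a poly \<Rightarrow> bool" where
  "is_ideal_b_function J b \<longleftrightarrow> monic b \<and> {p. weyl_poly p \<in> initial_ideal J} = {p. b dvd p}"

definition component_ideal :: "('i \<Rightarrow> 'a::field_char_0 weyl) set \<Rightarrow> 'i \<Rightarrow> 'a weyl set" where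
  "component_ideal N i = {l. (\<lambda>j. if j = i then l else 0) \<in> N}"

definition is_lcm :: "'i set \<Rightarrow> ('i \<Rightarrow> 'a::field_char_0 poly) \<Rightarrow> 'a poly \<Rightarrow> bool" where
  "is_lcm A B b \<longleftrightarrow> monic b \<and> (\<forall>p. b dvd p \<longleftrightarrow> (\<forall>i\<in>A. B i dvd p))"

definition is_b_function :: "'i set \<Rightarrow> ('i \<Rightarrow> 'a::field_char_0 weyl) set \<Rightarrow> 'a poly \<Rightarrow> bool" where
  "is_b_function A N b \<longleftrightarrow>
     (\<exists>B. (\<forall>i\<in>A. is_ideal_b_function (component_ideal N i) (B i)) \<and> is_lcm A B b)"

lemma monic_dvd_unique:
  fixes a b :: "'a::field_char_0 poly"
  assumes "monic a" "monic b" "a dvd b" "b dvd a" shows "a = b"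
proof -
  obtain c where c: "b = a * c" using assms(3) by (rule dvdE)
  have ne: "a \<noteq> 0" "b \<noteq> 0" using assms(1,2) by (auto simp: monic_def)
  have "degree b \<le> degree a" using ne assms(4) by (simp add: dvd_imp_degree_le)
  then have "degree c = 0" using ne by (auto simp: c degree_mult_eq)
  then obtain k where k: "c = [:k:]" by (rule degree_eq_zeroE)
  have "lead_coeff b = lead_coeff a * lead_coeff c" unfolding c by (rule lead_coeff_mult)
  then have "k = 1" using assms(1,2) k by (simp add: monic_def)
  then show ?thesis by (simp add: c k)
qed

lemma is_ideal_b_function_unique:
  assumes "is_ideal_b_function J a" "is_ideal_b_function J b" shows "a = b"
proof -
  have m: "monic a" "monic b" and eq: "{p. weyl_poly p \<in> initial_ideal J} = {p. a dvd p}"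
    "{p. weyl_poly p \<in> initial_ideal J} = {p. b dvd p}"
    using assms unfolding is_ideal_b_function_def by blast+
  from eq have "{p. a dvd p} = {p. b dvd p}" by (rule trans[OF sym])
  then have iff: "a dvd p \<longleftrightarrow> b dvd p" for p by blast
  show ?thesis using m iff[of a] iff[of b] by (intro monic_dvd_unique) simp_all
qed

lemma is_b_function_unique:
  assumes "is_b_function A N a" "is_b_function A N b" shows "a = b"
proof -
  obtain B where B: "\<And>i. i \<in> A \<Longrightarrow> is_ideal_b_function (component_ideal N i) (B i)" "is_lcm A B a"
    using assms(1) unfolding is_b_function_def by blast
  obtain B' where B': "\<And>i. i \<in> A \<Longrightarrow> is_ideal_b_function (component_ideal N i) (B' i)" "is_lcm A B' b"
    using assms(2) unfolding is_b_function_def by blast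
  have "B i = B' i" if "i \<in> A" for i using B(1) B'(1) that is_ideal_b_function_unique by blast
  then have iff: "a dvd p \<longleftrightarrow> b dvd p" for p using B(2) B'(2) unfolding is_lcm_def by simp
  have "monic a" "monic b" using B(2) B'(2) unfolding is_lcm_def by blast+
  then show ?thesis using iff[of a] iff[of b] by (intro monic_dvd_unique) simp_all
qed

section \<open>The module \<open>M\<close>\<close>

text \<open>\<open>\<phi>\<close> is the second map of a graded free resolution
  \<open>0 \<rightarrow> R(-d-\<mu>) \<oplus> R(-2d+\<mu>) \<rightarrow> R(-d)\<^sup>3 \<rightarrow> I \<rightarrow> 0\<close>; \<open>\<phi> i j\<close> is the entry in row \<open>i\<close> and column \<open>j\<close>. The ordering
  \<open>0 < \<mu> \<le> d - \<mu>\<close> of the columns is not required.\<close>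

definition hilbert_burch ::
    "(3 \<Rightarrow> 'a::field_char_0 R2) \<Rightarrow> nat \<Rightarrow> nat \<Rightarrow> (3 \<Rightarrow> 2 \<Rightarrow> 'a R2) \<Rightarrow> bool" where
  "hilbert_burch f d \<mu> \<phi> \<longleftrightarrow> \<mu> \<le> d \<and>
     (\<forall>i. homogeneous \<mu> (\<phi> i 0) \<and> homogeneous (d - \<mu>) (\<phi> i 1)) \<and>
     (\<forall>a. (\<Sum>i\<in>UNIV. a i * f i) = 0 \<longleftrightarrow> (\<exists>u. \<forall>i. a i = (\<Sum>j\<in>UNIV. \<phi> i j * u j))) \<and>
     (\<forall>u. (\<forall>i. (\<Sum>j\<in>UNIV. \<phi> i j * u j) = 0) \<longrightarrow> (\<forall>j. u j = 0))"

definition sym_eq :: "(3 \<Rightarrow> 2 \<Rightarrow> 'a::field_char_0 R2) \<Rightarrow> 2 \<Rightarrow> 'a RT" where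
  "sym_eq \<phi> j = linear_form (\<lambda>i. \<phi> i j)"

text \<open>\<open>\<T> = D[T\<^sub>1,T\<^sub>2,T\<^sub>3]\<close>; in a product of polynomials over \<open>D\<close> the variables are central.\<close>

type_synonym 'a DT = "3 expo \<Rightarrow>\<^sub>0 'a weyl"

definition weyl_of_R :: "'a::field_char_0 R2 \<Rightarrow> 'a weyl" where
  "weyl_of_R r = (\<Sum>\<alpha>\<in>keys r. wmono (\<alpha>, 0) (lookup r \<alpha>))"

definition DT_of_RT :: "'a::field_char_0 RT \<Rightarrow> 'a DT" where
  "DT_of_RT = Poly_Mapping.map weyl_of_R"

definition fourier_T :: "'a::field_char_0 DT \<Rightarrow> 'a DT" where
  "fourier_T = Poly_Mapping.map fourier"

definition L_op :: "(3 \<Rightarrow> 2 \<Rightarrow> 'a::field_char_0 R2) \<Rightarrow> 2 \<Rightarrow> 'a DT" where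
  "L_op \<phi> j = fourier_T (DT_of_RT (sym_eq \<phi> j))"

text \<open>The columns of \<open>H\<close> are indexed by the monomials of degree \<open>p - 2\<close>, its rows by the pairs
  \<open>(j, \<delta>)\<close> of an index of \<open>L\<^sub>j\<close> and a monomial of degree \<open>p - 1\<close>.\<close>

definition T_expos :: "nat \<Rightarrow> 3 expo set" where
  "T_expos n = {\<gamma>. tdeg \<gamma> = n}"

definition H_row :: "(3 \<Rightarrow> 2 \<Rightarrow> 'a::field_char_0 R2) \<Rightarrow> nat \<Rightarrow> 2 \<times> 3 expo \<Rightarrow> 3 expo \<Rightarrow> 'a weyl" where
  "H_row \<phi> p r = (\<lambda>\<gamma>. if \<gamma> \<in> T_expos (p - 2)
     then lookup (L_op \<phi> (fst r) * single \<gamma> 1) (snd r) else 0)"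

definition M_relations :: "(3 \<Rightarrow> 2 \<Rightarrow> 'a::field_char_0 R2) \<Rightarrow> nat \<Rightarrow> (3 expo \<Rightarrow> 'a weyl) set" where
  "M_relations \<phi> p = left_span (H_row \<phi> p ` (UNIV \<times> T_expos (p - 1)))"

end

theory Submission
  imports Defs
begin

text \<open>Write \<open>A = F[\<partial>\<^sub>1,\<partial>\<^sub>2]\<close>. The rows of \<open>H\<close> have entries in \<open>A\<close>, and \<open>D\<close> is free over \<open>A\<close> on the
  monomials \<open>x\<^sup>\<alpha>\<close>. Hence \<open>M = D \<otimes>\<^sub>A Q\<close>, where \<open>Q\<close> is the graded \<open>A\<close>-module with the same presentation,
  and all the invariants of \<open>M\<close> can be read off the graded dual of \<open>Q\<close>. This dual is Macaulay's inverse
  system \<open>E\<close>: the families \<open>w\<close> of coefficients \<open>w\<^sub>\<gamma>\<^sub>\<beta>\<close> that are annihilated by \<open>g\<^sub>1\<close> and \<open>g\<^sub>2\<close>, where the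
  variables \<open>x\<^sub>i\<close> act by contraction (\<open>inverse_system\<close>). An element of \<open>D\<^sup>m\<close> lies in \<open>N\<close> if and only if
  its coefficient of every \<open>x\<^sup>\<alpha>\<close>, a vector over \<open>A\<close>, pairs to zero with \<open>E\<close>
  (\<open>M_relations_eq_annihilator\<close>).

  The degrees in which \<open>E\<close> lives are those of the kernel, up to a reflection. The Koszul complex
  of \<open>g\<^sub>1, g\<^sub>2\<close> resolves \<open>Sym(I)\<close>, and \<open>\<K>\<^sub>p\<close> consists of the elements of \<open>Sym\<^sub>p(I)\<close> killed by a power of
  \<open>(x\<^sub>1,x\<^sub>2)\<close>. So local duality matches \<open>\<K>\<^sub>p\<^sub>,\<^sub>q\<close> with the part of \<open>E\<close> of degree \<open>d - 2 - q\<close>. Here this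
  duality is a diagram chase between two regular sequences, \<open>g\<^sub>1, g\<^sub>2\<close> and \<open>x\<^sub>1\<^sup>N, x\<^sub>2\<^sup>N\<close>. If
  \<open>x\<^sub>1\<^sup>N P = g\<^sub>1a\<^sub>1 + g\<^sub>2a\<^sub>2\<close> and \<open>x\<^sub>2\<^sup>N P = g\<^sub>1b\<^sub>1 + g\<^sub>2b\<^sub>2\<close>, then there is \<open>W\<close> with
  \<open>g\<^sub>2W = x\<^sub>2\<^sup>Na\<^sub>1 - x\<^sub>1\<^sup>Nb\<^sub>1\<close> and \<open>-g\<^sub>1W = x\<^sub>2\<^sup>Na\<^sub>2 - x\<^sub>1\<^sup>Nb\<^sub>2\<close>, and conversely. Moreover \<open>P \<in> (g\<^sub>1,g\<^sub>2)\<close> if and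
  only if \<open>W \<in> (x\<^sub>1\<^sup>N,x\<^sub>2\<^sup>N)\<close> (\<open>linkage_membership\<close>). The coefficients of \<open>W\<close> at the monomials outside
  \<open>(x\<^sub>1\<^sup>N,x\<^sub>2\<^sup>N)\<close>, counted backwards from \<open>(x\<^sub>1x\<^sub>2)\<^sup>N\<^sup>-\<^sup>1\<close>, form an element of \<open>E\<close>
  (\<open>kernel_piece_nonzero_iff_inverse_system\<close>). Two facts are needed for this. First, \<open>I\<close> contains all
  forms of large degree, by a dimension count along the resolution (\<open>ideal_contains_large_degrees\<close>);
  therefore \<open>\<K>\<^sub>p\<close> is the torsion described above. Second, \<open>g\<^sub>1, g\<^sub>2\<close> is a regular sequence
  (\<open>koszul_exact_sym_eq\<close>).

  Since the kernel has no elements of negative degree, \<open>E\<close> is finite-dimensional. By minimality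
  the entries of \<open>\<phi>\<close> have positive degree, so the constants lie in \<open>E\<close> and \<open>E\<close> is nonzero. Consequently \<open>M\<close>
  is free over \<open>F[x]\<close> on a finite graded basis, and its Hilbert function is a quadratic polynomial
  (\<open>has_bernstein_dim_annihilator\<close>). For the b-function, a polynomial \<open>p(s)\<close> has a normal form
  \<open>\<Sum> c\<^sub>\<alpha>x\<^sup>\<alpha>\<partial>\<^sup>\<alpha>\<close>, and it lies in \<open>J\<^sub>\<gamma>\<close> if and only if \<open>c\<^sub>\<alpha> = 0\<close> for all exponents \<open>\<alpha>\<close> that occur in \<open>E\<close> at the
  index \<open>\<gamma>\<close>. This set of exponents is closed under division, and \<open>p(s)x\<^sup>\<epsilon> = p(-|\<epsilon>|)x\<^sup>\<epsilon>\<close>, so the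
  condition is a triangular system equivalent to \<open>p(-|\<alpha>|) = 0\<close> for these \<open>\<alpha>\<close>. Thus the roots of the
  b-function are simple and are the negatives of the degrees of \<open>E\<close> (\<open>is_b_function_annihilator\<close>).\<close>

text \<open>With the product as scalar multiplication, this rewrite rule reverses associativity.\<close>
declare self_module.scale_scale [simp del]

section \<open>Monomials and bihomogeneous components\<close>

lemma UNIV_2: "(UNIV :: 2 set) = {0, 1}"
proof -
  have "{0, 1 :: 2} = UNIV" by (rule card_subset_eq) auto
  then show ?thesis by simp
qed

lemma tdeg_add [simp]: "tdeg (\<alpha> + \<beta>) = tdeg \<alpha> + tdeg \<beta>"
  by (simp add: tdeg_def lookup_add sum.distrib)

lemma tdeg_single [simp]: "tdeg (single i n) = n"
  by (simp add: tdeg_def lookup_single when_def)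

lemma tdeg_zero [simp]: "tdeg 0 = 0"
  by (simp add: tdeg_def)

lemma tdeg_2: "tdeg (\<alpha> :: 2 expo) = lookup \<alpha> 0 + lookup \<alpha> 1"
  by (simp add: tdeg_def UNIV_2)

lemma lookup_le_tdeg: "lookup \<alpha> i \<le> tdeg \<alpha>"
  unfolding tdeg_def by (rule member_le_sum) auto

lemma expo_diff_add:
  fixes \<alpha> \<beta> :: "'v expo"
  assumes "\<And>i. lookup \<beta> i \<le> lookup \<alpha> i" shows "\<alpha> - \<beta> + \<beta> = \<alpha>"
  using assms by (intro poly_mapping_eqI) (simp add: lookup_add lookup_minus)

lemma expo_add_eq_iff:
  fixes \<alpha> \<beta> \<kappa> :: "'v expo"
  shows "\<beta> + \<kappa> = \<alpha> \<longleftrightarrow> (\<forall>i. lookup \<beta> i \<le> lookup \<alpha> i) \<and> \<kappa> = \<alpha> - \<beta>"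
  by (auto simp: lookup_add expo_diff_add add.commute[of \<beta>])

lemma finite_expos_le: "finite {\<alpha> :: 'v::finite expo. \<forall>i. lookup \<alpha> i \<le> n}"
proof -
  have "{\<alpha> :: 'v expo. \<forall>i. lookup \<alpha> i \<le> n} \<subseteq> Abs_poly_mapping ` (UNIV \<rightarrow>\<^sub>E {..n})"
  proof
    fix \<alpha> :: "'v expo" assume "\<alpha> \<in> {\<alpha>. \<forall>i. lookup \<alpha> i \<le> n}"
    then have "lookup \<alpha> \<in> UNIV \<rightarrow>\<^sub>E {..n}" by auto
    then show "\<alpha> \<in> Abs_poly_mapping ` (UNIV \<rightarrow>\<^sub>E {..n})" by (rule rev_image_eqI) simp
  qed
  then show ?thesis by (rule finite_subset) (auto intro!: finite_PiE)
qed

lemma finite_expos_tdeg_le: "finite {\<alpha> :: 'v::finite expo. tdeg \<alpha> \<le> n}"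
  by (rule finite_subset[OF _ finite_expos_le[of n]]) (auto intro: order_trans[OF lookup_le_tdeg])

lemma finite_expos_tdeg: "finite {\<alpha> :: 'v::finite expo. tdeg \<alpha> = n}"
  by (rule finite_subset[OF _ finite_expos_tdeg_le[of n]]) auto

lemma finite_T_expos [simp]: "finite (T_expos n)"
  unfolding T_expos_def by (rule finite_expos_tdeg)

lemma poly_mapping_induct [case_names add single]:
  fixes P :: "'k \<Rightarrow>\<^sub>0 'c::comm_monoid_add"
  assumes add: "\<And>P Q. \<Phi> P \<Longrightarrow> \<Phi> Q \<Longrightarrow> \<Phi> (P + Q)" and single: "\<And>k c. \<Phi> (single k c)"
  shows "\<Phi> P"
proof -
  have sum: "\<Phi> (sum g A)" if "finite A" "\<And>k. \<Phi> (g k)" for g :: "'k \<Rightarrow> _" and A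
    using that by induction (auto intro: add simp: single[of _ 0, simplified])
  have "P = (\<Sum>k\<in>keys P. single k (lookup P k))"
    by (rule poly_mapping_eqI) (auto simp: lookup_sum lookup_single when_def in_keys_iff sum.delta)
  then show ?thesis using sum[of "keys P" "\<lambda>k. single k (lookup P k)"] single by simp
qed

lemma RT_induct [case_names add mono]:
  fixes P :: "'c::comm_ring_1 RT"
  assumes add: "\<And>P Q. \<Phi> P \<Longrightarrow> \<Phi> Q \<Longrightarrow> \<Phi> (P + Q)" and mono: "\<And>\<gamma> \<alpha> c. \<Phi> (single \<gamma> (single \<alpha> c))"
  shows "\<Phi> P"
proof (induction P rule: poly_mapping_induct)
  case (single \<gamma> r)
  show ?case by (induction r rule: poly_mapping_induct) (auto simp: single_add add mono)
qed (rule add)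

lemma RT_eq_sum_monomials:
  "(P :: 'c::comm_ring_1 RT) = (\<Sum>\<gamma>\<in>keys P. \<Sum>\<alpha>\<in>keys (lookup P \<gamma>). single \<gamma> (single \<alpha> (lookup (lookup P \<gamma>) \<alpha>)))"
  by (simp only: single_sum_distrib[symmetric] poly_mapping_sum_single[symmetric])

lemma lookup_monomial_mult:
  fixes P :: "'v::finite expo \<Rightarrow>\<^sub>0 'c::comm_ring_1"
  shows "lookup (single \<beta> c * P) \<alpha> = (if \<forall>i. lookup \<beta> i \<le> lookup \<alpha> i then c * lookup P (\<alpha> - \<beta>) else 0)"
proof (induction P rule: poly_mapping_induct)
  case (single \<kappa> d)
  show ?case using expo_add_eq_iff[of \<beta> \<kappa> \<alpha>] by (auto simp: mult_single lookup_single when_def)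
qed (simp add: distrib_left lookup_add)

lemma lookup_const_mult: "lookup (single 0 r * P) \<gamma> = r * lookup (P :: 'v::finite expo \<Rightarrow>\<^sub>0 'c::comm_ring_1) \<gamma>"
  by (simp add: lookup_monomial_mult)

definition hom_part :: "int \<Rightarrow> 'c::zero R2 \<Rightarrow> 'c R2" where
  "hom_part q r = Poly_Mapping.mapp (\<lambda>\<alpha> c. c when int (tdeg \<alpha>) = q) r"

text \<open>The degrees are integers so that shifts are total; components of negative degree vanish.\<close>

definition bi_part :: "int \<Rightarrow> int \<Rightarrow> 'c::zero RT \<Rightarrow> 'c RT" where
  "bi_part p q P = Poly_Mapping.mapp (\<lambda>\<gamma> r. hom_part q r when int (tdeg \<gamma>) = p) P"

lemma lookup_hom_part: "lookup (hom_part q r) \<alpha> = (if int (tdeg \<alpha>) = q then lookup r \<alpha> else 0)"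
  by (auto simp: hom_part_def lookup_mapp when_def in_keys_iff)

lemma hom_part_add: "hom_part q (r + s) = hom_part q r + hom_part q (s :: 'c::comm_ring_1 R2)"
  by (rule poly_mapping_eqI) (simp add: lookup_hom_part lookup_add)

lemma hom_part_zero [simp]: "hom_part q 0 = 0"
  by (rule poly_mapping_eqI) (simp add: lookup_hom_part)

lemma hom_part_single: "hom_part q (single \<alpha> c) = (if int (tdeg \<alpha>) = q then single \<alpha> c else 0)"
  by (rule poly_mapping_eqI) (auto simp: lookup_hom_part lookup_single when_def)

lemma lookup_bi_part: "lookup (bi_part p q P) \<gamma> = (if int (tdeg \<gamma>) = p then hom_part q (lookup P \<gamma>) else 0)"
  by (auto simp: bi_part_def lookup_mapp when_def in_keys_iff)

lemma bi_part_add: "bi_part p q (P + Q) = bi_part p q P + bi_part p q (Q :: 'c::comm_ring_1 RT)"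
  by (rule poly_mapping_eqI) (simp add: lookup_bi_part lookup_add hom_part_add)

lemma bi_part_zero [simp]: "bi_part p q 0 = 0"
  by (rule poly_mapping_eqI) (simp add: lookup_bi_part)

lemma bi_part_uminus: "bi_part p q (- P) = - bi_part p q (P :: 'c::comm_ring_1 RT)"
  using bi_part_add[of p q P "- P"] by (simp add: eq_neg_iff_add_eq_0 add.commute)

lemma bi_part_diff: "bi_part p q (P - Q) = bi_part p q P - bi_part p q (Q :: 'c::comm_ring_1 RT)"
  using bi_part_add[of p q P "- Q"] by (simp add: bi_part_uminus)

lemma bi_part_sum: "bi_part p q (\<Sum>i\<in>A. g i) = (\<Sum>i\<in>A. bi_part p q (g i :: 'c::comm_ring_1 RT))"
  by (induction A rule: infinite_finite_induct) (auto simp: bi_part_add)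

lemma bi_part_mono:
  "bi_part p q (single \<gamma> (single \<alpha> c)) =
     (if int (tdeg \<gamma>) = p \<and> int (tdeg \<alpha>) = q then single \<gamma> (single \<alpha> (c :: 'c::comm_ring_1)) else 0)"
  by (rule poly_mapping_eqI) (auto simp: lookup_bi_part lookup_single when_def hom_part_single)

lemma hom_part_mult:
  fixes g r :: "'c::comm_ring_1 R2"
  assumes "homogeneous n g" shows "hom_part (int n + q) (g * r) = g * hom_part q r"
proof -
  have mono: "hom_part (int (tdeg \<alpha>) + q) (single \<alpha> c * r) = single \<alpha> c * hom_part q r" for \<alpha> c
    by (induction r rule: poly_mapping_induct)
       (auto simp: hom_part_add distrib_left mult_single hom_part_single)
  have sum: "hom_part k (\<Sum>i\<in>A. h i) = (\<Sum>i\<in>A. hom_part k (h i :: 'c R2))" for A and h :: "2 expo \<Rightarrow> _" and k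
    by (induction A rule: infinite_finite_induct) (auto simp: hom_part_add)
  have "g * r = (\<Sum>\<alpha>\<in>keys g. single \<alpha> (lookup g \<alpha>) * r)"
    by (simp only: sum_distrib_right[symmetric] poly_mapping_sum_single[symmetric])
  then have "hom_part (int n + q) (g * r) = (\<Sum>\<alpha>\<in>keys g. hom_part (int n + q) (single \<alpha> (lookup g \<alpha>) * r))"
    by (simp add: sum)
  also have "\<dots> = (\<Sum>\<alpha>\<in>keys g. single \<alpha> (lookup g \<alpha>) * hom_part q r)"
    using assms mono by (intro sum.cong refl) (auto simp: homogeneous_def)
  also have "\<dots> = g * hom_part q r"
    by (simp only: sum_distrib_right[symmetric] poly_mapping_sum_single[symmetric])
  finally show ?thesis .
qed

lemma bi_part_mult:
  fixes g P :: "'c::comm_ring_1 RT"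
  assumes "bihomogeneous p' q' g"
  shows "bi_part (int p' + p) (q' + q) (g * P) = g * bi_part p q P"
proof -
  have mono: "bi_part (int (tdeg \<gamma>) + p) (int (tdeg \<alpha>) + q) (single \<gamma> (single \<alpha> c) * P)
      = single \<gamma> (single \<alpha> c) * bi_part p q P" for \<gamma> \<alpha> c
    by (induction P rule: RT_induct)
       (auto simp: bi_part_add distrib_left mult_single bi_part_mono)
  let ?m = "\<lambda>\<gamma> \<alpha>. single \<gamma> (single \<alpha> (lookup (lookup g \<gamma>) \<alpha>))"
  have gP: "g * Q = (\<Sum>\<gamma>\<in>keys g. \<Sum>\<alpha>\<in>keys (lookup g \<gamma>). ?m \<gamma> \<alpha> * Q)" for Q
    by (subst RT_eq_sum_monomials[of g]) (simp only: sum_distrib_right)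
  have "bi_part (int p' + p) (q' + q) (g * P) =
     (\<Sum>\<gamma>\<in>keys g. \<Sum>\<alpha>\<in>keys (lookup g \<gamma>). bi_part (int p' + p) (q' + q) (?m \<gamma> \<alpha> * P))"
    unfolding gP by (simp only: bi_part_sum)
  also have "\<dots> = (\<Sum>\<gamma>\<in>keys g. \<Sum>\<alpha>\<in>keys (lookup g \<gamma>). ?m \<gamma> \<alpha> * bi_part p q P)"
  proof (intro sum.cong refl)
    fix \<gamma> \<alpha> assume "\<gamma> \<in> keys g" "\<alpha> \<in> keys (lookup g \<gamma>)"
    then have "tdeg \<gamma> = p'" "int (tdeg \<alpha>) = q'" using assms by (auto simp: bihomogeneous_def)
    then show "bi_part (int p' + p) (q' + q) (?m \<gamma> \<alpha> * P) = ?m \<gamma> \<alpha> * bi_part p q P"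
      using mono[of \<gamma> \<alpha>] by blast
  qed
  also have "\<dots> = g * bi_part p q P" unfolding gP ..
  finally show ?thesis .
qed

lemma bihomogeneous_bi_part: "bihomogeneous p q (bi_part (int p) q P)"
  by (auto simp: bihomogeneous_def lookup_bi_part lookup_hom_part in_keys_iff split: if_splits)

lemma bi_part_bihomogeneous:
  assumes "bihomogeneous p q P" shows "bi_part (int p) q P = P"
proof (rule poly_mapping_eqI)
  fix \<gamma>
  show "lookup (bi_part (int p) q P) \<gamma> = lookup P \<gamma>"
  proof (cases "\<gamma> \<in> keys P")
    case True
    then have "hom_part q (lookup P \<gamma>) = lookup P \<gamma>"
      using assms True unfolding bihomogeneous_def
      by (intro poly_mapping_eqI) (metis in_keys_iff lookup_hom_part)
    then show ?thesis using True assms by (auto simp: lookup_bi_part bihomogeneous_def)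
  next
    case False
    then show ?thesis by (auto simp: lookup_bi_part in_keys_iff)
  qed
qed

section \<open>Linkage\<close>

text \<open>The Koszul complex on \<open>g, h\<close> is exact in the middle.\<close>

definition koszul_exact :: "'r::comm_ring_1 \<Rightarrow> 'r \<Rightarrow> bool" where
  "koszul_exact g h \<longleftrightarrow> (\<forall>a b. g * a + h * b = 0 \<longrightarrow> (\<exists>u. a = h * u \<and> b = - (g * u)))"

lemma koszul_exactD:
  "koszul_exact g h \<Longrightarrow> g * a + h * b = 0 \<Longrightarrow> \<exists>u. a = h * u \<and> b = - (g * u)"
  by (auto simp: koszul_exact_def)

text \<open>The next two lemmas chase the double complex formed by the Koszul complexes on \<open>g, h\<close> and on
  \<open>z, y\<close>: elements \<open>P\<close> with \<open>(z,y)P \<subseteq> (g,h)\<close> and elements \<open>W\<close> with \<open>(g,h)W \<subseteq> (z,y)\<close> determine each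
  other.\<close>

lemma linkage_forward:
  assumes gh: "koszul_exact g h" and P: "z * P = g * a\<^sub>1 + h * a\<^sub>2" "y * P = g * b\<^sub>1 + h * b\<^sub>2"
  shows "\<exists>W. h * W = y * a\<^sub>1 - z * b\<^sub>1 \<and> - (g * W) = y * a\<^sub>2 - z * b\<^sub>2"
proof -
  have "g * (y * a\<^sub>1 - z * b\<^sub>1) + h * (y * a\<^sub>2 - z * b\<^sub>2)
      = y * (g * a\<^sub>1 + h * a\<^sub>2) - z * (g * b\<^sub>1 + h * b\<^sub>2)" by (simp add: algebra_simps)
  also have "\<dots> = y * (z * P) - z * (y * P)" by (simp only: P)
  also have "\<dots> = 0" by (simp add: mult.left_commute)
  finally obtain W where "y * a\<^sub>1 - z * b\<^sub>1 = h * W" "y * a\<^sub>2 - z * b\<^sub>2 = - (g * W)"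
    using koszul_exactD[OF gh] by blast
  then show ?thesis by (intro exI[of _ W]) simp
qed

lemma linkage_backward:
  assumes zy: "koszul_exact z y" and W: "h * W = y * a\<^sub>1 - z * b\<^sub>1" "- (g * W) = y * a\<^sub>2 - z * b\<^sub>2"
  shows "\<exists>P. z * P = g * a\<^sub>1 + h * a\<^sub>2 \<and> y * P = g * b\<^sub>1 + h * b\<^sub>2"
proof -
  have "z * - (g * b\<^sub>1 + h * b\<^sub>2) + y * (g * a\<^sub>1 + h * a\<^sub>2)
      = g * (y * a\<^sub>1 - z * b\<^sub>1) + h * (y * a\<^sub>2 - z * b\<^sub>2)" by (simp add: algebra_simps)
  also have "\<dots> = g * (h * W) + h * - (g * W)" by (simp only: W)
  also have "\<dots> = 0" by (simp add: mult.left_commute)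
  finally obtain u where "- (g * b\<^sub>1 + h * b\<^sub>2) = y * u" "g * a\<^sub>1 + h * a\<^sub>2 = - (z * u)"
    using koszul_exactD[OF zy] by blast
  then have "z * - u = g * a\<^sub>1 + h * a\<^sub>2" "y * - u = g * b\<^sub>1 + h * b\<^sub>2"
    by (simp_all only: mult_minus_right minus_equation_iff[of "g * b\<^sub>1 + h * b\<^sub>2"])
  then show ?thesis by blast
qed

text \<open>Hence \<open>((g,h) : (z,y))/(g,h)\<close> and \<open>((z,y) : (g,h))/(z,y)\<close> are isomorphic: in both directions
  the exactness of the other Koszul complex corrects the representatives \<open>a\<^sub>i, b\<^sub>i\<close>.\<close>

lemma linkage_membership:
  fixes g h z y :: "'r::idom"
  assumes gh: "koszul_exact g h" and zy: "koszul_exact z y" and ne: "h \<noteq> 0" "z \<noteq> 0"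
    and P: "z * P = g * a\<^sub>1 + h * a\<^sub>2" "y * P = g * b\<^sub>1 + h * b\<^sub>2"
    and W: "h * W = y * a\<^sub>1 - z * b\<^sub>1" "- (g * W) = y * a\<^sub>2 - z * b\<^sub>2"
  shows "(\<exists>c\<^sub>1 c\<^sub>2. P = g * c\<^sub>1 + h * c\<^sub>2) \<longleftrightarrow> (\<exists>u v. W = y * u - z * v)"
proof
  assume "\<exists>c\<^sub>1 c\<^sub>2. P = g * c\<^sub>1 + h * c\<^sub>2"
  then obtain c\<^sub>1 c\<^sub>2 where c: "P = g * c\<^sub>1 + h * c\<^sub>2" by blast
  have "g * (a\<^sub>1 - z * c\<^sub>1) + h * (a\<^sub>2 - z * c\<^sub>2) = (g * a\<^sub>1 + h * a\<^sub>2) - z * (g * c\<^sub>1 + h * c\<^sub>2)"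
    by (simp add: algebra_simps)
  also have "\<dots> = 0" by (simp only: P(1)[symmetric] c diff_self)
  finally obtain u where u: "a\<^sub>1 - z * c\<^sub>1 = h * u" using koszul_exactD[OF gh] by blast
  have "g * (b\<^sub>1 - y * c\<^sub>1) + h * (b\<^sub>2 - y * c\<^sub>2) = (g * b\<^sub>1 + h * b\<^sub>2) - y * (g * c\<^sub>1 + h * c\<^sub>2)"
    by (simp add: algebra_simps)
  also have "\<dots> = 0" by (simp only: P(2)[symmetric] c diff_self)
  finally obtain v where v: "b\<^sub>1 - y * c\<^sub>1 = h * v" using koszul_exactD[OF gh] by blast
  have "h * W = y * (a\<^sub>1 - z * c\<^sub>1) - z * (b\<^sub>1 - y * c\<^sub>1)" unfolding W(1) by (simp add: algebra_simps)
  also have "\<dots> = h * (y * u - z * v)" unfolding u v by (simp add: algebra_simps)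
  finally show "\<exists>u v. W = y * u - z * v" using ne by auto
next
  assume "\<exists>u v. W = y * u - z * v"
  then obtain u v where w: "W = y * u - z * v" by blast
  have "z * (b\<^sub>1 - h * v) + y * - (a\<^sub>1 - h * u) = h * (y * u - z * v) - (y * a\<^sub>1 - z * b\<^sub>1)"
    by (simp add: algebra_simps)
  also have "\<dots> = 0" by (simp only: W(1)[symmetric] w diff_self)
  finally obtain c\<^sub>1 where "- (a\<^sub>1 - h * u) = - (z * c\<^sub>1)" using koszul_exactD[OF zy] by blast
  then have c1: "a\<^sub>1 = h * u + z * c\<^sub>1" by (simp only: neg_equal_iff_equal diff_eq_eq add.commute)
  have "z * (b\<^sub>2 + g * v) + y * - (a\<^sub>2 + g * u) = - (g * (y * u - z * v)) - (y * a\<^sub>2 - z * b\<^sub>2)"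
    by (simp add: algebra_simps)
  also have "\<dots> = 0" by (simp only: W(2)[symmetric] w diff_self)
  finally obtain c\<^sub>2 where "- (a\<^sub>2 + g * u) = - (z * c\<^sub>2)" using koszul_exactD[OF zy] by blast
  then have c2: "a\<^sub>2 = z * c\<^sub>2 - g * u" by (simp only: neg_equal_iff_equal eq_diff_eq)
  have "z * P = z * (g * c\<^sub>1 + h * c\<^sub>2)" unfolding P(1) c1 c2 by (simp add: algebra_simps)
  then show "\<exists>c\<^sub>1 c\<^sub>2. P = g * c\<^sub>1 + h * c\<^sub>2" using ne by auto
qed

section \<open>The regular sequence of powers of the variables\<close>

definition xpow :: "2 \<Rightarrow> nat \<Rightarrow> 'c::comm_ring_1 RT" where
  "xpow i N = single 0 (single (single i N) 1)"

lemma xpow_nonzero: "(xpow i N :: 'c::field_char_0 RT) \<noteq> 0"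
proof
  assume "(xpow i N :: 'c RT) = 0"
  then have "lookup (lookup (xpow i N :: 'c RT) 0) (single i N) = 0" by simp
  then show False by (simp add: xpow_def)
qed

lemma bihomogeneous_xpow: "bihomogeneous 0 (int N) (xpow i N :: 'c::field_char_0 RT)"
  by (simp add: bihomogeneous_def xpow_def)

lemma lookup_xpow_mult:
  "lookup (lookup (xpow i N * P) \<gamma>) \<alpha> =
     (if N \<le> lookup \<alpha> i then lookup (lookup P \<gamma>) (\<alpha> - single i N) else 0)"
  by (auto simp: xpow_def lookup_const_mult lookup_monomial_mult lookup_single when_def)

lemma xpow_dvd_mono:
  assumes "N \<le> lookup \<alpha> i"
  shows "single \<gamma> (single \<alpha> c) = xpow i N * single \<gamma> (single (\<alpha> - single i N) c)"
proof -
  have "single i N + (\<alpha> - single i N) = \<alpha>"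
    using assms by (intro poly_mapping_eqI) (auto simp: lookup_add lookup_minus lookup_single when_def)
  then show ?thesis by (simp add: xpow_def mult_single)
qed

lemma xpow_dvd:
  assumes "\<And>\<gamma> \<alpha>. lookup (lookup P \<gamma>) \<alpha> \<noteq> 0 \<Longrightarrow> N \<le> lookup \<alpha> i"
  shows "\<exists>Q. P = xpow i N * Q"
proof -
  let ?Q = "\<Sum>\<gamma>\<in>keys P. \<Sum>\<alpha>\<in>keys (lookup P \<gamma>). single \<gamma> (single (\<alpha> - single i N) (lookup (lookup P \<gamma>) \<alpha>))"
  have "P = (\<Sum>\<gamma>\<in>keys P. \<Sum>\<alpha>\<in>keys (lookup P \<gamma>). single \<gamma> (single \<alpha> (lookup (lookup P \<gamma>) \<alpha>)))"
    by (rule RT_eq_sum_monomials)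
  also have "\<dots> = xpow i N * ?Q" unfolding sum_distrib_left
    by (intro sum.cong refl xpow_dvd_mono assms) (simp add: in_keys_iff)
  finally show ?thesis by blast
qed

lemma koszul_exact_xpow: "koszul_exact (xpow 0 N) (xpow 1 N :: 'c::field_char_0 RT)"
  unfolding koszul_exact_def
proof (intro allI impI)
  fix a b :: "'c RT"
  assume eq: "xpow 0 N * a + xpow 1 N * b = 0"
  have "\<exists>u. a = xpow 1 N * u"
  proof (rule xpow_dvd)
    fix \<gamma> \<alpha> assume nz: "lookup (lookup a \<gamma>) \<alpha> \<noteq> 0"
    have "lookup (lookup (xpow 0 N * a) \<gamma>) (\<alpha> + single 0 N) = lookup (lookup a \<gamma>) \<alpha>"
      by (simp add: lookup_xpow_mult lookup_add)
    moreover have "lookup (lookup (xpow 0 N * a + xpow 1 N * b) \<gamma>) (\<alpha> + single 0 N) = 0"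
      unfolding eq by simp
    ultimately have "lookup (lookup (xpow 1 N * b) \<gamma>) (\<alpha> + single 0 N) \<noteq> 0"
      using nz unfolding lookup_add by (metis add.right_neutral)
    then have "N \<le> lookup (\<alpha> + single 0 N) 1" unfolding lookup_xpow_mult by argo
    then show "N \<le> lookup \<alpha> 1" by (simp add: lookup_add lookup_single)
  qed
  then obtain u where u: "a = xpow 1 N * u" by blast
  have "xpow 1 N * (xpow 0 N * u + b) = 0" using eq by (simp add: u algebra_simps)
  then have "b = - (xpow 0 N * u)" using xpow_nonzero[of 1 N, where 'c = 'c]
    by (simp add: eq_neg_iff_add_eq_0 add.commute)
  then show "\<exists>u. a = xpow 1 N * u \<and> b = - (xpow 0 N * u)" using u by blast
qed

lemma xpow_ideal_iff:
  "(\<exists>u v. P = xpow 1 N * u - xpow 0 N * (v :: 'c::field_char_0 RT)) \<longleftrightarrow>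
    (\<forall>\<gamma> \<alpha>. lookup (lookup P \<gamma>) \<alpha> \<noteq> 0 \<longrightarrow> N \<le> lookup \<alpha> 0 \<or> N \<le> lookup \<alpha> 1)"
proof
  assume "\<exists>u v. P = xpow 1 N * u - xpow 0 N * v"
  then obtain u v where P: "P = xpow 1 N * u - xpow 0 N * v" by blast
  have "lookup (lookup P \<gamma>) \<alpha> = lookup (lookup (xpow 1 N * u) \<gamma>) \<alpha> - lookup (lookup (xpow 0 N * v) \<gamma>) \<alpha>" for \<gamma> \<alpha>
    unfolding P lookup_minus ..
  then show "\<forall>\<gamma> \<alpha>. lookup (lookup P \<gamma>) \<alpha> \<noteq> 0 \<longrightarrow> N \<le> lookup \<alpha> 0 \<or> N \<le> lookup \<alpha> 1"
    by (simp only: lookup_xpow_mult) (auto split: if_splits)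
next
  assume big: "\<forall>\<gamma> \<alpha>. lookup (lookup P \<gamma>) \<alpha> \<noteq> 0 \<longrightarrow> N \<le> lookup \<alpha> 0 \<or> N \<le> lookup \<alpha> 1"
  let ?I = "\<lambda>P :: 'c RT. \<exists>u v. P = xpow 1 N * u - xpow 0 N * v"
  have "(0 :: 'c RT) = xpow 1 N * 0 - xpow 0 N * 0" by simp
  then have zero: "?I 0" by blast
  have add: "?I (P + Q)" if PQ: "?I P" "?I Q" for P Q
  proof -
    obtain u v u' v' where "P = xpow 1 N * u - xpow 0 N * v" "Q = xpow 1 N * u' - xpow 0 N * v'"
      using PQ by blast
    then have "P + Q = xpow 1 N * (u + u') - xpow 0 N * (v + v')"
      by (simp only: distrib_left add_diff_eq diff_add_eq diff_diff_eq add_ac)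
    then show ?thesis by blast
  qed
  have sum: "?I (sum h A)" if "finite A" "\<And>k. k \<in> A \<Longrightarrow> ?I (h k)" for h :: "'k \<Rightarrow> 'c RT" and A
    using that
  proof (induction A rule: finite_induct)
    case (insert k A)
    then show ?case using add[of "h k" "sum h A"] by simp
  qed (use zero in simp)
  have mono: "?I (single \<gamma> (single \<alpha> c))" if "N \<le> lookup \<alpha> 0 \<or> N \<le> lookup \<alpha> 1" for \<gamma> \<alpha> c
    using that
  proof
    assume "N \<le> lookup \<alpha> 0"
    then have "single \<gamma> (single \<alpha> c) = xpow 1 N * 0 - xpow 0 N * (- single \<gamma> (single (\<alpha> - single 0 N) c))"
      using xpow_dvd_mono[of N \<alpha> 0 \<gamma> c] by simp
    then show ?thesis by blast
  next
    assume "N \<le> lookup \<alpha> 1"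
    then have "single \<gamma> (single \<alpha> c) = xpow 1 N * single \<gamma> (single (\<alpha> - single 1 N) c) - xpow 0 N * 0"
      using xpow_dvd_mono[of N \<alpha> 1 \<gamma> c] by simp
    then show ?thesis by blast
  qed
  have "?I (\<Sum>\<gamma>\<in>keys P. \<Sum>\<alpha>\<in>keys (lookup P \<gamma>). single \<gamma> (single \<alpha> (lookup (lookup P \<gamma>) \<alpha>)))"
    using big by (intro sum mono) (auto simp: in_keys_iff)
  then show "?I P" by (simp only: RT_eq_sum_monomials[symmetric])
qed

section \<open>Dimension counts\<close>

lemma (in vector_space) spans_disjoint:
  assumes D: "independent D" and CD: "C \<subseteq> D" and fin: "finite D"
    and x: "x \<in> span C" "x \<in> span (D - C)"
  shows "x = 0"
proof -
  have fC: "finite C" using CD fin by (rule finite_subset)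
  obtain a where a: "x = (\<Sum>v\<in>C. scale (a v) v)" using x(1) fC by (auto simp: span_finite)
  obtain b where b: "x = (\<Sum>v\<in>D - C. scale (b v) v)" using x(2) fin by (auto simp: span_finite)
  define u where "u v = (if v \<in> C then a v else - b v)" for v
  have "(\<Sum>v\<in>D. scale (u v) v) = (\<Sum>v\<in>C. scale (u v) v) + (\<Sum>v\<in>D - C. scale (u v) v)"
    by (subst sum.subset_diff[OF CD fin]) (rule add.commute)
  also have "(\<Sum>v\<in>C. scale (u v) v) = x" unfolding a by (intro sum.cong) (auto simp: u_def)
  also have "(\<Sum>v\<in>D - C. scale (u v) v) = - x"
    unfolding b sum_negf[symmetric] by (intro sum.cong) (auto simp: u_def)
  finally have "u v = 0" if "v \<in> D" for v
    by (intro independentD[OF D fin subset_refl _ that]) (simp only: add.right_inverse)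
  then have "a v = 0" if "v \<in> C" for v using that CD unfolding u_def by (metis subsetD)
  then show "x = 0" unfolding a by simp
qed

lemma (in vector_space_pair) rank_nullity:
  assumes f: "Vector_Spaces.linear s1 s2 f" and V: "vs1.subspace V" and B: "finite B" "V \<subseteq> vs1.span B"
  shows "vs1.dim V = vs2.dim (f ` V) + vs1.dim (V \<inter> {x. f x = 0})"
proof -
  interpret f: Vector_Spaces.linear s1 s2 f by (rule f)
  let ?K = "V \<inter> {x. f x = 0}"
  have K: "vs1.subspace ?K" by (intro vs1.subspace_inter V f.subspace_kernel)
  obtain C where C: "C \<subseteq> ?K" "vs1.independent C" "?K \<subseteq> vs1.span C" "card C = vs1.dim ?K"
    by (rule vs1.basis_exists)
  obtain D where D: "C \<subseteq> D" "D \<subseteq> V" "vs1.independent D" "V \<subseteq> vs1.span D"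
    by (rule vs1.maximal_independent_subset_extend[OF _ C(2), of V]) (use C(1) in auto)
  have fin: "finite D" using vs1.independent_span_bound[OF B(1) D(3)] D(2) B(2) by blast
  then have finC: "finite C" using D(1) finite_subset by blast
  have spanC: "vs1.span C \<subseteq> ?K" using C(1) K by (rule vs1.span_minimal)
  have spanD: "vs1.span (D - C) \<subseteq> V" using D(2) V by (intro vs1.span_minimal) auto
  have inj': "inj_on f (vs1.span (D - C))"
  proof (rule inj_onI)
    fix x y assume xy: "x \<in> vs1.span (D - C)" "y \<in> vs1.span (D - C)" "f x = f y"
    then have d: "x - y \<in> vs1.span (D - C)" by (intro vs1.span_diff)
    moreover have "f (x - y) = 0" using xy(3) by (simp add: f.diff)
    ultimately have "x - y \<in> vs1.span C" using spanD C(3) by auto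
    then have "x - y = 0" using vs1.spans_disjoint[OF D(3,1) fin] d by blast
    then show "x = y" by simp
  qed
  have "vs1.independent (D - C)" using D(3) by (rule vs1.independent_mono) auto
  then have ind: "vs2.independent (f ` (D - C))" using inj' by (rule f.independent_injective_image)
  have inj: "inj_on f (D - C)" using inj' vs1.span_superset by (rule inj_on_subset)
  have "f ` V \<subseteq> vs2.span (f ` (D - C))"
  proof
    fix y assume "y \<in> f ` V"
    moreover have "C \<union> (D - C) = D" using D(1) by blast
    ultimately obtain x where x: "x \<in> vs1.span (C \<union> (D - C))" "y = f x"
      using D(4) by auto
    then obtain k r where "x = k + r" "k \<in> vs1.span C" "r \<in> vs1.span (D - C)"
      unfolding vs1.span_Un by blast
    moreover from this have "f k = 0" using spanC by blast
    ultimately show "y \<in> vs2.span (f ` (D - C))"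
      using x(2) by (simp add: f.add f.span_image)
  qed
  moreover have "f ` (D - C) \<subseteq> f ` V" using D(2) by auto
  ultimately have "vs2.dim (f ` V) = card (f ` (D - C))"
    using ind by (intro vs2.basis_card_eq_dim[symmetric])
  also have "\<dots> = card D - card C"
    using inj D(1) fin finC by (simp add: card_image card_Diff_subset)
  finally show ?thesis
    using vs1.basis_card_eq_dim[OF D(2,4,3)] C(4) card_mono[OF fin D(1)] by simp
qed

lemma (in vector_space) subspace_eq_if_dim_eq:
  assumes ST: "S \<subseteq> T" and S: "subspace S" and B: "finite B" "T \<subseteq> span B" and dim: "dim S = dim T"
  shows "S = T"
proof (rule ccontr)
  assume "S \<noteq> T"
  then obtain x where x: "x \<in> T" "x \<notin> S" using ST by blast
  obtain C where C: "C \<subseteq> S" "independent C" "S \<subseteq> span C" "card C = dim S" by (rule basis_exists)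
  obtain D where D: "D \<subseteq> T" "independent D" "T \<subseteq> span D" "card D = dim T" by (rule basis_exists)
  have finD: "finite D" using independent_span_bound[OF B(1) D(2)] D(1) B(2) by blast
  have "C \<subseteq> span B" using C(1) ST B(2) by blast
  then have finC: "finite C" using independent_span_bound[OF B(1) C(2)] by blast
  have "x \<notin> span C" using x(2) span_minimal[OF C(1) S] by blast
  then have "independent (insert x C)" using C(2) by (rule independent_insertI)
  moreover have "x \<notin> C" using \<open>x \<notin> span C\<close> span_base by blast
  moreover have "insert x C \<subseteq> span D" using x(1) C(1) ST D(3) by blast
  ultimately have "Suc (card C) \<le> card D"
    using independent_span_bound[OF finD] finC by fastforce
  then show False using C(4) D(4) dim by simp
qed

lemma (in vector_space) dim_eq_card_coordinates:
  assumes fin: "finite X"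
    and lin: "\<And>x u v. c x (u + v) = c x u + c x v" "\<And>x k u. c x (scale k u) = k * c x u"
    and dual: "\<And>x y. x \<in> X \<Longrightarrow> y \<in> X \<Longrightarrow> c x (e y) = (if x = y then 1 else 0)"
    and e: "\<And>x. x \<in> X \<Longrightarrow> e x \<in> V" and V: "\<And>v. v \<in> V \<Longrightarrow> v = (\<Sum>x\<in>X. scale (c x v) (e x))"
  shows "dim V = card X" "finite (e ` X)" "V \<subseteq> span (e ` X)"
proof -
  have inj: "inj_on e X"
  proof (rule inj_onI, rule ccontr)
    fix x y assume "x \<in> X" "y \<in> X" "e x = e y" "x \<noteq> y"
    then show False using dual[of x x] dual[of x y] by simp
  qed
  have c0: "c x 0 = 0" for x using lin(2)[of x 0 0] by simp
  have csum: "c x (sum h A) = (\<Sum>y\<in>A. c x (h y))" for x h and A :: "'d set"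
    by (induction A rule: infinite_finite_induct) (auto simp: lin c0)
  have "independent (e ` X)"
  proof (rule independent_if_scalars_zero)
    fix g v assume sum: "(\<Sum>v\<in>e ` X. scale (g v) v) = 0" and "v \<in> e ` X"
    then obtain x where x: "x \<in> X" "v = e x" by blast
    have "0 = c x (\<Sum>y\<in>X. scale (g (e y)) (e y))"
      using sum by (simp add: sum.reindex[OF inj] c0)
    also have "\<dots> = (\<Sum>y\<in>X. if y = x then g (e y) else 0)"
      unfolding csum by (intro sum.cong refl) (use x in \<open>auto simp: lin dual\<close>)
    also have "\<dots> = g v" using x fin by simp
    finally show "g v = 0" by simp
  qed (use fin in simp)
  moreover show span: "V \<subseteq> span (e ` X)"
  proof
    fix v assume "v \<in> V"
    then have "v = (\<Sum>x\<in>X. scale (c x v) (e x))" by (rule V)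
    also have "\<dots> \<in> span (e ` X)" by (intro span_sum span_scale span_base imageI)
    finally show "v \<in> span (e ` X)" .
  qed
  moreover have "e ` X \<subseteq> V" using e by auto
  ultimately have "card (e ` X) = dim V" by (intro basis_card_eq_dim)
  then show "dim V = card X" by (simp add: card_image inj)
  show "finite (e ` X)" using fin by simp
qed

lemma expos_tdeg_eq_image: "{\<alpha> :: 2 expo. tdeg \<alpha> = n} = (\<lambda>k. single 0 k + single 1 (n - k)) ` {..n}"
proof -
  have "\<alpha> = single 0 (lookup \<alpha> 0) + single 1 (tdeg \<alpha> - lookup \<alpha> 0)" for \<alpha> :: "2 expo"
  proof (rule poly_mapping_eqI)
    fix i :: 2
    have "i = 0 \<or> i = 1" using UNIV_2 by blast
    then show "lookup \<alpha> i = lookup (single 0 (lookup \<alpha> 0) + single 1 (tdeg \<alpha> - lookup \<alpha> 0)) i"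
      by (auto simp: lookup_add lookup_single tdeg_2)
  qed
  moreover have "lookup \<alpha> 0 \<le> tdeg \<alpha>" for \<alpha> :: "2 expo" by (rule lookup_le_tdeg)
  ultimately show ?thesis by auto
qed

lemma card_expos_tdeg: "card {\<alpha> :: 2 expo. tdeg \<alpha> = n} = n + 1"
proof -
  have "inj_on (\<lambda>k. single 0 k + single 1 (n - k) :: 2 expo) {..n}"
  proof (rule inj_onI)
    fix k l assume "single 0 k + single 1 (n - k) = (single 0 l + single 1 (n - l) :: 2 expo)"
    then have "lookup (single 0 k + single 1 (n - k) :: 2 expo) 0 = lookup (single 0 l + single 1 (n - l) :: 2 expo) 0"
      by simp
    then show "k = l" by (simp add: lookup_add lookup_single)
  qed
  then show ?thesis unfolding expos_tdeg_eq_image by (simp add: card_image)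
qed

text \<open>Families of polynomials over an index type treat the modules \<open>R\<^sup>3\<close>, \<open>R\<^sup>2\<close> and \<open>R\<close> of the resolution
  uniformly; the last one has the index type \<open>1\<close>.\<close>

definition family_scale :: "'c::field_char_0 \<Rightarrow> ('i \<Rightarrow> 'c R2) \<Rightarrow> 'i \<Rightarrow> 'c R2" where
  "family_scale c a = (\<lambda>i. single 0 c * a i)"

interpretation family: vector_space "family_scale :: 'c::field_char_0 \<Rightarrow> ('i \<Rightarrow> 'c R2) \<Rightarrow> _"
proof -
  have *: "single 0 (c + d) = single 0 c + (single 0 d :: 'c R2)" for c d by (rule single_add)
  show "vector_space (family_scale :: 'c \<Rightarrow> ('i \<Rightarrow> 'c R2) \<Rightarrow> _)"
    by unfold_locales
       (auto simp: family_scale_def fun_eq_iff distrib_left distrib_right * mult_single mult.assoc[symmetric])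
qed

interpretation family_pair: vector_space_pair
  "family_scale :: 'c::field_char_0 \<Rightarrow> ('i \<Rightarrow> 'c R2) \<Rightarrow> _" "family_scale :: 'c \<Rightarrow> ('j \<Rightarrow> 'c R2) \<Rightarrow> _" ..

definition homogeneous_families :: "('i \<Rightarrow> nat) \<Rightarrow> ('i \<Rightarrow> 'c::field_char_0 R2) set" where
  "homogeneous_families e = {a. \<forall>i. homogeneous (e i) (a i)}"

lemma homogeneous_iff: "homogeneous n r \<longleftrightarrow> (\<forall>\<alpha>. lookup r \<alpha> \<noteq> 0 \<longrightarrow> tdeg \<alpha> = n)"
  by (auto simp: homogeneous_def in_keys_iff)

lemma subspace_homogeneous_families: "family.subspace (homogeneous_families e)"
  by (rule family.subspaceI)
     (auto simp: homogeneous_families_def family_scale_def homogeneous_iff lookup_add lookup_const_mult,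
      metis add.right_neutral)

lemma dim_homogeneous_families:
  fixes e :: "'i::finite \<Rightarrow> nat"
  shows "family.dim (homogeneous_families e :: ('i \<Rightarrow> 'c::field_char_0 R2) set) = (\<Sum>i\<in>UNIV. e i + 1)"
    and "\<exists>B. finite B \<and> (homogeneous_families e :: ('i \<Rightarrow> 'c R2) set) \<subseteq> family.span B"
proof -
  let ?X = "SIGMA i:UNIV. {\<alpha> :: 2 expo. tdeg \<alpha> = e i}"
  let ?c = "\<lambda>(i, \<alpha>) a. lookup (a i :: 'c R2) \<alpha>"
  let ?e = "\<lambda>(i, \<alpha>) j. if j = i then single \<alpha> (1 :: 'c) else 0"
  have fin: "finite ?X" by (intro finite_SigmaI finite_expos_tdeg) auto
  have V: "a = (\<Sum>x\<in>?X. family_scale (?c x a) (?e x))" if a: "a \<in> homogeneous_families e"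
    for a :: "'i \<Rightarrow> 'c R2"
  proof (rule ext, rule poly_mapping_eqI)
    fix j \<beta>
    have fs: "(sum h A) j = (\<Sum>x\<in>A. h x j)" for h :: "'i \<times> 2 expo \<Rightarrow> 'i \<Rightarrow> 'c R2" and A
      by (induction A rule: infinite_finite_induct) auto
    have "lookup ((\<Sum>x\<in>?X. family_scale (?c x a) (?e x)) j) \<beta>
        = (\<Sum>x\<in>?X. if x = (j, \<beta>) then lookup (a j) \<beta> else 0)"
      unfolding fs lookup_sum
      by (intro sum.cong refl) (auto simp: family_scale_def lookup_const_mult lookup_single when_def split: if_splits)
    also have "\<dots> = lookup (a j) \<beta>"
      using a fin by (auto simp: homogeneous_families_def homogeneous_iff)
    finally show "lookup (a j) \<beta> = lookup ((\<Sum>x\<in>?X. family_scale (?c x a) (?e x)) j) \<beta>" by simp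
  qed
  have e: "?e x \<in> homogeneous_families e" if "x \<in> ?X" for x
    using that by (auto simp: homogeneous_families_def homogeneous_iff lookup_single when_def split: if_splits)
  note d = family.dim_eq_card_coordinates[of ?X ?c ?e "homogeneous_families e", OF fin _ _ _ e V]
  have "family.dim (homogeneous_families e :: ('i \<Rightarrow> 'c R2) set) = card ?X"
    by (rule d) (auto simp: lookup_add family_scale_def lookup_const_mult lookup_single when_def split: if_splits)
  then show "family.dim (homogeneous_families e :: ('i \<Rightarrow> 'c R2) set) = (\<Sum>i\<in>UNIV. e i + 1)"
    by (simp add: card_SigmaI finite_expos_tdeg card_expos_tdeg[simplified])
  have "finite (?e ` ?X)" using fin by simp
  moreover have "(homogeneous_families e :: ('i \<Rightarrow> 'c R2) set) \<subseteq> family.span (?e ` ?X)"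
    by (rule d(3)) (auto simp: lookup_add family_scale_def lookup_const_mult lookup_single when_def split: if_splits)
  ultimately show "\<exists>B. finite B \<and> (homogeneous_families e :: ('i \<Rightarrow> 'c R2) set) \<subseteq> family.span B" by blast
qed

lemma homogeneous_add: "homogeneous n r \<Longrightarrow> homogeneous n s \<Longrightarrow> homogeneous n (r + s :: 'c::field_char_0 R2)"
  unfolding homogeneous_iff lookup_add by (metis add.right_neutral)

lemma homogeneous_sum:
  "(\<And>i. i \<in> A \<Longrightarrow> homogeneous n (h i)) \<Longrightarrow> homogeneous n (\<Sum>i\<in>A. h i :: 'c::field_char_0 R2)"
proof (induction A rule: infinite_finite_induct)
  case (insert i A)
  then show ?case by (simp add: homogeneous_add)
qed (auto simp: homogeneous_iff)

lemma homogeneous_mult: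
  assumes "homogeneous m r" "homogeneous n s" shows "homogeneous (m + n) (r * s :: 'c::field_char_0 R2)"
  unfolding homogeneous_def
proof
  fix \<alpha> assume "\<alpha> \<in> keys (r * s)"
  then obtain \<beta> \<gamma> where "\<alpha> = \<beta> + \<gamma>" "\<beta> \<in> keys r" "\<gamma> \<in> keys s" using keys_mult[of r s] by blast
  then show "tdeg \<alpha> = m + n" using assms by (auto simp: homogeneous_def)
qed

lemma homogeneous_hom_part: "homogeneous n (hom_part (int n) r)"
  by (auto simp: homogeneous_iff lookup_hom_part split: if_splits)

lemma hom_part_homogeneous: "homogeneous n r \<Longrightarrow> hom_part (int n) r = r"
  by (rule poly_mapping_eqI) (auto simp: homogeneous_iff lookup_hom_part)

lemma hom_part_sum: "hom_part q (\<Sum>i\<in>A. h i) = (\<Sum>i\<in>A. hom_part q (h i :: 'c::comm_ring_1 R2))"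
  by (induction A rule: infinite_finite_induct) (auto simp: hom_part_add)

lemma hilbert_burch_column_degree:
  assumes "hilbert_burch f d \<mu> \<phi>"
  shows "homogeneous (if j = 0 then \<mu> else d - \<mu>) (\<phi> i j)"
  using assms UNIV_2 by (cases "j = 0") (auto simp: hilbert_burch_def)

text \<open>In degree \<open>n\<close> the resolution gives
  \<open>dim I\<^sub>n = 3(n-d+1) - (n-d-\<mu>+1) - (n-2d+\<mu>+1) = n + 1 = dim R\<^sub>n\<close>. The bound \<open>2d \<le> n\<close> makes every
  summand nonnegative.\<close>

lemma ideal_contains_large_degrees:
  fixes f :: "3 \<Rightarrow> 'c::field_char_0 R2"
  assumes f: "\<And>i. homogeneous d (f i)" and hb: "hilbert_burch f d \<mu> \<phi>"
    and n: "2 * d \<le> n" and r: "homogeneous n r"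
  shows "\<exists>a. r = (\<Sum>i\<in>UNIV. a i * f i)"
proof -
  define \<Psi> :: "(3 \<Rightarrow> 'c R2) \<Rightarrow> 1 \<Rightarrow> 'c R2" where "\<Psi> a = (\<lambda>_. \<Sum>i\<in>UNIV. a i * f i)" for a
  define \<Phi> :: "(2 \<Rightarrow> 'c R2) \<Rightarrow> 3 \<Rightarrow> 'c R2" where "\<Phi> u = (\<lambda>i. \<Sum>j\<in>UNIV. \<phi> i j * u j)" for u
  define m :: "2 \<Rightarrow> nat" where "m j = (if j = 0 then \<mu> else d - \<mu>)" for j
  define e :: "2 \<Rightarrow> nat" where "e j = n - d - m j" for j
  let ?V = "homogeneous_families (\<lambda>_. n - d) :: (3 \<Rightarrow> 'c R2) set"
  let ?U = "homogeneous_families e :: (2 \<Rightarrow> 'c R2) set"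
  let ?T = "homogeneous_families (\<lambda>_. n) :: (1 \<Rightarrow> 'c R2) set"
  have mu: "\<mu> \<le> d" and exact: "\<And>a. (\<Sum>i\<in>UNIV. a i * f i) = 0 \<longleftrightarrow> (\<exists>u. \<forall>i. a i = (\<Sum>j\<in>UNIV. \<phi> i j * u j))"
    and inj: "\<And>u. (\<forall>i. (\<Sum>j\<in>UNIV. \<phi> i j * u j) = 0) \<Longrightarrow> (\<forall>j. u j = 0)"
    using hb unfolding hilbert_burch_def by blast+
  have \<phi>: "homogeneous (m j) (\<phi> i j)" for i j unfolding m_def by (rule hilbert_burch_column_degree[OF hb])
  have me: "m j + e j = n - d" for j using mu n by (auto simp: m_def e_def)
  have lin\<Psi>: "Vector_Spaces.linear family_scale family_scale \<Psi>" and lin\<Phi>: "Vector_Spaces.linear family_scale family_scale \<Phi>"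
    by (auto simp: Vector_Spaces.linear_iff \<Psi>_def \<Phi>_def fun_eq_iff family_scale_def distrib_left
        distrib_right sum.distrib sum_distrib_left mult_ac intro: family.vector_space_axioms)
  have ker: "?V \<inter> {a. \<Psi> a = 0} = \<Phi> ` ?U"
  proof (intro equalityI subsetI)
    fix a assume "a \<in> ?V \<inter> {a. \<Psi> a = 0}"
    then have a: "\<And>i. homogeneous (n - d) (a i)" and "(\<Sum>i\<in>UNIV. a i * f i) = 0"
      by (auto simp: homogeneous_families_def \<Psi>_def fun_eq_iff)
    then obtain u where u: "\<And>i. a i = (\<Sum>j\<in>UNIV. \<phi> i j * u j)" using exact by blast
    have "a i = (\<Sum>j\<in>UNIV. \<phi> i j * hom_part (int (e j)) (u j))" for i
    proof -
      have "a i = hom_part (int (n - d)) (a i)" by (rule hom_part_homogeneous[OF a, symmetric])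
      also have "\<dots> = (\<Sum>j\<in>UNIV. hom_part (int (m j) + int (e j)) (\<phi> i j * u j))"
        unfolding u hom_part_sum of_nat_add[symmetric] me ..
      also have "\<dots> = (\<Sum>j\<in>UNIV. \<phi> i j * hom_part (int (e j)) (u j))"
        by (simp only: hom_part_mult[OF \<phi>])
      finally show ?thesis .
    qed
    then have "a = \<Phi> (\<lambda>j. hom_part (int (e j)) (u j))" by (simp add: \<Phi>_def fun_eq_iff)
    then show "a \<in> \<Phi> ` ?U" by (auto simp: homogeneous_families_def homogeneous_hom_part)
  next
    fix a assume "a \<in> \<Phi> ` ?U"
    then obtain u where u: "\<And>j. homogeneous (e j) (u j)" "a = \<Phi> u" by (auto simp: homogeneous_families_def)
    have "homogeneous (n - d) (\<phi> i j * u j)" for i j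
      using homogeneous_mult[OF \<phi>[of j i] u(1)[of j]] by (simp only: me)
    then have "a \<in> ?V" unfolding u(2) by (auto simp: homogeneous_families_def \<Phi>_def intro!: homogeneous_sum)
    moreover have "\<Psi> a = 0" using exact[of a] by (auto simp: u(2) \<Phi>_def \<Psi>_def fun_eq_iff)
    ultimately show "a \<in> ?V \<inter> {a. \<Psi> a = 0}" by blast
  qed
  have "?U \<inter> {u. \<Phi> u = 0} = {0}"
    using inj by (auto simp: \<Phi>_def fun_eq_iff homogeneous_families_def homogeneous_iff)
  moreover have "family.dim {0 :: 2 \<Rightarrow> 'c R2} = 0" using family.dim_le_card[of "{0}" "{}"] by simp
  moreover obtain BU :: "(2 \<Rightarrow> 'c R2) set" where "finite BU" "?U \<subseteq> family.span BU"
    using dim_homogeneous_families(2) by blast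
  ultimately have "family.dim ?U = family.dim (\<Phi> ` ?U)"
    using family_pair.rank_nullity[OF lin\<Phi> subspace_homogeneous_families] by simp
  moreover obtain BV :: "(3 \<Rightarrow> 'c R2) set" where "finite BV" "?V \<subseteq> family.span BV"
    using dim_homogeneous_families(2) by blast
  ultimately have "family.dim ?V = family.dim (\<Psi> ` ?V) + family.dim ?U"
    using family_pair.rank_nullity[OF lin\<Psi> subspace_homogeneous_families, of BV "\<lambda>_. n - d"] by (simp only: ker)
  moreover have "family.dim ?V = 3 * (n - d + 1)" by (simp add: dim_homogeneous_families)
  moreover have "family.dim ?U = (n - d - \<mu> + 1) + (n - d - (d - \<mu>) + 1)"
    by (simp add: dim_homogeneous_families UNIV_2 e_def m_def)
  ultimately have "family.dim (\<Psi> ` ?V) = n + 1" using mu n by simp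
  also have "\<dots> = family.dim ?T" by (simp add: dim_homogeneous_families)
  finally have dim: "family.dim (\<Psi> ` ?V) = family.dim ?T" .
  have "homogeneous n (a i * f i)" if "homogeneous (n - d) (a i)" for a :: "3 \<Rightarrow> 'c R2" and i
    using homogeneous_mult[OF that f[of i]] n by simp
  then have "\<Psi> ` ?V \<subseteq> ?T"
    by (auto simp: homogeneous_families_def \<Psi>_def intro!: homogeneous_sum)
  moreover have "family.subspace (\<Psi> ` ?V)"
    using Vector_Spaces.linear.axioms(3)[OF lin\<Psi>] subspace_homogeneous_families by (rule module_hom.subspace_image)
  moreover obtain BT :: "(1 \<Rightarrow> 'c R2) set" where "finite BT" "?T \<subseteq> family.span BT"
    using dim_homogeneous_families(2) by blast
  ultimately have "\<Psi> ` ?V = ?T" using dim by (intro family.subspace_eq_if_dim_eq)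
  moreover have "(\<lambda>_. r) \<in> ?T" using r by (simp add: homogeneous_families_def)
  ultimately obtain a where "\<Psi> a = (\<lambda>_. r)" by (metis imageE)
  then show ?thesis unfolding \<Psi>_def by metis
qed

section \<open>The equations of the symmetric algebra\<close>

abbreviation const_RT :: "'c::zero R2 \<Rightarrow> 'c RT" where
  "const_RT r \<equiv> single 0 r"

abbreviation var_T :: "3 \<Rightarrow> 'c::comm_ring_1 RT" where
  "var_T i \<equiv> single (single i 1) 1"

lemma const_RT_hom: "ring_hom (const_RT :: 'c::comm_ring_1 R2 \<Rightarrow> 'c RT)"
  by (auto simp: ring_hom_def single_add mult_single)

lemmas const_RT_simps = ring_hom_simps[OF const_RT_hom]

lemma single_Suc_0_eq_iff [simp]: "single i (Suc 0) = single j (Suc 0) \<longleftrightarrow> i = j"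
proof
  assume "single i (Suc 0) = single j (Suc 0)"
  then have "lookup (single i (Suc 0)) i = lookup (single j (Suc 0)) i" by simp
  then show "i = j" by (auto simp: lookup_single when_def split: if_splits)
qed simp

lemma lookup_linear_form: "lookup (linear_form a) (single i 1) = a i"
proof -
  have "lookup (linear_form a) (single i 1) = (\<Sum>j\<in>UNIV. if j = i then a j else 0)"
    unfolding linear_form_def lookup_sum by (intro sum.cong refl) (auto simp: lookup_single when_def)
  then show ?thesis by simp
qed

lemma linear_form_add: "linear_form (\<lambda>i. a i + b i) = linear_form a + linear_form b"
  by (simp add: linear_form_def single_add sum.distrib)

lemma linear_form_const_mult: "linear_form (\<lambda>i. r * a i) = const_RT r * linear_form a"
  by (simp add: linear_form_def sum_distrib_left mult_single)

lemma linear_form_zero: "linear_form (\<lambda>i. 0) = 0"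
  by (simp add: linear_form_def)

lemma linear_form_sum: "linear_form (\<lambda>i. \<Sum>j\<in>A. a j i) = (\<Sum>j\<in>A. linear_form (a j))"
  by (induction A rule: infinite_finite_induct) (auto simp: linear_form_zero linear_form_add)

lemma linear_form_columns:
  "linear_form (\<lambda>i. \<Sum>j\<in>UNIV. \<phi> i j * u j) = sym_eq \<phi> 0 * const_RT (u 0) + sym_eq \<phi> 1 * const_RT (u 1)"
proof -
  have "linear_form (\<lambda>i. \<phi> i j * u j) = sym_eq \<phi> j * const_RT (u j)" for j
    unfolding sym_eq_def using linear_form_const_mult[of "u j" "\<lambda>i. \<phi> i j"] by (simp add: mult.commute)
  then show ?thesis unfolding linear_form_sum by (simp add: UNIV_2)
qed

lemma ideal_gen_closed:
  "0 \<in> ideal_gen B" "a \<in> ideal_gen B \<Longrightarrow> b \<in> ideal_gen B \<Longrightarrow> a + b \<in> ideal_gen B"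
  "a \<in> ideal_gen B \<Longrightarrow> r * a \<in> ideal_gen B" "a \<in> B \<Longrightarrow> a \<in> ideal_gen B"
  unfolding ideal_gen_def
  by (auto simp: self_module.span_zero self_module.span_add self_module.span_scale self_module.span_base)

lemma hilbert_burch_column_syzygy:
  assumes hb: "hilbert_burch f d \<mu> \<phi>" shows "(\<Sum>i\<in>UNIV. \<phi> i j * f i) = 0"
proof -
  have exact: "\<And>a. (\<Sum>i\<in>UNIV. a i * f i) = 0 \<longleftrightarrow> (\<exists>u. \<forall>i. a i = (\<Sum>j\<in>UNIV. \<phi> i j * u j))"
    using hb unfolding hilbert_burch_def by blast
  have "\<phi> i j = (\<Sum>k\<in>UNIV. \<phi> i k * (if k = j then 1 else 0))" for i
    by (simp add: if_distrib[of "\<lambda>x. _ * x"] cong: if_cong)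
  then show ?thesis
    by (intro exact[of "\<lambda>i. \<phi> i j", THEN iffD2] exI[of _ "\<lambda>k. if k = j then 1 else 0"] allI)
qed

lemma sym_ideal_eq:
  assumes hb: "hilbert_burch f d \<mu> \<phi>"
  shows "P \<in> sym_ideal f \<longleftrightarrow> (\<exists>c\<^sub>1 c\<^sub>2. P = sym_eq \<phi> 0 * c\<^sub>1 + sym_eq \<phi> 1 * c\<^sub>2)"
proof
  have exact: "\<And>a. (\<Sum>i\<in>UNIV. a i * f i) = 0 \<longleftrightarrow> (\<exists>u. \<forall>i. a i = (\<Sum>j\<in>UNIV. \<phi> i j * u j))"
    using hb unfolding hilbert_burch_def by blast
  let ?J = "{P. \<exists>c\<^sub>1 c\<^sub>2. P = sym_eq \<phi> 0 * c\<^sub>1 + sym_eq \<phi> 1 * c\<^sub>2}"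
  have "self_module.subspace ?J"
  proof (rule self_module.subspaceI)
    have "0 = sym_eq \<phi> 0 * 0 + sym_eq \<phi> 1 * 0" by simp
    then show "0 \<in> ?J" by (intro CollectI exI)
  next
    fix P Q assume "P \<in> ?J" "Q \<in> ?J"
    then obtain c\<^sub>1 c\<^sub>2 e\<^sub>1 e\<^sub>2 where "P = sym_eq \<phi> 0 * c\<^sub>1 + sym_eq \<phi> 1 * c\<^sub>2" "Q = sym_eq \<phi> 0 * e\<^sub>1 + sym_eq \<phi> 1 * e\<^sub>2"
      by blast
    then have "P + Q = sym_eq \<phi> 0 * (c\<^sub>1 + e\<^sub>1) + sym_eq \<phi> 1 * (c\<^sub>2 + e\<^sub>2)" by (simp add: algebra_simps)
    then show "P + Q \<in> ?J" by (intro CollectI exI)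
  next
    fix r P assume "P \<in> ?J"
    then obtain c\<^sub>1 c\<^sub>2 where "P = sym_eq \<phi> 0 * c\<^sub>1 + sym_eq \<phi> 1 * c\<^sub>2" by blast
    then have "r * P = sym_eq \<phi> 0 * (r * c\<^sub>1) + sym_eq \<phi> 1 * (r * c\<^sub>2)" by (simp add: algebra_simps)
    then show "r * P \<in> ?J" by (intro CollectI exI)
  qed
  moreover have "{linear_form a | a. (\<Sum>i\<in>UNIV. a i * f i) = 0} \<subseteq> ?J"
  proof clarify
    fix a assume "(\<Sum>i\<in>UNIV. a i * f i) = 0"
    then obtain u where "\<And>i. a i = (\<Sum>j\<in>UNIV. \<phi> i j * u j)" using exact[of a] by auto
    then have "a = (\<lambda>i. \<Sum>j\<in>UNIV. \<phi> i j * u j)" by (rule ext)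
    then have "linear_form a = sym_eq \<phi> 0 * const_RT (u 0) + sym_eq \<phi> 1 * const_RT (u 1)"
      by (simp only: linear_form_columns)
    then show "\<exists>c\<^sub>1 c\<^sub>2. linear_form a = sym_eq \<phi> 0 * c\<^sub>1 + sym_eq \<phi> 1 * c\<^sub>2" by (intro exI)
  qed
  ultimately have "sym_ideal f \<subseteq> ?J"
    unfolding sym_ideal_def ideal_gen_def by (intro self_module.span_minimal)
  then show "P \<in> sym_ideal f \<Longrightarrow> \<exists>c\<^sub>1 c\<^sub>2. P = sym_eq \<phi> 0 * c\<^sub>1 + sym_eq \<phi> 1 * c\<^sub>2"
    by (auto dest: subsetD)
  have col: "sym_eq \<phi> j \<in> sym_ideal f" for j
  proof -
    have "(\<Sum>i\<in>UNIV. \<phi> i j * f i) = 0" by (rule hilbert_burch_column_syzygy[OF hb])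
    then show ?thesis unfolding sym_ideal_def sym_eq_def by (intro ideal_gen_closed(4)) blast
  qed
  assume "\<exists>c\<^sub>1 c\<^sub>2. P = sym_eq \<phi> 0 * c\<^sub>1 + sym_eq \<phi> 1 * c\<^sub>2"
  then obtain c\<^sub>1 c\<^sub>2 where P: "P = sym_eq \<phi> 0 * c\<^sub>1 + sym_eq \<phi> 1 * c\<^sub>2" by auto
  show "P \<in> sym_ideal f"
    using col unfolding sym_ideal_def P mult.commute[of "sym_eq \<phi> _"]
    by (intro ideal_gen_closed(2,3))
qed

lemma ideal_gen_prod_diff:
  fixes u v :: "'i \<Rightarrow> 'r::comm_ring_1"
  assumes I: "\<And>i. u i - v i \<in> ideal_gen B" and fin: "finite A"
  shows "(\<Prod>i\<in>A. u i ^ n i) - (\<Prod>i\<in>A. v i ^ n i) \<in> ideal_gen B"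
proof -
  have step: "a * c - b * e \<in> ideal_gen B" if "a - b \<in> ideal_gen B" "c - e \<in> ideal_gen B" for a b c e :: 'r
  proof -
    have "a * c - b * e = a * (c - e) + e * (a - b)" by (simp add: algebra_simps)
    then show ?thesis using that by (simp add: ideal_gen_closed)
  qed
  have pow: "u i ^ k - v i ^ k \<in> ideal_gen B" for i k
    by (induction k) (auto simp: ideal_gen_closed intro!: step I)
  show ?thesis using fin by (induction A) (auto simp: ideal_gen_closed intro!: step pow)
qed

text \<open>Substitutions that agree modulo an ideal have values that agree modulo it. This turns
  relations such as \<open>f\<^sub>i T\<^sub>j = f\<^sub>j T\<^sub>i\<close> into relations between values of polynomials.\<close>

lemma eval_RT_diff_in_ideal:
  assumes h: "ring_hom h"
  shows "eval_RT h u P - eval_RT h v P \<in> ideal_gen (range (\<lambda>i. u i - v i))"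
proof (induction P rule: poly_mapping_induct)
  case (add P Q)
  have "eval_RT h u (P + Q) - eval_RT h v (P + Q)
      = (eval_RT h u P - eval_RT h v P) + (eval_RT h u Q - eval_RT h v Q)"
    by (simp add: eval_RT_add[OF h])
  then show ?case using add by (simp add: ideal_gen_closed)
next
  case (single \<gamma> r)
  have "eval_RT h u (single \<gamma> r) - eval_RT h v (single \<gamma> r)
      = h r * ((\<Prod>i\<in>UNIV. u i ^ lookup \<gamma> i) - (\<Prod>i\<in>UNIV. v i ^ lookup \<gamma> i))"
    by (simp add: eval_RT_single[OF h] right_diff_distrib)
  also have "\<dots> \<in> ideal_gen (range (\<lambda>i. u i - v i))"
    by (intro ideal_gen_closed(3) ideal_gen_prod_diff) (auto intro: ideal_gen_closed(4))
  finally show ?case .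
qed

definition T_homogeneous :: "nat \<Rightarrow> 'c::zero RT \<Rightarrow> bool" where
  "T_homogeneous p P \<longleftrightarrow> (\<forall>\<gamma>\<in>keys P. tdeg \<gamma> = p)"

lemma T_homogeneous_add: "T_homogeneous p P \<Longrightarrow> T_homogeneous p Q \<Longrightarrow> T_homogeneous p (P + Q)"
  using Poly_Mapping.keys_add[of P Q] by (auto simp: T_homogeneous_def)

lemma T_homogeneous_const_mult: "T_homogeneous p P \<Longrightarrow> T_homogeneous p (const_RT r * (P :: 'c::comm_ring_1 RT))"
  by (auto simp: T_homogeneous_def in_keys_iff lookup_const_mult)

lemma bihomogeneous_imp_T_homogeneous: "bihomogeneous p q P \<Longrightarrow> T_homogeneous p P"
  by (auto simp: bihomogeneous_def T_homogeneous_def)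

lemma eval_RT_scaled_vars:
  assumes "T_homogeneous p (P :: 'c::comm_ring_1 RT)"
  shows "eval_RT const_RT (\<lambda>j. const_RT s * var_T j) P = const_RT s ^ p * P"
proof -
  have "const_RT (lookup P \<gamma>) * (\<Prod>i\<in>UNIV. (const_RT s * var_T i) ^ lookup \<gamma> i)
      = const_RT s ^ p * single \<gamma> (lookup P \<gamma>)" if "\<gamma> \<in> keys P" for \<gamma>
  proof -
    have "(\<Prod>i\<in>UNIV. (const_RT s * var_T i) ^ lookup \<gamma> i) = const_RT s ^ tdeg \<gamma> * single \<gamma> 1"
      by (simp only: power_mult_distrib prod.distrib power_sum tdeg_def single_expo_prod[of \<gamma>])
    moreover have "tdeg \<gamma> = p" using assms that by (auto simp: T_homogeneous_def)
    ultimately have "const_RT (lookup P \<gamma>) * (\<Prod>i\<in>UNIV. (const_RT s * var_T i) ^ lookup \<gamma> i)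
        = const_RT (lookup P \<gamma>) * (const_RT s ^ p * single \<gamma> 1)" by (simp only:)
    also have "\<dots> = const_RT s ^ p * (const_RT (lookup P \<gamma>) * single \<gamma> 1)" by (rule mult.left_commute)
    also have "const_RT (lookup P \<gamma>) * single \<gamma> 1 = single \<gamma> (lookup P \<gamma>)" by (simp add: mult_single)
    finally show ?thesis .
  qed
  then have "eval_RT const_RT (\<lambda>j. const_RT s * var_T j) P = (\<Sum>\<gamma>\<in>keys P. const_RT s ^ p * single \<gamma> (lookup P \<gamma>))"
    unfolding eval_RT_def by (intro sum.cong) auto
  then show ?thesis by (simp only: sum_distrib_left[symmetric] poly_mapping_sum_single[symmetric])
qed

lemma eval_RT_multiples:
  assumes "T_homogeneous p (P :: 'c::comm_ring_1 RT)"
  shows "eval_RT const_RT (\<lambda>j. const_RT (f j) * X) P = const_RT (eval_RT (\<lambda>r. r) f P) * X ^ p"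
proof -
  have "const_RT (lookup P \<gamma>) * (\<Prod>i\<in>UNIV. (const_RT (f i) * X) ^ lookup \<gamma> i)
      = const_RT (lookup P \<gamma> * (\<Prod>i\<in>UNIV. f i ^ lookup \<gamma> i)) * X ^ p" if "\<gamma> \<in> keys P" for \<gamma>
  proof -
    have pr: "(\<Prod>i\<in>UNIV. const_RT (f i) ^ lookup \<gamma> i) = const_RT (\<Prod>i\<in>UNIV. f i ^ lookup \<gamma> i)"
    proof -
      have "const_RT (\<Prod>i\<in>A. g i) = (\<Prod>i\<in>A. const_RT (g i :: 'c R2))" if "finite A" for A :: "3 set" and g
        using that by induction (auto simp: const_RT_simps(3))
      then show ?thesis by (simp add: ring_hom_power[OF const_RT_hom])
    qed
    have "(\<Prod>i\<in>UNIV. (const_RT (f i) * X) ^ lookup \<gamma> i) = const_RT (\<Prod>i\<in>UNIV. f i ^ lookup \<gamma> i) * X ^ tdeg \<gamma>"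
      by (simp only: power_mult_distrib prod.distrib power_sum tdeg_def pr)
    moreover have "tdeg \<gamma> = p" using assms that by (auto simp: T_homogeneous_def)
    ultimately show ?thesis by (simp only: const_RT_simps(3) mult.assoc)
  qed
  then have "eval_RT const_RT (\<lambda>j. const_RT (f j) * X) P
      = (\<Sum>\<gamma>\<in>keys P. const_RT (lookup P \<gamma> * (\<Prod>i\<in>UNIV. f i ^ lookup \<gamma> i)) * X ^ p)"
    unfolding eval_RT_def by (intro sum.cong) auto
  then show ?thesis
    by (simp only: eval_RT_def ring_hom_sum[OF const_RT_hom] sum_distrib_right)
qed

lemma rees_map_T_homogeneous:
  assumes "T_homogeneous p P"
  shows "rees_map f P = monom (eval_RT (\<lambda>r. r) f P) p"
proof -
  have prod: "(\<Prod>i\<in>A. monom (f i) 1 ^ n i) = monom (\<Prod>i\<in>A. f i ^ n i) (\<Sum>i\<in>A. n i)"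
    if "finite A" for A and n :: "3 \<Rightarrow> nat"
    using that
  proof induction
    case empty
    show ?case by (simp add: monom_0 one_pCons)
  next
    case (insert i A)
    show ?case unfolding prod.insert[OF insert.hyps] sum.insert[OF insert.hyps] insert.IH
      by (simp only: monom_power mult_monom mult_1)
  qed
  have "rees_map f P = (\<Sum>\<gamma>\<in>keys P. monom (lookup P \<gamma> * (\<Prod>i\<in>UNIV. f i ^ lookup \<gamma> i)) p)"
    unfolding rees_map_def eval_RT_def
  proof (intro sum.cong refl)
    fix \<gamma> assume "\<gamma> \<in> keys P"
    then have "tdeg \<gamma> = p" using assms by (auto simp: T_homogeneous_def)
    then show "[:lookup P \<gamma>:] * (\<Prod>i\<in>UNIV. monom (f i) 1 ^ lookup \<gamma> i)
        = monom (lookup P \<gamma> * (\<Prod>i\<in>UNIV. f i ^ lookup \<gamma> i)) p"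
      by (simp only: prod[OF finite] tdeg_def[symmetric] monom_0[symmetric] mult_monom add_0_left)
  qed
  then show ?thesis by (simp only: eval_RT_def monom_sum)
qed

lemma syzygy_in_sym_ideal:
  "const_RT (f j) * var_T i - const_RT (f i) * var_T j \<in> sym_ideal (f :: 3 \<Rightarrow> 'c::comm_ring_1 R2)"
proof -
  let ?a = "\<lambda>k. (if k = i then f j else 0) - (if k = j then f i else 0)"
  have "linear_form ?a = (\<Sum>k\<in>UNIV. (if k = i then single (single k 1) (f j) else 0)
      - (if k = j then single (single k 1) (f i) else 0))"
    unfolding linear_form_def by (intro sum.cong refl) (auto simp: single_diff)
  also have "\<dots> = const_RT (f j) * var_T i - const_RT (f i) * var_T j"
    by (simp add: sum_subtractf mult_single)
  finally have "linear_form ?a = const_RT (f j) * var_T i - const_RT (f i) * var_T j" .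
  moreover have "(\<Sum>k\<in>UNIV. ?a k * f k) = (\<Sum>k\<in>UNIV. (if k = i then f j * f k else 0) - (if k = j then f i * f k else 0))"
    by (intro sum.cong refl) (auto simp: left_diff_distrib)
  moreover have "\<dots> = 0" by (simp add: sum_subtractf)
  ultimately have "const_RT (f j) * var_T i - const_RT (f i) * var_T j
      \<in> {linear_form a | a. (\<Sum>i\<in>UNIV. a i * f i) = 0}"
    by (intro CollectI exI[of _ ?a] conjI) (simp_all only:)
  then show ?thesis unfolding sym_ideal_def by (rule ideal_gen_closed(4))
qed

text \<open>In the symmetric algebra \<open>f\<^sub>i T\<^sub>j = f\<^sub>j T\<^sub>i\<close>, hence \<open>f\<^sub>i\<^sup>p P(T) = P(f\<^sub>i T) = P(f) T\<^sub>i\<^sup>p\<close>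
  for \<open>P\<close> of degree \<open>p\<close> in \<open>T\<close>, and \<open>P(f) = 0\<close> for \<open>P\<close> in the kernel.\<close>

lemma power_times_rees_kernel:
  fixes f :: "3 \<Rightarrow> 'c::field_char_0 R2"
  assumes P: "T_homogeneous p P" and ker: "rees_map f P = 0"
  shows "const_RT (f i) ^ p * P \<in> sym_ideal f"
proof -
  have "eval_RT (\<lambda>r. r) f P = 0" using ker rees_map_T_homogeneous[OF P, of f] by simp
  then have "eval_RT const_RT (\<lambda>j. const_RT (f j) * var_T i) P = 0"
    by (simp only: eval_RT_multiples[OF P] single_zero mult_zero_left)
  then have "- (const_RT (f i) ^ p * P) \<in> ideal_gen (range (\<lambda>j. const_RT (f j) * var_T i - const_RT (f i) * var_T j))"
    using eval_RT_diff_in_ideal[OF const_RT_hom, of "\<lambda>j. const_RT (f j) * var_T i" P "\<lambda>j. const_RT (f i) * var_T j"]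
    by (simp only: eval_RT_scaled_vars[OF P] diff_0)
  also have "\<dots> \<subseteq> sym_ideal f"
  proof -
    have "range (\<lambda>j. const_RT (f j) * var_T i - const_RT (f i) * var_T j) \<subseteq> sym_ideal f"
      using syzygy_in_sym_ideal by blast
    then show ?thesis unfolding sym_ideal_def ideal_gen_def by (intro self_module.span_minimal) simp_all
  qed
  finally have "(- 1) * - (const_RT (f i) ^ p * P) \<in> sym_ideal f"
    unfolding sym_ideal_def by (rule ideal_gen_closed(3))
  then show ?thesis by simp
qed

lemma radical_contains_ideal:
  fixes f :: "'i \<Rightarrow> 'r::comm_ring_1"
  assumes J: "0 \<in> J" "\<And>a b. a \<in> J \<Longrightarrow> b \<in> J \<Longrightarrow> a + b \<in> J" "\<And>r a. a \<in> J \<Longrightarrow> r * a \<in> J"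
    and f: "\<And>i. i \<in> A \<Longrightarrow> \<exists>k. f i ^ k \<in> J" and fin: "finite A"
  shows "\<exists>k. (\<Sum>i\<in>A. a i * f i) ^ k \<in> J"
  using fin f
proof (induction A rule: finite_induct)
  case empty
  show ?case using J(1) by (intro exI[of _ 1]) simp
next
  case (insert i A)
  obtain m where m: "f i ^ m \<in> J" using insert.prems by blast
  obtain n where n: "(\<Sum>i\<in>A. a i * f i) ^ n \<in> J" using insert.IH insert.prems by blast
  let ?x = "a i * f i" and ?y = "\<Sum>i\<in>A. a i * f i"
  have x: "?x ^ k \<in> J" if "m \<le> k" for k
  proof -
    have "f i ^ k = f i ^ (k - m) * f i ^ m" using that by (simp flip: power_add)
    then have "?x ^ k = (a i ^ k * f i ^ (k - m)) * f i ^ m" by (simp only: power_mult_distrib mult.assoc)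
    then show ?thesis using J(3)[OF m] by simp
  qed
  have y: "?y ^ k \<in> J" if "n \<le> k" for k
  proof -
    have "?y ^ k = ?y ^ (k - n) * ?y ^ n" using that by (simp flip: power_add)
    then show ?thesis using J(3)[OF n] by simp
  qed
  have sum: "(\<Sum>k\<in>B. h k) \<in> J" if "finite B" "\<And>k. k \<in> B \<Longrightarrow> h k \<in> J" for h :: "nat \<Rightarrow> 'r" and B
    using that by (induction B) (auto intro: J)
  have "(?x + ?y) ^ (m + n) = (\<Sum>k\<le>m + n. of_nat (m + n choose k) * ?x ^ k * ?y ^ (m + n - k))"
    by (rule binomial_ring)
  also have "\<dots> \<in> J"
  proof (rule sum)
    fix k assume "k \<in> {..m + n}"
    show "of_nat (m + n choose k) * ?x ^ k * ?y ^ (m + n - k) \<in> J"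
    proof (cases "m \<le> k")
      case True
      have "of_nat (m + n choose k) * ?x ^ k * ?y ^ (m + n - k)
          = (of_nat (m + n choose k) * ?y ^ (m + n - k)) * ?x ^ k" by (simp only: mult_ac)
      then show ?thesis using x[OF True] by (simp only: J(3))
    next
      case False
      then have "n \<le> m + n - k" by simp
      then show ?thesis by (intro J(3) y)
    qed
  qed simp
  finally have "(?x + ?y) ^ (m + n) \<in> J" .
  then show ?case using insert.hyps by auto
qed

lemma power_xpow: "const_RT (single (single i n) (1 :: 'c::comm_ring_1)) ^ k = xpow i (k * n)"
  by (induction k) (auto simp: xpow_def mult_single simp flip: single_add)

lemma xpow_add: "xpow i (m + n) = xpow i m * (xpow i n :: 'c::comm_ring_1 RT)"
  by (simp add: xpow_def mult_single single_add)

text \<open>The ideal \<open>I\<close> contains a power of each variable, so what is killed by powers of the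
  generators of \<open>I\<close> is killed by powers of the variables.\<close>

lemma killed_by_powers_of_variables:
  fixes f :: "3 \<Rightarrow> 'c::field_char_0 R2"
  assumes f: "\<And>i. homogeneous d (f i)" and hb: "hilbert_burch f d \<mu> \<phi>"
    and J: "self_module.subspace J" and P: "\<And>i. \<exists>k. const_RT (f i) ^ k * P \<in> J"
  shows "\<exists>N\<^sub>0. \<forall>N\<ge>N\<^sub>0. \<forall>i. xpow i N * P \<in> J"
proof -
  let ?J = "{r. r * P \<in> J}"
  note J' = self_module.subspace_0[OF J] self_module.subspace_add[OF J] self_module.subspace_scale[OF J]
  have "\<exists>N. xpow i N * P \<in> J" for i
  proof -
    have "homogeneous (2 * d) (single (single i (2 * d)) (1 :: 'c))" by (simp add: homogeneous_def)
    then obtain a where a: "single (single i (2 * d)) 1 = (\<Sum>j\<in>UNIV. a j * f j)"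
      using ideal_contains_large_degrees[OF f hb order_refl] by blast
    have "\<exists>k. (\<Sum>j\<in>UNIV. const_RT (a j) * const_RT (f j)) ^ k \<in> ?J"
      by (rule radical_contains_ideal) (use J' P in \<open>auto simp: distrib_right mult.assoc\<close>)
    then obtain k where "(\<Sum>j\<in>UNIV. const_RT (a j) * const_RT (f j)) ^ k * P \<in> J" by blast
    moreover have "(\<Sum>j\<in>UNIV. const_RT (a j) * const_RT (f j)) = const_RT (single (single i (2 * d)) (1 :: 'c))"
      unfolding a by (simp only: ring_hom_sum[OF const_RT_hom] const_RT_simps(3))
    ultimately have "xpow i (k * (2 * d)) * P \<in> J" by (simp only: power_xpow)
    then show ?thesis by blast
  qed
  then obtain n where n: "\<And>i. xpow i (n i) * P \<in> J" by metis
  have "xpow i N * P \<in> J" if "max (n 0) (n 1) \<le> N" for i N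
  proof -
    have "i = 0 \<or> i = 1" using UNIV_2 by blast
    then have "n i \<le> N" using that by auto
    then have "xpow i N * P = xpow i (N - n i) * (xpow i (n i) * P)"
      by (simp add: mult.assoc[symmetric] flip: xpow_add)
    then show ?thesis using J'(3)[OF n[of i]] by metis
  qed
  then show ?thesis by blast
qed

section \<open>The two equations form a regular sequence\<close>

lemma sum_3:
  fixes i j k :: 3 and g :: "3 \<Rightarrow> 'r::comm_monoid_add"
  assumes "i \<noteq> j" "i \<noteq> k" "j \<noteq> k" shows "(\<Sum>l\<in>UNIV. g l) = g i + g j + g k"
proof -
  have "{i, j, k} = (UNIV :: 3 set)" using assms by (intro card_subset_eq) auto
  then have "(\<Sum>l\<in>UNIV. g l) = sum g {i, j, k}" by simp
  then show ?thesis using assms by (simp add: add.assoc)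
qed

lemma other_indices: "\<exists>j k :: 3. i \<noteq> j \<and> i \<noteq> k \<and> j \<noteq> k"
proof -
  have "card (UNIV - {i}) = 2" by (simp add: card_Diff_singleton)
  then obtain j k where "UNIV - {i} = {j, k}" "j \<noteq> k" unfolding card_2_iff by blast
  then show ?thesis by blast
qed

lemma nonzero_if_lookup_nonzero: "lookup P k \<noteq> 0 \<Longrightarrow> P \<noteq> 0"
  by auto

lemma subspace_multiples: "self_module.subspace {h * w | w. True}"
proof (rule self_module.subspaceI)
  show "0 \<in> {h * w | w. True}" by (auto intro: exI[of _ 0])
  show "x + y \<in> {h * w | w. True}" if "x \<in> {h * w | w. True}" "y \<in> {h * w | w. True}" for x y
    using that by (auto simp flip: distrib_left)
  show "r * x \<in> {h * w | w. True}" if "x \<in> {h * w | w. True}" for r x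
    using that by (auto simp: mult.left_commute)
qed

text \<open>Substitute \<open>f\<^sub>k T\<^sub>i\<close> for \<open>T\<^sub>k\<close> and \<open>f\<^sub>i T\<^sub>l\<close> for the other variables \<open>T\<^sub>l\<close>. This kills the form
  \<open>f\<^sub>i T\<^sub>k - f\<^sub>k T\<^sub>i\<close> and multiplies \<open>f\<^sub>i T\<^sub>j - f\<^sub>j T\<^sub>i\<close> by \<open>f\<^sub>i\<close>, so the relation shows that it kills \<open>A\<close>.
  Modulo \<open>f\<^sub>i T\<^sub>k - f\<^sub>k T\<^sub>i\<close> it is the substitution of \<open>f\<^sub>i T\<close> for \<open>T\<close>, which maps \<open>A\<close> to \<open>f\<^sub>i\<^sup>s A\<close>.\<close>

lemma koszul_exact_syzygy_forms:
  fixes A :: "'c::field_char_0 RT"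
  assumes A: "T_homogeneous s A" and jk: "i \<noteq> j" "i \<noteq> k" "j \<noteq> k" and fi: "f i \<noteq> 0"
    and rel: "(const_RT (f i) * var_T j - const_RT (f j) * var_T i) * A
        + (const_RT (f i) * var_T k - const_RT (f k) * var_T i) * B = 0"
  shows "\<exists>w. const_RT (f i) ^ s * A = (const_RT (f i) * var_T k - const_RT (f k) * var_T i) * w"
proof -
  let ?l = "const_RT (f i) * var_T k - const_RT (f k) * var_T i"
  let ?m = "const_RT (f i) * var_T j - const_RT (f j) * var_T i"
  define v :: "3 \<Rightarrow> 'c RT" where
    "v l = (if l = k then const_RT (f k) * var_T i else const_RT (f i) * var_T l)" for l
  define \<sigma> where "\<sigma> = eval_RT const_RT v"
  have hom: "ring_hom \<sigma>" unfolding \<sigma>_def by (rule eval_RT_hom[OF const_RT_hom])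
  note h = ring_hom_simps[OF hom]
  have prodv: "(\<Prod>m\<in>UNIV. v m ^ lookup (single l (1::nat)) m) = v l" for l
  proof -
    have "(\<Prod>m\<in>UNIV. v m ^ lookup (single l (1::nat)) m) = (\<Prod>m\<in>UNIV. if m = l then v m else 1)"
      by (intro prod.cong) (auto simp: lookup_single when_def)
    then show ?thesis by simp
  qed
  have T: "\<sigma> (var_T l) = v l" for l
    unfolding \<sigma>_def eval_RT_single[OF const_RT_hom] prodv by simp
  have c: "\<sigma> (const_RT r) = const_RT r" for r
    unfolding \<sigma>_def eval_RT_single[OF const_RT_hom] by simp
  have "\<sigma> ?l = const_RT (f i) * (const_RT (f k) * var_T i) - const_RT (f k) * (const_RT (f i) * var_T i)"
    unfolding h T c v_def using jk by simp
  then have l0: "\<sigma> ?l = 0" by (simp only: mult.left_commute diff_self)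
  have "\<sigma> ?m = const_RT (f i) * (const_RT (f i) * var_T j) - const_RT (f j) * (const_RT (f i) * var_T i)"
    unfolding h T c v_def using jk by simp
  also have "\<dots> = const_RT (f i) * ?m" by (simp only: right_diff_distrib mult.left_commute)
  finally have m: "\<sigma> ?m = const_RT (f i) * ?m" .
  have "lookup ?m (single j 1) = f i" using jk(1)
    by (auto simp: lookup_minus mult_single lookup_single when_def)
  then have m_nz: "?m \<noteq> 0" using fi by (intro nonzero_if_lookup_nonzero[of _ "single j 1"]) (simp only: not_False_eq_True)
  have "lookup (const_RT (f i)) (0 :: 3 expo) \<noteq> 0" using fi by simp
  then have "const_RT (f i) \<noteq> (0 :: 'c RT)" by (rule nonzero_if_lookup_nonzero)
  moreover have "\<sigma> ?m * \<sigma> A + \<sigma> ?l * \<sigma> B = 0" unfolding h(2,3)[symmetric] rel h(4) ..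
  then have "(const_RT (f i) * ?m) * \<sigma> A = 0" unfolding l0 m by (simp only: mult_zero_left add_0_right)
  ultimately have "\<sigma> A = 0" using m_nz by (simp only: mult_eq_0_iff simp_thms)
  then have "const_RT (f i) ^ s * A \<in> ideal_gen (range (\<lambda>l. const_RT (f i) * var_T l - v l))"
    using eval_RT_diff_in_ideal[OF const_RT_hom, of "\<lambda>l. const_RT (f i) * var_T l" A v]
    by (simp only: eval_RT_scaled_vars[OF A] \<sigma>_def diff_0_right)
  moreover have "self_module.subspace {?l * w | w. True}" by (rule subspace_multiples)
  moreover have "const_RT (f i) * var_T l - v l \<in> {?l * w | w. True}" for l
  proof (cases "l = k")
    case True
    then have "const_RT (f i) * var_T l - v l = ?l * 1" by (simp add: v_def)
    then show ?thesis by blast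
  next
    case False
    then have "const_RT (f i) * var_T l - v l = ?l * 0" by (simp add: v_def)
    then show ?thesis by blast
  qed
  ultimately show ?thesis
    unfolding ideal_gen_def using self_module.span_minimal[of "range (\<lambda>l. const_RT (f i) * var_T l - v l)"]
    by blast
qed

text \<open>Where \<open>f\<^sub>i\<close> is invertible, the forms \<open>l\<^sub>j = f\<^sub>i T\<^sub>j - f\<^sub>j T\<^sub>i\<close> and \<open>l\<^sub>k = f\<^sub>i T\<^sub>k - f\<^sub>k T\<^sub>i\<close> generate the same
  ideal as the two equations. The transition matrices are given by the \<open>\<alpha>\<close>, \<open>\<beta>\<close> below and by two rows
  of \<open>\<phi>\<close>, and their product is \<open>f\<^sub>i\<close> times the identity. So the Koszul exactness of \<open>l\<^sub>j, l\<^sub>k\<close>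
  carries over.\<close>

lemma koszul_exact_sym_eq_localized:
  fixes f :: "3 \<Rightarrow> 'c::field_char_0 R2"
  assumes hb: "hilbert_burch f d \<mu> \<phi>" and jk: "i \<noteq> j" "i \<noteq> k" "j \<noteq> k" and fi: "f i \<noteq> 0"
    and a: "T_homogeneous r a" and b: "T_homogeneous r b"
    and rel: "sym_eq \<phi> 0 * a + sym_eq \<phi> 1 * b = 0"
  shows "\<exists>w. const_RT (f i) ^ Suc r * a = sym_eq \<phi> 1 * w"
proof -
  let ?g = "sym_eq \<phi> 0" and ?h = "sym_eq \<phi> 1"
  define l where "l m = const_RT (f i) * var_T m - const_RT (f m) * var_T i" for m
  have exact: "\<And>a. (\<Sum>i\<in>UNIV. a i * f i) = 0 \<longleftrightarrow> (\<exists>u. \<forall>i. a i = (\<Sum>j\<in>UNIV. \<phi> i j * u j))"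
    and inj: "\<And>u. (\<forall>i. (\<Sum>j\<in>UNIV. \<phi> i j * u j) = 0) \<Longrightarrow> (\<forall>j. u j = 0)"
    using hb unfolding hilbert_burch_def by blast+
  have "\<exists>u v. l m = ?g * const_RT u + ?h * const_RT v" for m
  proof -
    let ?a = "\<lambda>n. (if n = m then f i else 0) - (if n = i then f m else 0)"
    have "(\<Sum>n\<in>UNIV. ?a n * f n) = (\<Sum>n\<in>UNIV. (if n = m then f i * f n else 0) - (if n = i then f m * f n else 0))"
      by (intro sum.cong refl) (auto simp: left_diff_distrib)
    also have "\<dots> = 0" by (simp add: sum_subtractf)
    finally have "\<exists>u. \<forall>n. ?a n = (\<Sum>j\<in>UNIV. \<phi> n j * u j)" using exact[of ?a] by (simp only: simp_thms)
    then obtain u where "\<And>n. ?a n = (\<Sum>j\<in>UNIV. \<phi> n j * u j)" by blast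
    then have "?a = (\<lambda>n. \<Sum>j\<in>UNIV. \<phi> n j * u j)" by (rule ext)
    then have "linear_form ?a = ?g * const_RT (u 0) + ?h * const_RT (u 1)" by (simp only: linear_form_columns)
    moreover have "linear_form ?a = (\<Sum>n\<in>UNIV. (if n = m then single (single n 1) (f i) else 0)
        - (if n = i then single (single n 1) (f m) else 0))"
      unfolding linear_form_def by (intro sum.cong refl) (auto simp: single_diff)
    then have "linear_form ?a = l m" unfolding l_def by (simp add: sum_subtractf mult_single)
    ultimately show ?thesis by metis
  qed
  then obtain \<alpha> \<beta> where l: "\<And>m. l m = ?g * const_RT (\<alpha> m) + ?h * const_RT (\<beta> m)" by metis
  have col: "const_RT (f i) * sym_eq \<phi> c = const_RT (\<phi> j c) * l j + const_RT (\<phi> k c) * l k" for c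
  proof -
    have "(\<Sum>n\<in>UNIV. \<phi> n c * f n) = 0" by (rule hilbert_burch_column_syzygy[OF hb])
    then have "\<phi> i c * f i + \<phi> j c * f j + \<phi> k c * f k = 0" by (simp only: sum_3[OF jk])
    then have syz: "\<phi> i c * f i = - (\<phi> j c * f j) - \<phi> k c * f k"
      by (simp add: eq_neg_iff_add_eq_0 eq_diff_eq add_ac)
    have "const_RT (f i) * sym_eq \<phi> c = single (single i 1) (\<phi> i c * f i)
        + single (single j 1) (f i * \<phi> j c) + single (single k 1) (f i * \<phi> k c)"
      unfolding sym_eq_def linear_form_def sum_3[OF jk] by (simp add: distrib_left mult_single mult.commute)
    also have "\<dots> = const_RT (\<phi> j c) * l j + const_RT (\<phi> k c) * l k"
      unfolding syz l_def by (simp add: right_diff_distrib mult_single single_diff single_uminus mult_ac)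
    finally show ?thesis .
  qed
  define A where "A = const_RT (\<phi> j 0) * a + const_RT (\<phi> j 1) * b"
  define B where "B = const_RT (\<phi> k 0) * a + const_RT (\<phi> k 1) * b"
  have "l j * A + l k * B = (const_RT (\<phi> j 0) * l j + const_RT (\<phi> k 0) * l k) * a
      + (const_RT (\<phi> j 1) * l j + const_RT (\<phi> k 1) * l k) * b"
    unfolding A_def B_def by (simp add: algebra_simps)
  also have "\<dots> = const_RT (f i) * (?g * a + ?h * b)" unfolding col[symmetric] by (simp add: algebra_simps)
  finally have AB: "l j * A + l k * B = 0" by (simp add: rel)
  have "T_homogeneous r A" unfolding A_def by (intro T_homogeneous_add T_homogeneous_const_mult a b)
  then obtain w where w: "const_RT (f i) ^ r * A = l k * w"
    using koszul_exact_syzygy_forms[of r A i j k f B] jk fi AB unfolding l_def by blast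
  have "lookup (l k) (single k 1) = f i" using jk(2)
    by (auto simp: l_def lookup_minus mult_single lookup_single when_def)
  then have lk: "l k \<noteq> 0" using fi by (intro nonzero_if_lookup_nonzero[of _ "single k 1"]) (simp only: not_False_eq_True)
  have "l k * (l j * w + const_RT (f i) ^ r * B) = const_RT (f i) ^ r * (l j * A + l k * B)"
    using w by (simp add: distrib_left mult.left_commute)
  then have "l j * w + const_RT (f i) ^ r * B = 0" using lk by (simp add: AB)
  then have w': "const_RT (f i) ^ r * B = - (l j * w)" by (simp add: eq_neg_iff_add_eq_0 add.commute)
  have "\<alpha> j * \<phi> j c + \<alpha> k * \<phi> k c = (if c = 0 then f i else 0)" for c
  proof -
    let ?u = "\<lambda>n. (if n = 0 then \<alpha> j else \<beta> j) * \<phi> j c + (if n = 0 then \<alpha> k else \<beta> k) * \<phi> k c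
        - (if n = c then f i else 0)"
    have c01: "c = 0 \<or> c = 1" using UNIV_2 by blast
    have "linear_form (\<lambda>i. \<Sum>n\<in>UNIV. \<phi> i n * ?u n) =
        const_RT (\<phi> j c) * l j + const_RT (\<phi> k c) * l k - const_RT (f i) * sym_eq \<phi> c"
      unfolding linear_form_columns l const_RT_simps(2,3,6) using c01
      by (elim disjE) (simp_all add: algebra_simps)
    then have z: "linear_form (\<lambda>i. \<Sum>n\<in>UNIV. \<phi> i n * ?u n) = 0" by (simp add: col)
    have "(\<Sum>n\<in>UNIV. \<phi> m n * ?u n) = 0" for m
      using lookup_linear_form[of "\<lambda>i. \<Sum>n\<in>UNIV. \<phi> i n * ?u n" m] unfolding z by simp
    then have "?u 0 = 0" using inj[of ?u] by blast
    then show ?thesis by auto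
  qed
  from this[of 0] this[of 1]
  have det: "\<alpha> j * \<phi> j 0 + \<alpha> k * \<phi> k 0 = f i" "\<alpha> j * \<phi> j 1 + \<alpha> k * \<phi> k 1 = 0" by auto
  have "const_RT (\<alpha> j) * A + const_RT (\<alpha> k) * B
      = const_RT (\<alpha> j * \<phi> j 0 + \<alpha> k * \<phi> k 0) * a + const_RT (\<alpha> j * \<phi> j 1 + \<alpha> k * \<phi> k 1) * b"
    unfolding A_def B_def by (simp only: const_RT_simps(2,3)) (simp add: algebra_simps)
  then have fa: "const_RT (f i) * a = const_RT (\<alpha> j) * A + const_RT (\<alpha> k) * B"
    unfolding det by simp
  have "const_RT (f i) ^ Suc r * a = const_RT (f i) ^ r * (const_RT (f i) * a)" by (simp add: mult_ac)
  also have "\<dots> = const_RT (\<alpha> j) * (const_RT (f i) ^ r * A) + const_RT (\<alpha> k) * (const_RT (f i) ^ r * B)"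
    unfolding fa by (simp only: distrib_left mult.left_commute)
  also have "\<dots> = const_RT (\<alpha> j) * l k * w - const_RT (\<alpha> k) * l j * w"
    unfolding w w' by (simp add: mult_ac)
  also have "\<dots> = ?h * ((const_RT (\<alpha> j) * const_RT (\<beta> k) - const_RT (\<alpha> k) * const_RT (\<beta> j)) * w)"
    unfolding l by (simp only: algebra_simps)
  finally show ?thesis by blast
qed

lemma sym_eq_nonzero:
  fixes \<phi> :: "3 \<Rightarrow> 2 \<Rightarrow> 'a::field_char_0 R2"
  assumes hb: "hilbert_burch f d \<mu> \<phi>" shows "sym_eq \<phi> j \<noteq> 0"
proof
  assume z: "sym_eq \<phi> j = 0"
  have "\<phi> i j = 0" for i using lookup_linear_form[of "\<lambda>i. \<phi> i j" i] z by (simp add: sym_eq_def)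
  then have col: "\<forall>i. (\<Sum>k\<in>UNIV. \<phi> i k * (if k = j then 1 else 0)) = 0"
    by (simp add: if_distrib[of "\<lambda>x. _ * x"] cong: if_cong)
  have inj: "\<And>u. (\<forall>i. (\<Sum>k\<in>UNIV. \<phi> i k * u k) = 0) \<Longrightarrow> (\<forall>k. u k = 0)"
    using hb unfolding hilbert_burch_def by blast
  have "\<forall>k. (if k = j then 1 else 0) = (0 :: 'a R2)" by (rule inj[OF col])
  then have "(if j = j then 1 else 0) = (0 :: 'a R2)" by (rule spec)
  then show False by simp
qed

lemma bihomogeneous_sym_eq:
  assumes "hilbert_burch f d \<mu> \<phi>"
  shows "bihomogeneous 1 (int (if j = 0 then \<mu> else d - \<mu>)) (sym_eq \<phi> j)"
  unfolding bihomogeneous_def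
proof
  fix \<gamma> assume "\<gamma> \<in> keys (sym_eq \<phi> j)"
  then have nz: "lookup (sym_eq \<phi> j) \<gamma> \<noteq> 0" by (simp add: in_keys_iff)
  have eq: "lookup (sym_eq \<phi> j) \<gamma> = (\<Sum>i\<in>UNIV. if \<gamma> = single i 1 then \<phi> i j else 0)"
    unfolding sym_eq_def linear_form_def lookup_sum by (intro sum.cong refl) (auto simp: lookup_single when_def)
  have "\<exists>i. \<gamma> = single i 1"
  proof (rule ccontr)
    assume "\<nexists>i. \<gamma> = single i 1"
    then have "lookup (sym_eq \<phi> j) \<gamma> = 0" unfolding eq by (intro sum.neutral) auto
    then show False using nz by blast
  qed
  then obtain i where i: "\<gamma> = single i 1" by blast
  have "lookup (sym_eq \<phi> j) \<gamma> = \<phi> i j" unfolding i sym_eq_def by (rule lookup_linear_form)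
  then show "tdeg \<gamma> = 1 \<and> (\<forall>\<alpha>\<in>keys (lookup (sym_eq \<phi> j) \<gamma>). int (tdeg \<alpha>) = int (if j = 0 then \<mu> else d - \<mu>))"
    using hilbert_burch_column_degree[OF assms, of j i] by (auto simp: i homogeneous_def)
qed

lemma lookup_lookup_bi_part:
  "lookup (lookup (bi_part p q P) \<gamma>) \<alpha> =
     (if int (tdeg \<gamma>) = p \<and> int (tdeg \<alpha>) = q then lookup (lookup P \<gamma>) \<alpha> else 0)"
  by (simp add: lookup_bi_part lookup_hom_part)

lemma sum_bi_parts:
  fixes P :: "'c::comm_ring_1 RT"
  shows "\<exists>A :: (nat \<times> int) set. finite A \<and> P = (\<Sum>(p, q)\<in>A. bi_part (int p) q P)"
proof (intro exI conjI)
  let ?A = "tdeg ` keys P \<times> (\<lambda>\<alpha>. int (tdeg \<alpha>)) ` (\<Union>\<gamma>\<in>keys P. keys (lookup P \<gamma>))"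
  show fin: "finite ?A" by simp
  show "P = (\<Sum>(p, q)\<in>?A. bi_part (int p) q P)"
  proof (rule poly_mapping_eqI, rule poly_mapping_eqI)
    fix \<gamma> \<alpha>
    have "lookup (lookup (\<Sum>(p, q)\<in>?A. bi_part (int p) q P) \<gamma>) \<alpha>
        = (\<Sum>x\<in>?A. if x = (tdeg \<gamma>, int (tdeg \<alpha>)) then lookup (lookup P \<gamma>) \<alpha> else 0)"
      unfolding lookup_sum by (intro sum.cong refl) (auto simp: lookup_lookup_bi_part split: if_splits)
    also have "\<dots> = (if (tdeg \<gamma>, int (tdeg \<alpha>)) \<in> ?A then lookup (lookup P \<gamma>) \<alpha> else 0)"
      by (rule sum.delta[OF fin])
    also have "\<dots> = lookup (lookup P \<gamma>) \<alpha>"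
    proof (cases "lookup (lookup P \<gamma>) \<alpha> = 0")
      case False
      then have "\<gamma> \<in> keys P" "\<alpha> \<in> keys (lookup P \<gamma>)" by (auto simp: in_keys_iff)
      then show ?thesis by auto
    qed simp
    finally show "lookup (lookup P \<gamma>) \<alpha> = lookup (lookup (\<Sum>(p, q)\<in>?A. bi_part (int p) q P) \<gamma>) \<alpha>" by simp
  qed
qed

text \<open>For homogeneous \<open>a\<close> some powers of all \<open>f\<^sub>i\<close>, hence also \<open>x\<^sub>1\<^sup>N\<close> and \<open>x\<^sub>2\<^sup>N\<close>, multiply \<open>a\<close> into the ideal
  of the second equation \<open>h\<close>. From \<open>x\<^sub>1\<^sup>N a = h u\<close> and \<open>x\<^sub>2\<^sup>N a = h v\<close> it follows that
  \<open>x\<^sub>1\<^sup>N v = x\<^sub>2\<^sup>N u\<close>, so \<open>x\<^sub>1\<^sup>N\<close> divides \<open>u\<close> and \<open>h\<close> divides \<open>a\<close>.\<close>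

theorem koszul_exact_sym_eq:
  fixes f :: "3 \<Rightarrow> 'c::field_char_0 R2"
  assumes f: "\<And>i. homogeneous d (f i)" and hb: "hilbert_burch f d \<mu> \<phi>"
  shows "koszul_exact (sym_eq \<phi> 0) (sym_eq \<phi> 1)"
  unfolding koszul_exact_def
proof (intro allI impI)
  fix a b assume rel: "sym_eq \<phi> 0 * a + sym_eq \<phi> 1 * b = 0"
  let ?g = "sym_eq \<phi> 0" and ?h = "sym_eq \<phi> 1"
  let ?J = "{?h * w | w. True}"
  have J: "self_module.subspace ?J" by (rule subspace_multiples)
  have hom: "a' \<in> ?J" if a': "T_homogeneous r a'" and b': "T_homogeneous r b'" and rel': "?g * a' + ?h * b' = 0"
    for r a' b'
  proof -
    have "\<exists>k. const_RT (f i) ^ k * a' \<in> ?J" for i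
    proof (cases "f i = 0")
      case True
      then have "const_RT (f i) ^ 1 * a' = 0" by simp
      then have "const_RT (f i) ^ 1 * a' \<in> ?J" using self_module.subspace_0[OF J] by (simp only:)
      then show ?thesis by (rule exI)
    next
      case False
      obtain j k where "i \<noteq> j" "i \<noteq> k" "j \<noteq> k" using other_indices by blast
      then obtain w where "const_RT (f i) ^ Suc r * a' = ?h * w"
        using koszul_exact_sym_eq_localized[OF hb _ _ _ False a' b' rel'] by blast
      then show ?thesis by blast
    qed
    then obtain N where N: "\<And>i. xpow i N * a' \<in> ?J"
      using killed_by_powers_of_variables[OF f hb J] by blast
    obtain u where u: "xpow 0 N * a' = ?h * u" using N[of 0] by blast
    obtain v where v: "xpow 1 N * a' = ?h * v" using N[of 1] by blast
    have "?h * (xpow 0 N * v - xpow 1 N * u) = xpow 0 N * (?h * v) - xpow 1 N * (?h * u)"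
      by (simp add: right_diff_distrib mult.left_commute)
    also have "\<dots> = 0" unfolding u[symmetric] v[symmetric] by (simp add: mult.left_commute)
    finally have "xpow 0 N * v + xpow 1 N * - u = 0" using sym_eq_nonzero[OF hb, of 1] by simp
    then obtain t where "- u = - (xpow 0 N * t)" using koszul_exactD[OF koszul_exact_xpow] by blast
    then have "xpow 0 N * a' = xpow 0 N * (?h * t)" using u by (simp add: mult.left_commute)
    then have "a' = ?h * t" using xpow_nonzero[of 0 N, where 'c = 'c] by simp
    then show ?thesis by blast
  qed
  have part: "bi_part (int p) q a \<in> ?J" for p q
  proof (rule hom)
    let ?b = "bi_part (int p) (q + int \<mu> - int (d - \<mu>)) b"
    show "T_homogeneous p (bi_part (int p) q a)" "T_homogeneous p ?b"
      by (rule bihomogeneous_imp_T_homogeneous[OF bihomogeneous_bi_part])+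
    have "bi_part (int 1 + int p) (int \<mu> + q) (?g * a) = ?g * bi_part (int p) q a"
      using bi_part_mult[OF bihomogeneous_sym_eq[OF hb, of 0]] by simp
    moreover have "bi_part (int 1 + int p) (int (d - \<mu>) + (q + int \<mu> - int (d - \<mu>))) (?h * b) = ?h * ?b"
      using bi_part_mult[OF bihomogeneous_sym_eq[OF hb, of 1], of "int p" "q + int \<mu> - int (d - \<mu>)" b] by simp
    moreover have "int (d - \<mu>) + (q + int \<mu> - int (d - \<mu>)) = int \<mu> + q" by simp
    ultimately have "?g * bi_part (int p) q a + ?h * ?b = bi_part (int 1 + int p) (int \<mu> + q) (?g * a + ?h * b)"
      by (simp only: bi_part_add)
    then show "?g * bi_part (int p) q a + ?h * ?b = 0" by (simp only: rel bi_part_zero)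
  qed
  obtain A :: "(nat \<times> int) set" where "a = (\<Sum>(p, q)\<in>A. bi_part (int p) q a)" using sum_bi_parts by blast
  also have "\<dots> \<in> ?J" by (intro self_module.subspace_sum[OF J]) (auto intro: part[simplified])
  finally obtain u where u: "a = ?h * u" by blast
  have "?h * (?g * u + b) = 0" using rel by (simp add: u distrib_left mult.left_commute)
  then have "b = - (?g * u)" using sym_eq_nonzero[OF hb, of 1] by (simp add: eq_neg_iff_add_eq_0 add.commute)
  then show "\<exists>u. a = ?h * u \<and> b = - (?g * u)" using u by blast
qed

section \<open>The inverse system and the kernel\<close>

text \<open>The function \<open>u\<close> stands for the power series with coefficients \<open>u \<beta>\<close> in the dual variables, on which
  \<open>x\<^sup>\<kappa>\<close> acts by lowering exponents by \<open>\<kappa>\<close>.\<close>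

definition contraction :: "'c::comm_ring_1 R2 \<Rightarrow> (2 expo \<Rightarrow> 'c) \<Rightarrow> 2 expo \<Rightarrow> 'c" where
  "contraction r u \<eta> = (\<Sum>\<kappa>\<in>keys r. lookup r \<kappa> * u (\<kappa> + \<eta>))"

text \<open>The coefficient of \<open>T\<^sup>\<delta>\<close> in \<open>g\<^sub>j \<cdot> (\<Sum> T\<^sup>\<gamma> w\<^sub>\<gamma>)\<close>, with \<open>R\<close> acting by contraction.\<close>

definition sym_contraction ::
    "(3 \<Rightarrow> 2 \<Rightarrow> 'c::comm_ring_1 R2) \<Rightarrow> 2 \<Rightarrow> (3 expo \<Rightarrow> 2 expo \<Rightarrow> 'c) \<Rightarrow> 3 expo \<Rightarrow> 2 expo \<Rightarrow> 'c" where
  "sym_contraction \<phi> j w \<delta> \<eta> =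
     (\<Sum>i\<in>UNIV. if lookup \<delta> i = 0 then 0 else contraction (\<phi> i j) (w (\<delta> - single i 1)) \<eta>)"

definition inverse_system :: "(3 \<Rightarrow> 2 \<Rightarrow> 'c::comm_ring_1 R2) \<Rightarrow> nat \<Rightarrow> (3 expo \<Rightarrow> 2 expo \<Rightarrow> 'c) set" where
  "inverse_system \<phi> n = {w. (\<forall>\<gamma> \<beta>. w \<gamma> \<beta> \<noteq> 0 \<longrightarrow> tdeg \<gamma> = n) \<and> (\<forall>j \<delta> \<eta>. sym_contraction \<phi> j w \<delta> \<eta> = 0)}"

definition degree_part :: "nat \<Rightarrow> (3 expo \<Rightarrow> 2 expo \<Rightarrow> 'c::zero) \<Rightarrow> 3 expo \<Rightarrow> 2 expo \<Rightarrow> 'c" where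
  "degree_part k w = (\<lambda>\<gamma> \<beta>. if tdeg \<beta> = k then w \<gamma> \<beta> else 0)"

lemma contraction_homogeneous:
  assumes "homogeneous m r"
  shows "contraction r (degree_part k w \<gamma>) \<eta> = (if m + tdeg \<eta> = k then contraction r (w \<gamma>) \<eta> else 0)"
proof -
  have "contraction r (degree_part k w \<gamma>) \<eta>
      = (\<Sum>\<kappa>\<in>keys r. if m + tdeg \<eta> = k then lookup r \<kappa> * w \<gamma> (\<kappa> + \<eta>) else 0)"
    unfolding contraction_def using assms
    by (intro sum.cong refl) (auto simp: degree_part_def homogeneous_def)
  then show ?thesis by (simp add: contraction_def)
qed

lemma degree_part_inverse_system:
  assumes hb: "hilbert_burch f d \<mu> \<phi>" and w: "w \<in> inverse_system \<phi> n"
  shows "degree_part k w \<in> inverse_system \<phi> n"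
proof -
  have "sym_contraction \<phi> j (degree_part k w) \<delta> \<eta> =
      (if (if j = 0 then \<mu> else d - \<mu>) + tdeg \<eta> = k then sym_contraction \<phi> j w \<delta> \<eta> else 0)" for j \<delta> \<eta>
    unfolding sym_contraction_def contraction_homogeneous[OF hilbert_burch_column_degree[OF hb, of j]]
    by (simp cong: if_cong)
  then show ?thesis using w by (auto simp: inverse_system_def degree_part_def)
qed

lemma shift_inverse_system:
  assumes "w \<in> inverse_system \<phi> n" shows "(\<lambda>\<gamma> \<beta>. w \<gamma> (\<beta> + \<zeta>)) \<in> inverse_system \<phi> n"
proof -
  have "sym_contraction \<phi> j (\<lambda>\<gamma> \<beta>. w \<gamma> (\<beta> + \<zeta>)) \<delta> \<eta> = sym_contraction \<phi> j w \<delta> (\<eta> + \<zeta>)" for j \<delta> \<eta>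
    unfolding sym_contraction_def contraction_def add.assoc ..
  then show ?thesis using assms by (auto simp: inverse_system_def)
qed

lemma lookup_mult_eq_sum:
  fixes r s :: "'c::comm_ring_1 R2"
  shows "lookup (r * s) \<zeta> =
    (\<Sum>\<kappa>\<in>keys r. if \<forall>i. lookup \<kappa> i \<le> lookup \<zeta> i then lookup r \<kappa> * lookup s (\<zeta> - \<kappa>) else 0)"
proof -
  have "r * s = (\<Sum>\<kappa>\<in>keys r. single \<kappa> (lookup r \<kappa>) * s)"
    by (simp only: sum_distrib_right[symmetric] poly_mapping_sum_single[symmetric])
  then have "lookup (r * s) \<zeta> = (\<Sum>\<kappa>\<in>keys r. lookup (single \<kappa> (lookup r \<kappa>) * s) \<zeta>)"
    by (simp only: lookup_sum)
  then show ?thesis by (simp only: lookup_monomial_mult)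
qed

lemma lookup_sym_eq_mult:
  "lookup (sym_eq \<phi> j * W) \<delta> =
     (\<Sum>i\<in>UNIV. if lookup \<delta> i = 0 then 0 else \<phi> i j * lookup W (\<delta> - single i 1))"
proof -
  have le: "(\<forall>k. lookup (single i (1::nat)) k \<le> lookup \<delta> k) \<longleftrightarrow> lookup \<delta> i \<noteq> 0" for i
    by (auto simp: lookup_single when_def)
  have "lookup (sym_eq \<phi> j * W) \<delta> = (\<Sum>i\<in>UNIV. lookup (single (single i 1) (\<phi> i j) * W) \<delta>)"
    unfolding sym_eq_def linear_form_def sum_distrib_right lookup_sum ..
  then show ?thesis unfolding lookup_monomial_mult le by (auto intro!: sum.cong)
qed

text \<open>The exponent of the socle \<open>(x\<^sub>1x\<^sub>2)\<^sup>N\<^sup>-\<^sup>1\<close> of \<open>R/(x\<^sub>1\<^sup>N,x\<^sub>2\<^sup>N)\<close>. The monomials in the box are a basis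
  of this ring, and \<open>\<beta> \<mapsto> corner N - \<beta>\<close> is the duality between its complementary degrees.\<close>

definition corner :: "nat \<Rightarrow> 2 expo" where
  "corner N = single 0 (N - 1) + single 1 (N - 1)"

lemma lookup_corner: "lookup (corner N) i = N - 1"
proof -
  have "i = 0 \<or> i = 1" using UNIV_2 by blast
  then show ?thesis by (auto simp: corner_def lookup_add lookup_single)
qed

definition in_box :: "nat \<Rightarrow> 2 expo \<Rightarrow> bool" where
  "in_box N \<beta> \<longleftrightarrow> (\<forall>i. lookup \<beta> i < N)"

lemma in_box_iff: "in_box N \<beta> \<longleftrightarrow> \<not> (N \<le> lookup \<beta> 0 \<or> N \<le> lookup \<beta> 1)"
proof -
  have "i = 0 \<or> i = 1" for i :: 2 using UNIV_2 by blast
  then have "in_box N \<beta> \<longleftrightarrow> lookup \<beta> 0 < N \<and> lookup \<beta> 1 < N" unfolding in_box_def by metis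
  then show ?thesis by (simp add: not_le)
qed

lemma corner_minus:
  assumes "in_box N \<beta>"
  shows "in_box N (corner N - \<beta>)" "corner N - (corner N - \<beta>) = \<beta>" "tdeg (corner N - \<beta>) + tdeg \<beta> = 2 * (N - 1)"
proof -
  have b: "lookup \<beta> i \<le> N - 1" "0 < N" for i using assms by (auto simp: in_box_def dest: spec[of _ i])
  show "in_box N (corner N - \<beta>)" using b by (auto simp: in_box_def lookup_minus lookup_corner)
  show "corner N - (corner N - \<beta>) = \<beta>"
  proof (rule poly_mapping_eqI)
    fix i
    show "lookup (corner N - (corner N - \<beta>)) i = lookup \<beta> i"
      using b(1)[of i] b(2) by (simp add: lookup_minus lookup_corner)
  qed
  have "tdeg (corner N - \<beta>) + tdeg \<beta> = tdeg (corner N - \<beta> + \<beta>)" by simp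
  also have "corner N - \<beta> + \<beta> = corner N" using b by (intro expo_diff_add) (simp add: lookup_corner)
  finally show "tdeg (corner N - \<beta>) + tdeg \<beta> = 2 * (N - 1)" by (simp add: corner_def)
qed

lemma not_in_box_tdeg: "\<not> in_box N \<beta> \<Longrightarrow> N \<le> tdeg \<beta>"
  unfolding in_box_def not_all not_less using lookup_le_tdeg order_trans by blast

text \<open>Read backwards from the corner, multiplication becomes contraction. The contraction also has
  terms that correspond to no monomial of the product; they leave the box, and there \<open>w\<close> vanishes
  because its degrees are below \<open>N\<close>.\<close>

lemma lookup_sym_eq_mult_dual:
  fixes W :: "'c::field_char_0 RT"
  assumes dual: "\<And>\<gamma> \<epsilon>. in_box N \<epsilon> \<Longrightarrow> lookup (lookup W \<gamma>) \<epsilon> = w \<gamma> (corner N - \<epsilon>)"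
    and w: "\<And>\<gamma> \<beta>. w \<gamma> \<beta> \<noteq> 0 \<Longrightarrow> tdeg \<beta> < N" and \<zeta>: "in_box N \<zeta>"
  shows "lookup (lookup (sym_eq \<phi> j * W) \<delta>) \<zeta> = sym_contraction \<phi> j w \<delta> (corner N - \<zeta>)"
proof -
  have "lookup (\<phi> i j * lookup W \<gamma>) \<zeta> = contraction (\<phi> i j) (w \<gamma>) (corner N - \<zeta>)" for i \<gamma>
    unfolding lookup_mult_eq_sum contraction_def
  proof (intro sum.cong refl)
    fix \<kappa>
    show "(if \<forall>i. lookup \<kappa> i \<le> lookup \<zeta> i then lookup (\<phi> i j) \<kappa> * lookup (lookup W \<gamma>) (\<zeta> - \<kappa>) else 0)
        = lookup (\<phi> i j) \<kappa> * w \<gamma> (\<kappa> + (corner N - \<zeta>))"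
    proof (cases "\<forall>i. lookup \<kappa> i \<le> lookup \<zeta> i")
      case True
      have "in_box N (\<zeta> - \<kappa>)" using \<zeta> by (auto simp: in_box_def lookup_minus less_imp_diff_less)
      moreover have "corner N - (\<zeta> - \<kappa>) = \<kappa> + (corner N - \<zeta>)"
      proof (rule poly_mapping_eqI)
        fix i
        have "lookup \<zeta> i < N" "lookup \<kappa> i \<le> lookup \<zeta> i" using \<zeta> True by (auto simp: in_box_def)
        then show "lookup (corner N - (\<zeta> - \<kappa>)) i = lookup (\<kappa> + (corner N - \<zeta>)) i"
          by (simp add: lookup_add lookup_minus lookup_corner)
      qed
      ultimately show ?thesis using True dual by simp
    next
      case False
      then obtain i where "lookup \<zeta> i < lookup \<kappa> i" by (auto simp: not_le)
      moreover have "lookup \<zeta> i < N" using \<zeta> by (auto simp: in_box_def)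
      ultimately have "N \<le> lookup (\<kappa> + (corner N - \<zeta>)) i"
        by (simp add: lookup_add lookup_minus lookup_corner)
      then have "\<not> tdeg (\<kappa> + (corner N - \<zeta>)) < N" using lookup_le_tdeg[of "\<kappa> + (corner N - \<zeta>)" i] by linarith
      then have "w \<gamma> (\<kappa> + (corner N - \<zeta>)) = 0" using w by blast
      then show ?thesis unfolding if_not_P[OF False] by simp
    qed
  qed
  then show ?thesis unfolding lookup_sym_eq_mult lookup_sum sym_contraction_def
    by (intro sum.cong refl) simp
qed

lemma sym_eq_mult_in_xpow_ideal_iff:
  fixes W :: "'c::field_char_0 RT"
  assumes dual: "\<And>\<gamma> \<epsilon>. in_box N \<epsilon> \<Longrightarrow> lookup (lookup W \<gamma>) \<epsilon> = w \<gamma> (corner N - \<epsilon>)"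
    and w: "\<And>\<gamma> \<beta>. w \<gamma> \<beta> \<noteq> 0 \<Longrightarrow> tdeg \<beta> < N"
  shows "(\<exists>u v. sym_eq \<phi> j * W = xpow 1 N * u - xpow 0 N * v) \<longleftrightarrow> (\<forall>\<delta> \<eta>. sym_contraction \<phi> j w \<delta> \<eta> = 0)"
proof -
  have "(\<exists>u v. sym_eq \<phi> j * W = xpow 1 N * u - xpow 0 N * v)
      \<longleftrightarrow> (\<forall>\<delta> \<zeta>. in_box N \<zeta> \<longrightarrow> lookup (lookup (sym_eq \<phi> j * W) \<delta>) \<zeta> = 0)"
    unfolding xpow_ideal_iff in_box_iff by blast
  also have "\<dots> \<longleftrightarrow> (\<forall>\<delta> \<zeta>. in_box N \<zeta> \<longrightarrow> sym_contraction \<phi> j w \<delta> (corner N - \<zeta>) = 0)"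
    using lookup_sym_eq_mult_dual[OF dual w] by simp
  also have "\<dots> \<longleftrightarrow> (\<forall>\<delta> \<eta>. sym_contraction \<phi> j w \<delta> \<eta> = 0)"
  proof (intro iffI allI impI)
    fix \<delta> \<eta> assume *: "\<forall>\<delta> \<zeta>. in_box N \<zeta> \<longrightarrow> sym_contraction \<phi> j w \<delta> (corner N - \<zeta>) = 0"
    show "sym_contraction \<phi> j w \<delta> \<eta> = 0"
    proof (cases "in_box N \<eta>")
      case True
      then show ?thesis using * corner_minus(1,2)[OF True] by metis
    next
      case False
      then have "N \<le> tdeg \<eta>" by (rule not_in_box_tdeg)
      then have "w \<gamma> (\<kappa> + \<eta>) = 0" for \<gamma> \<kappa> using w[of \<gamma> "\<kappa> + \<eta>"] by fastforce
      then show ?thesis by (auto simp: sym_contraction_def contraction_def intro!: sum.neutral)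
    qed
  qed auto
  finally show ?thesis .
qed

lemma bi_part_mult_pure:
  fixes g :: "'c::comm_ring_1 RT"
  assumes "bihomogeneous p' q' g" "bi_part p q a = a" "P = int p' + p" "Q = q' + q"
  shows "bi_part P Q (g * a) = g * a"
  using bi_part_mult[OF assms(1), of p q a] assms by simp

lemma bi_part_idem [simp]: "bi_part p q (bi_part p q P) = bi_part p q P"
  by (intro poly_mapping_eqI) (simp add: lookup_lookup_bi_part)

lemma kernel_piece_nonzero_iff:
  "kernel_piece_nonzero f p q \<longleftrightarrow> (\<exists>P. bihomogeneous p q P \<and> rees_map f P = 0 \<and> P \<notin> sym_ideal f)"
proof -
  note cl = ideal_gen_closed[where B = "{linear_form a | a. (\<Sum>i\<in>UNIV. a i * f i) = 0}", folded sym_ideal_def]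
  have class_eq: "sym_class f P = sym_class f 0 \<longleftrightarrow> P \<in> sym_ideal f" for P
  proof
    assume "sym_class f P = sym_class f 0"
    moreover have "P \<in> sym_class f P" using cl(1) by (simp add: sym_class_def)
    ultimately show "P \<in> sym_ideal f" by (simp add: sym_class_def)
  next
    assume P: "P \<in> sym_ideal f"
    have "Q - P \<in> sym_ideal f \<longleftrightarrow> Q \<in> sym_ideal f" for Q
    proof
      assume "Q - P \<in> sym_ideal f"
      then have "(Q - P) + P \<in> sym_ideal f" using P by (rule cl(2))
      then show "Q \<in> sym_ideal f" by simp
    next
      assume "Q \<in> sym_ideal f"
      then have "Q + (- 1) * P \<in> sym_ideal f" using P by (intro cl(2,3))
      then show "Q - P \<in> sym_ideal f" by simp
    qed
    then show "sym_class f P = sym_class f 0" by (simp add: sym_class_def)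
  qed
  have "bihomogeneous p q 0" "rees_map f 0 = 0" by (auto simp: bihomogeneous_def rees_map_def)
  then have "sym_class f 0 \<in> kernel_piece f p q" unfolding kernel_piece_def by blast
  then have "kernel_piece_nonzero f p q \<longleftrightarrow> (\<exists>X\<in>kernel_piece f p q. X \<noteq> sym_class f 0)"
    unfolding kernel_piece_nonzero_def by blast
  also have "\<dots> \<longleftrightarrow> (\<exists>P. bihomogeneous p q P \<and> rees_map f P = 0 \<and> P \<notin> sym_ideal f)"
    unfolding kernel_piece_def using class_eq by blast
  finally show ?thesis .
qed

lemma rees_map_xpow_mult_eq_0:
  fixes f :: "3 \<Rightarrow> 'c::field_char_0 R2"
  assumes "rees_map f (xpow i N * P) = 0" shows "rees_map f P = 0"
proof -
  have "rees_map f (xpow i N) = [:single (single i N) 1:]"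
    by (simp add: rees_map_def xpow_def eval_RT_single[OF const_poly_hom])
  moreover have "lookup (single (single i N) (1 :: 'c)) (single i N) \<noteq> 0" by simp
  then have "single (single i N) (1 :: 'c) \<noteq> 0" by (rule nonzero_if_lookup_nonzero)
  ultimately have "rees_map f (xpow i N) \<noteq> 0" by simp
  then show ?thesis using assms by (simp add: ring_hom_simps(3)[OF rees_map_hom])
qed

lemma lookup_sum_of_monomials:
  fixes w :: "3 expo \<Rightarrow> 2 expo \<Rightarrow> 'c::comm_ring_1"
  assumes fin: "finite A" "finite B"
  defines "W \<equiv> (\<Sum>\<gamma>\<in>A. \<Sum>\<epsilon>\<in>B. single \<gamma> (single \<epsilon> (w \<gamma> \<epsilon>)))"
  shows "lookup (lookup W \<gamma>) \<epsilon> = (if \<gamma> \<in> A \<and> \<epsilon> \<in> B then w \<gamma> \<epsilon> else 0)"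
proof -
  have "lookup (lookup W \<gamma>) \<epsilon>
      = (\<Sum>\<gamma>'\<in>A. if \<gamma>' = \<gamma> then \<Sum>\<epsilon>'\<in>B. if \<epsilon>' = \<epsilon> then w \<gamma>' \<epsilon>' else 0 else 0)"
    unfolding W_def lookup_sum by (intro sum.cong refl) (auto simp: lookup_single when_def lookup_sum intro!: sum.cong)
  then show ?thesis using fin by simp
qed

text \<open>The bidegree of the linked element \<open>W\<close> is \<open>(p - 2, q + 2N - d)\<close>, as \<open>P\<close> has bidegree \<open>(p, q)\<close> and
  \<open>bideg P + bideg x\<^sub>1\<^sup>Nx\<^sub>2\<^sup>N = bideg W + bideg g\<^sub>1g\<^sub>2\<close>. Counted from the corner, of degree \<open>2N - 2\<close>, its
  monomials have degree \<open>d - 2 - q\<close>.\<close>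

lemma inverse_system_of_kernel:
  fixes f :: "3 \<Rightarrow> 'c::field_char_0 R2"
  assumes f: "\<And>i. homogeneous d (f i)" and hb: "hilbert_burch f d \<mu> \<phi>" and p: "2 \<le> p"
    and P: "bihomogeneous p q P" "rees_map f P = 0" "P \<notin> sym_ideal f"
  shows "\<exists>w\<in>inverse_system \<phi> (p - 2). \<exists>\<gamma> \<beta>. w \<gamma> \<beta> \<noteq> 0 \<and> int (tdeg \<beta>) = int d - 2 - q"
proof -
  let ?g = "sym_eq \<phi> 0" and ?h = "sym_eq \<phi> 1"
  have mu: "\<mu> \<le> d" using hb by (simp add: hilbert_burch_def)
  have g: "bihomogeneous 1 (int \<mu>) ?g" and h: "bihomogeneous 1 (int (d - \<mu>)) ?h"
    using bihomogeneous_sym_eq[OF hb, of 0] bihomogeneous_sym_eq[OF hb, of 1] by auto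
  have "self_module.subspace (sym_ideal f)" unfolding sym_ideal_def ideal_gen_def by simp
  moreover have "\<exists>k. const_RT (f i) ^ k * P \<in> sym_ideal f" for i
    using power_times_rees_kernel[OF bihomogeneous_imp_T_homogeneous[OF P(1)] P(2)] by blast
  ultimately obtain N\<^sub>0 where N0: "\<And>N i. N \<ge> N\<^sub>0 \<Longrightarrow> xpow i N * P \<in> sym_ideal f"
    using killed_by_powers_of_variables[OF f hb] by blast
  \<comment> \<open>The power \<open>x\<^sub>i\<^sup>N\<close> kills \<open>P\<close>, and all monomials of degree \<open>d - 2 - q\<close> lie in the box of \<open>N\<close>.\<close>
  define N where "N = N\<^sub>0 + nat (int d - 2 - q) + 1"
  then have N1: "1 \<le> N" by simp
  let ?z = "xpow 0 N" and ?y = "xpow 1 N"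
  have rep: "\<exists>a\<^sub>1 a\<^sub>2. xpow i N * P = ?g * a\<^sub>1 + ?h * a\<^sub>2 \<and> bi_part (int p - 1) (int N + q - int \<mu>) a\<^sub>1 = a\<^sub>1 \<and>
      bi_part (int p - 1) (int N + q - int (d - \<mu>)) a\<^sub>2 = a\<^sub>2" for i
  proof -
    obtain c\<^sub>1 c\<^sub>2 where c: "xpow i N * P = ?g * c\<^sub>1 + ?h * c\<^sub>2"
      using N0[of N i] sym_ideal_eq[OF hb] by (auto simp: N_def)
    have "bi_part (int 0 + int p) (int N + q) (xpow i N * P) = xpow i N * P"
      by (rule bi_part_mult_pure[OF bihomogeneous_xpow bi_part_bihomogeneous[OF P(1)]]) simp_all
    then have "xpow i N * P = bi_part (int p) (int N + q) (?g * c\<^sub>1) + bi_part (int p) (int N + q) (?h * c\<^sub>2)"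
      using c by (simp add: bi_part_add)
    also have "bi_part (int p) (int N + q) (?g * c\<^sub>1) = ?g * bi_part (int p - 1) (int N + q - int \<mu>) c\<^sub>1"
      using bi_part_mult[OF g, of "int p - 1" "int N + q - int \<mu>" c\<^sub>1] by simp
    also have "bi_part (int p) (int N + q) (?h * c\<^sub>2) = ?h * bi_part (int p - 1) (int N + q - int (d - \<mu>)) c\<^sub>2"
      using bi_part_mult[OF h, of "int p - 1" "int N + q - int (d - \<mu>)" c\<^sub>2] by simp
    finally show ?thesis using bi_part_idem by blast
  qed
  obtain a\<^sub>1 a\<^sub>2 where a: "?z * P = ?g * a\<^sub>1 + ?h * a\<^sub>2" "bi_part (int p - 1) (int N + q - int \<mu>) a\<^sub>1 = a\<^sub>1"
      "bi_part (int p - 1) (int N + q - int (d - \<mu>)) a\<^sub>2 = a\<^sub>2" using rep by blast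
  obtain b\<^sub>1 b\<^sub>2 where b: "?y * P = ?g * b\<^sub>1 + ?h * b\<^sub>2" "bi_part (int p - 1) (int N + q - int \<mu>) b\<^sub>1 = b\<^sub>1"
      "bi_part (int p - 1) (int N + q - int (d - \<mu>)) b\<^sub>2 = b\<^sub>2" using rep by blast
  note gh = koszul_exact_sym_eq[OF f hb]
  obtain W\<^sub>0 where W0: "?h * W\<^sub>0 = ?y * a\<^sub>1 - ?z * b\<^sub>1" "- (?g * W\<^sub>0) = ?y * a\<^sub>2 - ?z * b\<^sub>2"
    using linkage_forward[OF gh a(1) b(1)] by blast
  define W where "W = bi_part (int p - 2) (q + 2 * int N - int d) W\<^sub>0"
  have hW: "?h * W = ?y * a\<^sub>1 - ?z * b\<^sub>1"
  proof -
    have "?h * W = bi_part (int p - 1) (2 * int N + q - int \<mu>) (?h * W\<^sub>0)"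
      using bi_part_mult[OF h, of "int p - 2" "q + 2 * int N - int d" W\<^sub>0] mu
      by (simp add: W_def of_nat_diff algebra_simps)
    also have "\<dots> = ?y * a\<^sub>1 - ?z * b\<^sub>1"
      unfolding W0(1) bi_part_diff
      by (simp add: bi_part_mult_pure[OF bihomogeneous_xpow a(2)] bi_part_mult_pure[OF bihomogeneous_xpow b(2)])
    finally show ?thesis .
  qed
  have gW: "- (?g * W) = ?y * a\<^sub>2 - ?z * b\<^sub>2"
  proof -
    have "- (?g * W) = bi_part (int p - 1) (2 * int N + q - int (d - \<mu>)) (- (?g * W\<^sub>0))"
      using bi_part_mult[OF g, of "int p - 2" "q + 2 * int N - int d" W\<^sub>0] mu
      by (simp add: W_def of_nat_diff algebra_simps bi_part_uminus)
    also have "\<dots> = ?y * a\<^sub>2 - ?z * b\<^sub>2"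
      unfolding W0(2) bi_part_diff
      by (simp add: bi_part_mult_pure[OF bihomogeneous_xpow a(3)] bi_part_mult_pure[OF bihomogeneous_xpow b(3)])
    finally show ?thesis .
  qed
  have "\<not> (\<exists>u v. W = ?y * u - ?z * v)"
    using linkage_membership[OF gh koszul_exact_xpow sym_eq_nonzero[OF hb] xpow_nonzero a(1) b(1) hW gW]
      P(3) sym_ideal_eq[OF hb] by blast
  then obtain \<gamma> \<epsilon> where \<epsilon>: "lookup (lookup W \<gamma>) \<epsilon> \<noteq> 0" "in_box N \<epsilon>"
    unfolding xpow_ideal_iff in_box_iff by blast
  define w where "w \<gamma> \<beta> = (if in_box N \<beta> then lookup (lookup W \<gamma>) (corner N - \<beta>) else 0)" for \<gamma> \<beta>
  have w_deg: "tdeg \<gamma> = p - 2 \<and> int (tdeg \<beta>) = int d - 2 - q" if "w \<gamma> \<beta> \<noteq> 0" for \<gamma> \<beta>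
  proof -
    have \<beta>: "in_box N \<beta>" "lookup (lookup W \<gamma>) (corner N - \<beta>) \<noteq> 0" using that by (auto simp: w_def split: if_splits)
    then have "int (tdeg \<gamma>) = int p - 2" "int (tdeg (corner N - \<beta>)) = q + 2 * int N - int d"
      by (auto simp: W_def lookup_lookup_bi_part split: if_splits)
    moreover have "int (tdeg (corner N - \<beta>)) + int (tdeg \<beta>) = 2 * int N - 2"
      using corner_minus(3)[OF \<beta>(1)] N1 by linarith
    ultimately show ?thesis using p by linarith
  qed
  have dual: "lookup (lookup W \<gamma>) \<epsilon> = w \<gamma> (corner N - \<epsilon>)" if "in_box N \<epsilon>" for \<gamma> \<epsilon>
    using corner_minus(1,2)[OF that] by (simp add: w_def)
  have small: "tdeg \<beta> < N" if "w \<gamma> \<beta> \<noteq> 0" for \<gamma> \<beta> using w_deg[OF that] by (auto simp: N_def)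
  have mem: "\<exists>u v. sym_eq \<phi> j * W = ?y * u - ?z * v" for j
  proof -
    have "?g * W = ?y * - a\<^sub>2 - ?z * - b\<^sub>2" using gW by (simp add: minus_equation_iff[of "?g * W"])
    moreover have "j = 0 \<or> j = 1" using UNIV_2 by blast
    ultimately show ?thesis using hW by blast
  qed
  have "(\<exists>u v. sym_eq \<phi> j * W = ?y * u - ?z * v) \<longleftrightarrow> (\<forall>\<delta> \<eta>. sym_contraction \<phi> j w \<delta> \<eta> = 0)" for j
    by (rule sym_eq_mult_in_xpow_ideal_iff) (erule dual, erule small)
  then have "sym_contraction \<phi> j w \<delta> \<eta> = 0" for j \<delta> \<eta> using mem by blast
  then have "w \<in> inverse_system \<phi> (p - 2)" using w_deg by (auto simp: inverse_system_def)
  moreover have "w \<gamma> (corner N - \<epsilon>) \<noteq> 0" using \<epsilon> dual by simp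
  ultimately show ?thesis using w_deg by blast
qed

lemma kernel_of_inverse_system:
  fixes f :: "3 \<Rightarrow> 'c::field_char_0 R2"
  assumes f: "\<And>i. homogeneous d (f i)" and hb: "hilbert_burch f d \<mu> \<phi>" and p: "2 \<le> p"
    and w0: "w\<^sub>0 \<in> inverse_system \<phi> (p - 2)" "w\<^sub>0 \<gamma>\<^sub>0 \<beta>\<^sub>0 \<noteq> 0" and q: "int (tdeg \<beta>\<^sub>0) = int d - 2 - q"
  shows "\<exists>P. bihomogeneous p q P \<and> rees_map f P = 0 \<and> P \<notin> sym_ideal f"
proof -
  let ?g = "sym_eq \<phi> 0" and ?h = "sym_eq \<phi> 1"
  have mu: "\<mu> \<le> d" using hb by (simp add: hilbert_burch_def)
  have g: "bihomogeneous 1 (int \<mu>) ?g" and h: "bihomogeneous 1 (int (d - \<mu>)) ?h"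
    using bihomogeneous_sym_eq[OF hb, of 0] bihomogeneous_sym_eq[OF hb, of 1] by auto
  define N where "N = tdeg \<beta>\<^sub>0 + 1"
  then have N1: "1 \<le> N" by simp
  let ?z = "xpow 0 N :: 'c RT" and ?y = "xpow 1 N :: 'c RT"
  define w where "w = degree_part (tdeg \<beta>\<^sub>0) w\<^sub>0"
  have w: "w \<in> inverse_system \<phi> (p - 2)" unfolding w_def by (rule degree_part_inverse_system[OF hb w0(1)])
  have w_nz: "w \<gamma>\<^sub>0 \<beta>\<^sub>0 \<noteq> 0" using w0(2) by (simp add: w_def degree_part_def)
  have w_deg: "tdeg \<gamma> = p - 2 \<and> tdeg \<beta> = tdeg \<beta>\<^sub>0" if "w \<gamma> \<beta> \<noteq> 0" for \<gamma> \<beta>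
    using that w by (auto simp: inverse_system_def) (auto simp: w_def degree_part_def split: if_splits)
  have "finite {\<epsilon> :: 2 expo. in_box N \<epsilon>}"
    by (rule finite_subset[OF _ finite_expos_le[of N]]) (auto simp: in_box_def less_imp_le)
  define W where "W = (\<Sum>\<gamma>\<in>T_expos (p - 2). \<Sum>\<epsilon>\<in>{\<epsilon>. in_box N \<epsilon>}. single \<gamma> (single \<epsilon> (w \<gamma> (corner N - \<epsilon>))))"
  have lookup_W: "lookup (lookup W \<gamma>) \<epsilon> = (if in_box N \<epsilon> then w \<gamma> (corner N - \<epsilon>) else 0)" for \<gamma> \<epsilon>
    using lookup_sum_of_monomials[OF finite_T_expos[of "p - 2"] \<open>finite {\<epsilon>. in_box N \<epsilon>}\<close>,
        where w = "\<lambda>\<gamma> \<epsilon>. w \<gamma> (corner N - \<epsilon>)" and \<gamma> = \<gamma> and \<epsilon> = \<epsilon>]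
      w_deg[of \<gamma> "corner N - \<epsilon>"] by (auto simp: W_def T_expos_def)
  have dual: "lookup (lookup W \<gamma>) \<epsilon> = w \<gamma> (corner N - \<epsilon>)" if "in_box N \<epsilon>" for \<gamma> \<epsilon>
    using that by (simp add: lookup_W)
  have small: "tdeg \<beta> < N" if "w \<gamma> \<beta> \<noteq> 0" for \<gamma> \<beta> using w_deg[OF that] by (simp add: N_def)
  have W_deg: "bi_part (int p - 2) (q + 2 * int N - int d) W = W"
  proof (intro poly_mapping_eqI)
    fix \<gamma> \<epsilon>
    have "int (tdeg \<gamma>) = int p - 2 \<and> int (tdeg \<epsilon>) = q + 2 * int N - int d" if nz: "lookup (lookup W \<gamma>) \<epsilon> \<noteq> 0"
    proof -
      have \<epsilon>: "in_box N \<epsilon>" "w \<gamma> (corner N - \<epsilon>) \<noteq> 0" using nz by (auto simp: lookup_W split: if_splits)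
      have "int (tdeg (corner N - \<epsilon>)) + int (tdeg \<epsilon>) = 2 * int N - 2"
        using corner_minus(3)[OF \<epsilon>(1)] N1 by linarith
      then show ?thesis using w_deg[OF \<epsilon>(2)] p q by linarith
    qed
    then show "lookup (lookup (bi_part (int p - 2) (q + 2 * int N - int d) W) \<gamma>) \<epsilon> = lookup (lookup W \<gamma>) \<epsilon>"
      by (auto simp: lookup_lookup_bi_part)
  qed
  have rep: "\<exists>u v. sym_eq \<phi> j * W = ?y * u - ?z * v \<and>
      bi_part (int p - 1) (m + q + int N - int d) u = u \<and> bi_part (int p - 1) (m + q + int N - int d) v = v"
    if m: "bihomogeneous 1 m (sym_eq \<phi> j)" for j m
  proof -
    have "(\<exists>u v. sym_eq \<phi> j * W = ?y * u - ?z * v) \<longleftrightarrow> (\<forall>\<delta> \<eta>. sym_contraction \<phi> j w \<delta> \<eta> = 0)"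
      by (rule sym_eq_mult_in_xpow_ideal_iff) (erule dual, erule small)
    moreover have "\<forall>\<delta> \<eta>. sym_contraction \<phi> j w \<delta> \<eta> = 0" using w by (simp add: inverse_system_def)
    ultimately obtain u v where uv: "sym_eq \<phi> j * W = ?y * u - ?z * v" by blast
    have "sym_eq \<phi> j * W = bi_part (int p - 1) (m + q + 2 * int N - int d) (sym_eq \<phi> j * W)"
      by (rule bi_part_mult_pure[OF m W_deg, symmetric]) simp_all
    also have "\<dots> = bi_part (int p - 1) (m + q + 2 * int N - int d) (?y * u)
        - bi_part (int p - 1) (m + q + 2 * int N - int d) (?z * v)" unfolding uv by (rule bi_part_diff)
    also have "\<dots> = ?y * bi_part (int p - 1) (m + q + int N - int d) u - ?z * bi_part (int p - 1) (m + q + int N - int d) v"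
      using bi_part_mult[OF bihomogeneous_xpow, of "int p - 1" N "m + q + int N - int d" 1 u]
        bi_part_mult[OF bihomogeneous_xpow, of "int p - 1" N "m + q + int N - int d" 0 v]
      by (simp add: algebra_simps)
    finally show ?thesis using bi_part_idem by blast
  qed
  obtain a\<^sub>1 b\<^sub>1 where a1: "?h * W = ?y * a\<^sub>1 - ?z * b\<^sub>1"
      "bi_part (int p - 1) (int (d - \<mu>) + q + int N - int d) a\<^sub>1 = a\<^sub>1"
      "bi_part (int p - 1) (int (d - \<mu>) + q + int N - int d) b\<^sub>1 = b\<^sub>1" using rep[OF h] by blast
  obtain a\<^sub>2' b\<^sub>2' where a2': "?g * W = ?y * a\<^sub>2' - ?z * b\<^sub>2'"
      "bi_part (int p - 1) (int \<mu> + q + int N - int d) a\<^sub>2' = a\<^sub>2'"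
      "bi_part (int p - 1) (int \<mu> + q + int N - int d) b\<^sub>2' = b\<^sub>2'" using rep[OF g] by blast
  define a\<^sub>2 b\<^sub>2 where "a\<^sub>2 = - a\<^sub>2'" and "b\<^sub>2 = - b\<^sub>2'"
  have a2: "- (?g * W) = ?y * a\<^sub>2 - ?z * b\<^sub>2"
      "bi_part (int p - 1) (int \<mu> + q + int N - int d) a\<^sub>2 = a\<^sub>2"
      "bi_part (int p - 1) (int \<mu> + q + int N - int d) b\<^sub>2 = b\<^sub>2"
    using a2' by (auto simp: a\<^sub>2_def b\<^sub>2_def bi_part_uminus)
  obtain P\<^sub>0 where P0: "?z * P\<^sub>0 = ?g * a\<^sub>1 + ?h * a\<^sub>2" "?y * P\<^sub>0 = ?g * b\<^sub>1 + ?h * b\<^sub>2"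
    using linkage_backward[OF koszul_exact_xpow a1(1) a2(1)] by blast
  define P where "P = bi_part (int p) q P\<^sub>0"
  have xP: "xpow i N * P = bi_part (int p) (int N + q) (xpow i N * P\<^sub>0)" for i
    using bi_part_mult[OF bihomogeneous_xpow, of "int p" N q i P\<^sub>0] by (simp add: P_def)
  have zP: "?z * P = ?g * a\<^sub>1 + ?h * a\<^sub>2"
    unfolding xP P0 bi_part_add
    using mu by (simp add: bi_part_mult_pure[OF g a1(2)] bi_part_mult_pure[OF h a2(2)] of_nat_diff)
  have yP: "?y * P = ?g * b\<^sub>1 + ?h * b\<^sub>2"
    unfolding xP P0 bi_part_add
    using mu by (simp add: bi_part_mult_pure[OF g a1(3)] bi_part_mult_pure[OF h a2(3)] of_nat_diff)
  have "in_box N \<beta>\<^sub>0" using not_in_box_tdeg[of N \<beta>\<^sub>0] by (auto simp: N_def)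
  then have "in_box N (corner N - \<beta>\<^sub>0)" "lookup (lookup W \<gamma>\<^sub>0) (corner N - \<beta>\<^sub>0) \<noteq> 0"
    using corner_minus(1,2)[of N \<beta>\<^sub>0] w_nz by (auto simp: lookup_W)
  then have "\<not> (\<exists>u v. W = ?y * u - ?z * v)" unfolding xpow_ideal_iff in_box_iff by blast
  then have "P \<notin> sym_ideal f"
    using linkage_membership[OF koszul_exact_sym_eq[OF f hb] koszul_exact_xpow sym_eq_nonzero[OF hb] xpow_nonzero
        zP yP a1(1) a2(1)] sym_ideal_eq[OF hb] by blast
  moreover have "?z * P \<in> sym_ideal f" using zP sym_ideal_eq[OF hb] by blast
  then have "rees_map f P = 0" by (rule rees_map_xpow_mult_eq_0[OF rees_map_sym_ideal])
  moreover have "bihomogeneous p q P" unfolding P_def by (rule bihomogeneous_bi_part)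
  ultimately show ?thesis by blast
qed

text \<open>This is local duality for \<open>Sym\<^sub>p(I)\<close>: \<open>\<K>\<^sub>p = H\<^sup>0\<^sub>m(Sym\<^sub>p(I))\<close> is dual to \<open>Ext\<^sup>2\<^sub>R(Sym\<^sub>p(I), R)\<close>, which
  the Koszul complex identifies with \<open>Q\<close>.\<close>

theorem kernel_piece_nonzero_iff_inverse_system:
  fixes f :: "3 \<Rightarrow> 'c::field_char_0 R2"
  assumes f: "\<And>i. homogeneous d (f i)" and hb: "hilbert_burch f d \<mu> \<phi>" and p: "2 \<le> p"
  shows "kernel_piece_nonzero f p q \<longleftrightarrow>
    (\<exists>w\<in>inverse_system \<phi> (p - 2). \<exists>\<gamma> \<beta>. w \<gamma> \<beta> \<noteq> 0 \<and> int (tdeg \<beta>) = int d - 2 - q)"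
  unfolding kernel_piece_nonzero_iff
proof
  assume "\<exists>P. bihomogeneous p q P \<and> rees_map f P = 0 \<and> P \<notin> sym_ideal f"
  then obtain P where "bihomogeneous p q P" "rees_map f P = 0" "P \<notin> sym_ideal f" by blast
  then show "\<exists>w\<in>inverse_system \<phi> (p - 2). \<exists>\<gamma> \<beta>. w \<gamma> \<beta> \<noteq> 0 \<and> int (tdeg \<beta>) = int d - 2 - q"
    by (rule inverse_system_of_kernel[OF f hb p])
next
  assume "\<exists>w\<in>inverse_system \<phi> (p - 2). \<exists>\<gamma> \<beta>. w \<gamma> \<beta> \<noteq> 0 \<and> int (tdeg \<beta>) = int d - 2 - q"
  then obtain w \<gamma> \<beta> where "w \<in> inverse_system \<phi> (p - 2)" "w \<gamma> \<beta> \<noteq> 0" "int (tdeg \<beta>) = int d - 2 - q"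
    by blast
  then show "\<exists>P. bihomogeneous p q P \<and> rees_map f P = 0 \<and> P \<notin> sym_ideal f"
    by (rule kernel_of_inverse_system[OF f hb p])
qed

text \<open>An element of \<open>E\<close> of degree \<open>k\<close> yields a nonzero kernel element whose degree \<open>d - 2 - k\<close> in \<open>x\<close> cannot
  be negative.\<close>

lemma inverse_system_degree_bound:
  fixes f :: "3 \<Rightarrow> 'c::field_char_0 R2"
  assumes f: "\<And>i. homogeneous d (f i)" and hb: "hilbert_burch f d \<mu> \<phi>" and p: "2 \<le> p"
    and w: "w \<in> inverse_system \<phi> (p - 2)" "w \<gamma> \<beta> \<noteq> 0"
  shows "tdeg \<beta> \<le> d"
proof -
  have "int (tdeg \<beta>) = int d - 2 - (int d - 2 - int (tdeg \<beta>))" by simp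
  then obtain P where P: "bihomogeneous p (int d - 2 - int (tdeg \<beta>)) P" "P \<notin> sym_ideal f"
    using kernel_of_inverse_system[OF f hb p w] by blast
  have "P \<noteq> 0" using P(2) ideal_gen_closed(1) by (auto simp: sym_ideal_def)
  then obtain \<gamma>' where "\<gamma>' \<in> keys P" by (meson all_not_in_conv keys_eq_empty)
  moreover from this have "lookup P \<gamma>' \<noteq> 0" by (simp add: in_keys_iff)
  then obtain \<alpha> where "\<alpha> \<in> keys (lookup P \<gamma>')" by (meson all_not_in_conv keys_eq_empty)
  ultimately have "int (tdeg \<alpha>) = int d - 2 - int (tdeg \<beta>)" using P(1) by (auto simp: bihomogeneous_def)
  then show ?thesis by linarith
qed

section \<open>The relations of \<open>M\<close> as an annihilator\<close>

text \<open>The function \<open>u\<close> is the linear functional on \<open>F[\<partial>\<^sub>1,\<partial>\<^sub>2]\<close> with value \<open>u \<beta>\<close> at \<open>\<partial>\<^sup>\<beta>\<close>; it is applied to the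
  coefficient of \<open>x\<^sup>\<alpha>\<close> in \<open>a\<close>.\<close>

definition pairing :: "'c::field_char_0 weyl \<Rightarrow> (2 expo \<Rightarrow> 'c) \<Rightarrow> 2 expo \<Rightarrow> 'c" where
  "pairing a u \<alpha> = (\<Sum>m\<in>keys (wcoeffs a). if fst m = \<alpha> then lookup (wcoeffs a) m * u (snd m) else 0)"

lemma pairing_superset:
  assumes "finite A" "keys (wcoeffs a) \<subseteq> A"
  shows "pairing a u \<alpha> = (\<Sum>m\<in>A. if fst m = \<alpha> then lookup (wcoeffs a) m * u (snd m) else 0)"
  unfolding pairing_def using assms by (intro sum.mono_neutral_left) (auto simp: in_keys_iff)

lemma pairing_add: "pairing (a + b) u \<alpha> = pairing a u \<alpha> + pairing b u \<alpha>"
proof -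
  let ?A = "keys (wcoeffs a) \<union> keys (wcoeffs b)"
  have "keys (wcoeffs (a + b)) \<subseteq> ?A" by (simp add: Poly_Mapping.keys_add)
  then have "pairing (a + b) u \<alpha> = (\<Sum>m\<in>?A. (if fst m = \<alpha> then lookup (wcoeffs a) m * u (snd m) else 0)
      + (if fst m = \<alpha> then lookup (wcoeffs b) m * u (snd m) else 0))"
    by (subst pairing_superset[of ?A]) (auto simp: lookup_add distrib_right intro!: sum.cong)
  then show ?thesis by (simp add: sum.distrib pairing_superset[of ?A])
qed

lemma pairing_zero [simp]: "pairing 0 u \<alpha> = 0"
  by (simp add: pairing_def)

lemma pairing_sum: "pairing (\<Sum>i\<in>A. h i) u \<alpha> = (\<Sum>i\<in>A. pairing (h i) u \<alpha>)"
  by (induction A rule: infinite_finite_induct) (auto simp: pairing_add)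

lemma pairing_wmono: "pairing (wmono (\<gamma>, \<beta>) c) u \<alpha> = (if \<gamma> = \<alpha> then c * u \<beta> else 0)"
  by (subst pairing_superset[of "{(\<gamma>, \<beta>)}"]) auto

lemma const_times_wmono: "weyl_const c * wmono m d = wmono m (c * d)"
  by (cases m, rule weyl_eqI_single) (simp only: act_simps mult_ac)

lemma x_times_wmono: "weyl_x i * wmono (\<alpha>, \<beta>) c = wmono (\<alpha> + single i 1, \<beta>) c"
  by (rule weyl_eqI_single) (simp only: act_simps mult_ac add_ac)

lemma d_power_times_wmono: "wmono (0, \<eta>) 1 * wmono (0, \<kappa>) c = wmono (0, \<kappa> + \<eta>) c"
proof -
  have "common_expos \<eta> 0 = {0}" by (auto simp: common_expos_def intro!: poly_mapping_eqI)
  then show ?thesis by (simp add: wmono_times_wmono leibniz_coeff_def add.commute)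
qed

lemma x_power_times_wmono: "wmono (\<alpha>, 0) 1 * wmono (0, \<beta>) c = wmono (\<alpha>, \<beta>) c"
proof -
  have "common_expos 0 0 = {0}" by (auto simp: common_expos_def intro!: poly_mapping_eqI)
  then show ?thesis by (simp add: wmono_times_wmono leibniz_coeff_def)
qed

lemma pairing_const: "pairing (weyl_const c * a) u \<alpha> = c * pairing a u \<alpha>"
proof (induction a rule: weyl_induct)
  case (mono m d)
  show ?case by (cases m) (simp add: const_times_wmono pairing_wmono)
qed (simp add: distrib_left pairing_add)

lemma pairing_x:
  "pairing (weyl_x i * a) u \<alpha> = (if lookup \<alpha> i = 0 then 0 else pairing a u (\<alpha> - single i 1))"
proof (induction a rule: weyl_induct)
  case (mono m c)
  obtain \<gamma> \<beta> where m: "m = (\<gamma>, \<beta>)" by (cases m)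
  have "\<gamma> + single i 1 = \<alpha> \<longleftrightarrow> lookup \<alpha> i \<noteq> 0 \<and> \<gamma> = \<alpha> - single i 1"
    using expo_add_eq_iff[of "single i 1" \<gamma> \<alpha>] by (auto simp: add.commute lookup_single when_def)
  then show ?case unfolding m x_times_wmono pairing_wmono by auto
qed (simp add: distrib_left pairing_add)

lemma pairing_d:
  "pairing (weyl_d i * a) u \<alpha> = pairing a (\<lambda>\<beta>. u (\<beta> + single i 1)) \<alpha>
     + of_nat (lookup \<alpha> i + 1) * pairing a u (\<alpha> + single i 1)"
proof (induction a rule: weyl_induct)
  case (mono m c)
  obtain \<gamma> \<beta> where m: "m = (\<gamma>, \<beta>)" by (cases m)
  have eq: "\<gamma> - single i 1 = \<alpha> \<longleftrightarrow> \<gamma> = \<alpha> + single i 1" if "lookup \<gamma> i \<noteq> 0"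
  proof -
    have "\<gamma> - single i 1 + single i 1 = \<gamma>"
      using that by (intro expo_diff_add) (auto simp: lookup_single when_def)
    then show ?thesis by (metis add_diff_cancel_right')
  qed
  show ?case
  proof (cases "lookup \<gamma> i = 0")
    case True
    then have "\<gamma> \<noteq> \<alpha> + single i 1" by (auto simp: lookup_add)
    then show ?thesis using True unfolding m weyl_d_times_wmono pairing_add pairing_wmono by simp
  next
    case False
    show ?thesis unfolding m weyl_d_times_wmono pairing_add pairing_wmono eq[OF False]
      by (auto simp: lookup_add)
  qed
qed (simp add: distrib_left pairing_add algebra_simps)

definition annihilator ::
    "'i set \<Rightarrow> ('i \<Rightarrow> 2 expo \<Rightarrow> 'c::field_char_0) set \<Rightarrow> ('i \<Rightarrow> 'c weyl) set" where
  "annihilator A E = {v \<in> free_module A. \<forall>w\<in>E. \<forall>\<alpha>. (\<Sum>i\<in>A. pairing (v i) (w i) \<alpha>) = 0}"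

text \<open>Multiplication by \<open>x\<^sub>i\<close> only shifts \<open>\<alpha>\<close>. Multiplication by \<open>\<partial>\<^sub>i\<close> adds to such a shift a shift of the
  functional, and therefore \<open>E\<close> has to be closed under shifts.\<close>

lemma annihilator_left_mult:
  assumes E: "\<And>w \<zeta>. w \<in> E \<Longrightarrow> (\<lambda>i \<beta>. w i (\<beta> + \<zeta>)) \<in> E"
  shows "v \<in> annihilator A E \<Longrightarrow> (\<lambda>i. c * v i) \<in> annihilator A E"
proof (induction c arbitrary: v rule: weyl_gen_induct)
  case (const c)
  then show ?case
    by (auto simp: annihilator_def free_module_def pairing_const simp flip: sum_distrib_left)
next
  case (x i)
  have "(\<Sum>j\<in>A. pairing (weyl_x i * v j) (w j) \<alpha>) = 0" if "w \<in> E" for w \<alpha>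
    using x that by (cases "lookup \<alpha> i = 0") (auto simp: annihilator_def pairing_x)
  then show ?case using x by (auto simp: annihilator_def free_module_def)
next
  case (d i)
  show ?case unfolding annihilator_def
  proof (intro CollectI conjI ballI allI)
    show "(\<lambda>j. weyl_d i * v j) \<in> free_module A" using d by (auto simp: annihilator_def free_module_def)
  next
    fix w \<alpha> assume w: "w \<in> E"
    have "(\<Sum>j\<in>A. pairing (v j) (w j) (\<alpha> + single i 1)) = 0" using d w by (auto simp: annihilator_def)
    moreover have "\<forall>w\<in>E. (\<Sum>j\<in>A. pairing (v j) (w j) \<alpha>) = 0" using d by (auto simp: annihilator_def)
    then have "(\<Sum>j\<in>A. pairing (v j) (\<lambda>\<beta>. w j (\<beta> + single i 1)) \<alpha>) = 0" by (rule bspec[OF _ E[OF w]])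
    ultimately show "(\<Sum>j\<in>A. pairing (weyl_d i * v j) (w j) \<alpha>) = 0"
      unfolding pairing_d sum.distrib by (simp flip: sum_distrib_left)
  qed
next
  case (add a b)
  have "(\<lambda>i. a * v i) \<in> annihilator A E" "(\<lambda>i. b * v i) \<in> annihilator A E" using add by blast+
  then show ?case by (simp add: annihilator_def free_module_def distrib_right pairing_add sum.distrib)
next
  case (mult a b)
  have "(\<lambda>i. a * (b * v i)) \<in> annihilator A E" by (rule mult(1)[OF mult(2)[OF mult(3)]])
  then show ?case by (simp only: mult.assoc)
qed

lemma annihilator_left_span:
  assumes E: "\<And>w \<zeta>. w \<in> E \<Longrightarrow> (\<lambda>i \<beta>. w i (\<beta> + \<zeta>)) \<in> E" and B: "B \<subseteq> annihilator A E"
  shows "left_span B \<subseteq> annihilator A E"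
proof
  fix v assume "v \<in> left_span B"
  then obtain C c where C: "finite C" "C \<subseteq> B" "v = (\<lambda>i. \<Sum>b\<in>C. c b * b i)" by (auto simp: left_span_def)
  have "(\<lambda>i. \<Sum>b\<in>C. c b * b i) \<in> annihilator A E" using C(1,2)
  proof (induction C rule: finite_induct)
    case empty
    show ?case by (simp add: annihilator_def free_module_def)
  next
    case (insert b C)
    have "(\<lambda>i. c b * b i) \<in> annihilator A E" using insert.prems B by (intro annihilator_left_mult E) auto
    moreover have "(\<lambda>i. \<Sum>b\<in>C. c b * b i) \<in> annihilator A E" using insert by simp
    ultimately show ?case using insert.hyps
      by (simp add: annihilator_def free_module_def pairing_add sum.distrib)
  qed
  then show "v \<in> annihilator A E" by (simp add: C(3))
qed

lemma left_span_closed: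
  assumes "u \<in> left_span B" "v \<in> left_span B"
  shows "(\<lambda>i. u i + v i) \<in> left_span B" and "(\<lambda>i. a * u i) \<in> left_span B"
proof -
  obtain C c where C: "finite C" "C \<subseteq> B" "u = (\<lambda>i. \<Sum>b\<in>C. c b * b i)" using assms(1) by (auto simp: left_span_def)
  obtain C' c' where C': "finite C'" "C' \<subseteq> B" "v = (\<lambda>i. \<Sum>b\<in>C'. c' b * b i)" using assms(2) by (auto simp: left_span_def)
  let ?e = "\<lambda>b. (if b \<in> C then c b else 0) + (if b \<in> C' then c' b else 0)"
  have "u i + v i = (\<Sum>b\<in>C \<union> C'. ?e b * b i)" for i
  proof -
    have "u i = (\<Sum>b\<in>C \<union> C'. (if b \<in> C then c b else 0) * b i)"
      unfolding C(3) using C(1) C'(1) by (intro sum.mono_neutral_cong_left) auto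
    moreover have "v i = (\<Sum>b\<in>C \<union> C'. (if b \<in> C' then c' b else 0) * b i)"
      unfolding C'(3) using C(1) C'(1) by (intro sum.mono_neutral_cong_left) auto
    ultimately show ?thesis by (simp add: distrib_right sum.distrib)
  qed
  then show "(\<lambda>i. u i + v i) \<in> left_span B"
    unfolding left_span_def using C C' by (intro CollectI exI[of _ "C \<union> C'"] exI[of _ ?e]) auto
  have "a * u i = (\<Sum>b\<in>C. (a * c b) * b i)" for i by (simp add: C(3) sum_distrib_left mult.assoc)
  then show "(\<lambda>i. a * u i) \<in> left_span B"
    unfolding left_span_def using C by (intro CollectI exI[of _ C] exI[of _ "\<lambda>b. a * c b"]) auto
qed

lemma left_span_zero: "(\<lambda>i. 0) \<in> left_span B"
  unfolding left_span_def by (intro CollectI exI[of _ "{}"]) auto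

lemma left_span_sum:
  assumes "\<And>x. x \<in> X \<Longrightarrow> h x \<in> left_span B" shows "(\<lambda>i. \<Sum>x\<in>X. h x i) \<in> left_span B"
  using assms
proof (induction X rule: infinite_finite_induct)
  case (insert x X)
  have "(\<lambda>i. h x i + (\<Sum>x\<in>X. h x i)) \<in> left_span B"
    by (rule left_span_closed(1)) (use insert in auto)
  then show ?case using insert.hyps by simp
qed (auto simp: left_span_zero)

lemma left_span_base: "b \<in> B \<Longrightarrow> b \<in> left_span B"
  unfolding left_span_def by (intro CollectI exI[of _ "{b}"] exI[of _ "\<lambda>_. 1"]) auto

lemma subspace_left_span: "vec_vs.subspace (left_span B)"
proof (rule vec_vs.subspaceI)
  show "0 \<in> left_span B" using left_span_zero[of B] by (simp add: zero_fun_def)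
  show "u + v \<in> left_span B" if "u \<in> left_span B" "v \<in> left_span B" for u v
    using left_span_closed(1)[OF that] by (simp add: plus_fun_def)
  show "vec_scale c u \<in> left_span B" if "u \<in> left_span B" for c u
    using left_span_closed(2)[OF that that] by (simp add: vec_scale_def weyl_scale_def)
qed

lemma (in vector_space) separating_functional:
  assumes S: "subspace S" and x: "x \<notin> S"
  shows "\<exists>l. Vector_Spaces.linear scale (*) l \<and> (\<forall>s\<in>S. l s = 0) \<and> l x = 1"
proof -
  interpret pair: vector_space_pair scale "(*) :: 'a \<Rightarrow> 'a \<Rightarrow> 'a"
    by unfold_locales (auto simp: algebra_simps)
  obtain B where B: "B \<subseteq> S" "independent B" "S \<subseteq> span B" by (metis basis_exists)
  have "x \<notin> span B" using x span_minimal[OF B(1) S] by blast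
  then have ind: "independent (insert x B)" using B(2) by (rule independent_insertI)
  obtain l where l: "Vector_Spaces.linear scale (*) l" "\<forall>b\<in>insert x B. l b = (if b = x then 1 else 0)"
    using pair.linear_independent_extend[OF ind, of "\<lambda>b. if b = x then 1 else 0"] by blast
  interpret l: Vector_Spaces.linear scale "(*) :: 'a \<Rightarrow> 'a \<Rightarrow> 'a" l by (rule l(1))
  have "b \<noteq> x" if "b \<in> B" for b using that B(1) x by blast
  then have "l b = 0" if "b \<in> B" for b using l(2) that by auto
  moreover have "l s = 0" if "s \<in> span B" and B0: "\<And>b. b \<in> B \<Longrightarrow> l b = 0" for s
    using that(1) by (induction rule: span_induct_alt) (auto simp: l.add l.scale l.zero B0)
  ultimately have "\<forall>s\<in>S. l s = 0" using B(3) by blast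
  then show ?thesis using l by auto
qed

text \<open>The constant coefficient operator \<open>r(\<partial>)\<close>.\<close>

definition d_operator :: "'c::field_char_0 R2 \<Rightarrow> 'c weyl" where
  "d_operator r = fourier (weyl_of_R r)"

lemma weyl_of_R_superset:
  assumes "finite A" "keys r \<subseteq> A"
  shows "weyl_of_R (r :: 'c::field_char_0 R2) = (\<Sum>\<alpha>\<in>A. wmono (\<alpha>, 0) (lookup r \<alpha>))"
  unfolding weyl_of_R_def using assms by (intro sum.mono_neutral_left) (auto simp: in_keys_iff)

lemma wmono_add: "wmono m (c + d) = wmono m c + wmono m (d :: 'c::field_char_0)"
  by (rule weyl_eqI) (simp add: single_add)

lemma d_operator_add: "d_operator (r + s) = d_operator r + d_operator s"
proof -
  have "keys (r + s) \<subseteq> keys r \<union> keys s" by (simp add: Poly_Mapping.keys_add)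
  then have "weyl_of_R (r + s) = weyl_of_R r + weyl_of_R s"
    by (simp add: weyl_of_R_superset[of "keys r \<union> keys s"] lookup_add wmono_add sum.distrib)
  then show ?thesis by (simp add: d_operator_def fourier_add)
qed

lemma d_operator_zero [simp]: "d_operator 0 = 0"
  by (simp add: d_operator_def weyl_of_R_def fourier_def)

lemma d_operator_sum: "d_operator (\<Sum>i\<in>A. h i) = (\<Sum>i\<in>A. d_operator (h i))"
  by (induction A rule: infinite_finite_induct) (auto simp: d_operator_add)

lemma d_operator_single: "d_operator (single \<kappa> c) = wmono (0, \<kappa>) c"
proof -
  have "weyl_of_R (single \<kappa> c) = wmono (\<kappa>, 0) c"
    by (subst weyl_of_R_superset[of "{\<kappa>}"]) auto
  then have "d_operator (single \<kappa> c) = weyl_const c * wmono (0, \<kappa>) 1 * 1"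
    by (simp add: d_operator_def fourier_wmono fourier_mono_def one_weyl_def)
  then show ?thesis by (simp add: const_times_wmono)
qed

lemma contraction_superset:
  assumes "finite A" "keys r \<subseteq> A"
  shows "contraction r u \<eta> = (\<Sum>\<kappa>\<in>A. lookup r \<kappa> * u (\<kappa> + \<eta>))"
  unfolding contraction_def using assms by (intro sum.mono_neutral_left) (auto simp: in_keys_iff)

lemma contraction_add: "contraction (r + s) u \<eta> = contraction r u \<eta> + contraction s u \<eta>"
proof -
  have "keys (r + s) \<subseteq> keys r \<union> keys s" by (simp add: Poly_Mapping.keys_add)
  then show ?thesis
    by (simp add: contraction_superset[of "keys r \<union> keys s"] lookup_add distrib_right sum.distrib)
qed

lemma contraction_single: "contraction (single \<kappa> c) u \<eta> = c * u (\<kappa> + \<eta>)"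
  by (subst contraction_superset[of "{\<kappa>}"]) auto

lemma pairing_d_operator:
  "pairing (wmono (0, \<eta>) 1 * d_operator r) u \<alpha> = (if \<alpha> = 0 then contraction r u \<eta> else 0)"
proof (induction r rule: poly_mapping_induct)
  case (add r s)
  then show ?case by (simp add: d_operator_add distrib_left pairing_add contraction_add)
next
  case (single \<kappa> c)
  show ?case unfolding d_operator_single d_power_times_wmono pairing_wmono contraction_single by auto
qed

lemma lookup_L_op: "lookup (L_op \<phi> j) \<kappa> = (\<Sum>i\<in>UNIV. if \<kappa> = single i 1 then d_operator (\<phi> i j) else 0)"
proof -
  have z: "weyl_of_R 0 = 0" "fourier 0 = (0 :: 'a weyl)" by (simp_all add: weyl_of_R_def fourier_def)
  have map: "lookup (Poly_Mapping.map h P) k = h (lookup P k)" if "h 0 = 0" for h :: "'b::zero \<Rightarrow> 'd::zero" and P :: "'k \<Rightarrow>\<^sub>0 'b" and k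
    using that by (auto simp: Poly_Mapping.map.rep_eq when_def)
  have "lookup (L_op \<phi> j) \<kappa> = d_operator (lookup (sym_eq \<phi> j) \<kappa>)"
    unfolding L_op_def fourier_T_def DT_of_RT_def d_operator_def by (simp add: map z)
  also have "lookup (sym_eq \<phi> j) \<kappa> = (\<Sum>i\<in>UNIV. if \<kappa> = single i 1 then \<phi> i j else 0)"
    unfolding sym_eq_def linear_form_def lookup_sum by (intro sum.cong refl) (auto simp: lookup_single when_def)
  also have "d_operator \<dots> = (\<Sum>i\<in>UNIV. if \<kappa> = single i 1 then d_operator (\<phi> i j) else 0)"
    unfolding d_operator_sum by (intro sum.cong refl) auto
  finally show ?thesis .
qed

lemma lookup_mult_monomial:
  fixes P :: "3 expo \<Rightarrow>\<^sub>0 'r::ring_1"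
  shows "lookup (P * single \<gamma> 1) \<delta> = (if \<forall>i. lookup \<gamma> i \<le> lookup \<delta> i then lookup P (\<delta> - \<gamma>) else 0)"
proof (induction P rule: poly_mapping_induct)
  case (single \<kappa> d)
  show ?case using expo_add_eq_iff[of \<gamma> \<kappa> \<delta>]
    by (auto simp: mult_single lookup_single when_def add.commute)
qed (simp add: distrib_right lookup_add)

lemma H_row_eq:
  assumes "\<gamma> \<in> T_expos (p - 2)"
  shows "H_row \<phi> p (j, \<delta>) \<gamma> =
    (\<Sum>i\<in>UNIV. if lookup \<delta> i \<noteq> 0 \<and> \<gamma> = \<delta> - single i 1 then d_operator (\<phi> i j) else 0)"
proof -
  have iff: "(\<forall>k. lookup \<gamma> k \<le> lookup \<delta> k) \<and> \<delta> - \<gamma> = single i 1 \<longleftrightarrow> lookup \<delta> i \<noteq> 0 \<and> \<gamma> = \<delta> - single i 1" for i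
  proof -
    have "(\<forall>k. lookup \<gamma> k \<le> lookup \<delta> k) \<and> \<delta> - \<gamma> = single i 1 \<longleftrightarrow> \<gamma> + single i 1 = \<delta>"
      using expo_add_eq_iff[of \<gamma> "single i 1" \<delta>] by metis
    also have "\<dots> \<longleftrightarrow> lookup \<delta> i \<noteq> 0 \<and> \<gamma> = \<delta> - single i 1"
      using expo_add_eq_iff[of "single i 1" \<gamma> \<delta>] by (auto simp: add.commute lookup_single when_def)
    finally show ?thesis .
  qed
  have "H_row \<phi> p (j, \<delta>) \<gamma> = (\<Sum>i\<in>UNIV. if (\<forall>k. lookup \<gamma> k \<le> lookup \<delta> k) \<and> \<delta> - \<gamma> = single i 1 then d_operator (\<phi> i j) else 0)"
    using assms
    by (auto simp: H_row_def lookup_mult_monomial lookup_L_op intro!: sum.cong sum.neutral)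
  then show ?thesis unfolding iff .
qed

lemma pairing_H_row:
  assumes p: "2 \<le> p" and \<delta>: "\<delta> \<in> T_expos (p - 1)"
  shows "(\<Sum>\<gamma>\<in>T_expos (p - 2). pairing (wmono (0, \<eta>) 1 * H_row \<phi> p (j, \<delta>) \<gamma>) (w \<gamma>) \<alpha>)
    = (if \<alpha> = 0 then sym_contraction \<phi> j w \<delta> \<eta> else 0)"
proof -
  have mem: "\<delta> - single i 1 \<in> T_expos (p - 2)" if "lookup \<delta> i \<noteq> 0" for i
  proof -
    have "\<delta> - single i 1 + single i 1 = \<delta>" using that by (intro expo_diff_add) (auto simp: lookup_single when_def)
    then have "tdeg \<delta> = tdeg (\<delta> - single i 1) + 1" by (metis tdeg_add tdeg_single)
    then show ?thesis using \<delta> p by (simp add: T_expos_def)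
  qed
  have "(\<Sum>\<gamma>\<in>T_expos (p - 2). pairing (wmono (0, \<eta>) 1 * H_row \<phi> p (j, \<delta>) \<gamma>) (w \<gamma>) \<alpha>)
      = (\<Sum>\<gamma>\<in>T_expos (p - 2). \<Sum>i\<in>UNIV. if lookup \<delta> i \<noteq> 0 \<and> \<gamma> = \<delta> - single i 1
          then (if \<alpha> = 0 then contraction (\<phi> i j) (w \<gamma>) \<eta> else 0) else 0)"
  proof (intro sum.cong refl)
    fix \<gamma> assume "\<gamma> \<in> T_expos (p - 2)"
    then have "wmono (0, \<eta>) 1 * H_row \<phi> p (j, \<delta>) \<gamma> = (\<Sum>i\<in>UNIV. if lookup \<delta> i \<noteq> 0 \<and> \<gamma> = \<delta> - single i 1
        then wmono (0, \<eta>) 1 * d_operator (\<phi> i j) else 0)"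
      unfolding H_row_eq[OF \<open>\<gamma> \<in> _\<close>] sum_distrib_left by (intro sum.cong refl) auto
    then show "pairing (wmono (0, \<eta>) 1 * H_row \<phi> p (j, \<delta>) \<gamma>) (w \<gamma>) \<alpha> = (\<Sum>i\<in>UNIV. if lookup \<delta> i \<noteq> 0 \<and> \<gamma> = \<delta> - single i 1
          then (if \<alpha> = 0 then contraction (\<phi> i j) (w \<gamma>) \<eta> else 0) else 0)"
      by (simp only: pairing_sum) (auto intro!: sum.cong simp: pairing_d_operator)
  qed
  also have "\<dots> = (\<Sum>i\<in>UNIV. \<Sum>\<gamma>\<in>T_expos (p - 2). if lookup \<delta> i \<noteq> 0 \<and> \<gamma> = \<delta> - single i 1
          then (if \<alpha> = 0 then contraction (\<phi> i j) (w \<gamma>) \<eta> else 0) else 0)"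
    by (rule sum.swap)
  also have "\<dots> = (\<Sum>i\<in>UNIV. if lookup \<delta> i = 0 then 0
      else if \<alpha> = 0 then contraction (\<phi> i j) (w (\<delta> - single i 1)) \<eta> else 0)"
  proof (intro sum.cong refl)
    fix i
    show "(\<Sum>\<gamma>\<in>T_expos (p - 2). if lookup \<delta> i \<noteq> 0 \<and> \<gamma> = \<delta> - single i 1
          then (if \<alpha> = 0 then contraction (\<phi> i j) (w \<gamma>) \<eta> else 0) else 0)
        = (if lookup \<delta> i = 0 then 0 else if \<alpha> = 0 then contraction (\<phi> i j) (w (\<delta> - single i 1)) \<eta> else 0)"
    proof (cases "lookup \<delta> i = 0")
      case False
      have "(\<Sum>\<gamma>\<in>T_expos (p - 2). if \<gamma> = \<delta> - single i 1 then (if \<alpha> = 0 then contraction (\<phi> i j) (w \<gamma>) \<eta> else 0) else 0)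
          = (if \<alpha> = 0 then contraction (\<phi> i j) (w (\<delta> - single i 1)) \<eta> else 0)"
        using mem[OF False] by (simp only: sum.delta[OF finite_T_expos] if_True)
      then show ?thesis using False by (simp only: simp_thms if_False)
    qed simp
  qed
  also have "\<dots> = (if \<alpha> = 0 then sym_contraction \<phi> j w \<delta> \<eta> else 0)"
    unfolding sym_contraction_def by (auto intro!: sum.cong sum.neutral)
  finally show ?thesis .
qed

text \<open>The rows of \<open>H\<close> pair to zero with \<open>E\<close> by the definition of \<open>E\<close>. Conversely, if \<open>v\<close> pairs to zero with
  \<open>E\<close>, each of its slices, the coefficients of a fixed \<open>x\<^sup>\<alpha>\<close>, lies in \<open>N\<close>: otherwise some linear functional
  vanishes on \<open>N\<close> but not on the slice, and its values at the \<open>\<partial>\<^sup>\<beta>e\<^sub>\<gamma>\<close> form an element of \<open>E\<close>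
  with which the slice does not pair to zero.\<close>

theorem M_relations_eq_annihilator:
  fixes \<phi> :: "3 \<Rightarrow> 2 \<Rightarrow> 'a::field_char_0 R2"
  assumes p: "2 \<le> p"
  shows "M_relations \<phi> p = annihilator (T_expos (p - 2)) (inverse_system \<phi> (p - 2))"
proof
  let ?A = "T_expos (p - 2)" and ?E = "inverse_system \<phi> (p - 2)"
  show "M_relations \<phi> p \<subseteq> annihilator ?A ?E"
    unfolding M_relations_def
  proof (rule annihilator_left_span)
    show "(\<lambda>\<gamma> \<beta>. w \<gamma> (\<beta> + \<zeta>)) \<in> ?E" if "w \<in> ?E" for w \<zeta> using that by (rule shift_inverse_system)
    show "H_row \<phi> p ` (UNIV \<times> T_expos (p - 1)) \<subseteq> annihilator ?A ?E"
    proof clarify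
      fix j \<delta> assume \<delta>: "\<delta> \<in> T_expos (p - 1)"
      have "(\<Sum>\<gamma>\<in>?A. pairing (H_row \<phi> p (j, \<delta>) \<gamma>) (w \<gamma>) \<alpha>) = 0" if "w \<in> ?E" for w \<alpha>
        using pairing_H_row[OF p \<delta>, of 0 \<phi> j w \<alpha>] that
        by (auto simp: inverse_system_def simp flip: one_weyl_def)
      then show "H_row \<phi> p (j, \<delta>) \<in> annihilator ?A ?E"
        by (auto simp: annihilator_def free_module_def H_row_def)
    qed
  qed
  show "annihilator ?A ?E \<subseteq> M_relations \<phi> p"
  proof
    fix v assume v: "v \<in> annihilator ?A ?E"
    let ?N = "M_relations \<phi> p"
    define sl where "sl \<alpha> \<gamma> = (\<Sum>m\<in>keys (wcoeffs (v \<gamma>)). if fst m = \<alpha> then wmono (0, snd m) (lookup (wcoeffs (v \<gamma>)) m) else 0)"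
      for \<alpha> \<gamma>
    have sl_free: "sl \<alpha> \<gamma> = 0" if "\<gamma> \<notin> ?A" for \<alpha> \<gamma>
      using that v by (simp add: sl_def annihilator_def free_module_def)
    have slice_in_N: "sl \<alpha> \<in> ?N" for \<alpha>
    proof (rule ccontr)
      assume "sl \<alpha> \<notin> ?N"
      then obtain l where l: "Vector_Spaces.linear vec_scale (*) l" "\<forall>u\<in>?N. l u = 0" "l (sl \<alpha>) = 1"
        using vec_vs.separating_functional[OF subspace_left_span] unfolding M_relations_def by blast
      interpret l: Vector_Spaces.linear vec_scale "(*) :: 'a \<Rightarrow> 'a \<Rightarrow> 'a" l by (rule l(1))
      define unit where "unit \<gamma> a = (\<lambda>\<gamma>'. if \<gamma>' = \<gamma> then a else 0)" for \<gamma> :: "3 expo" and a :: "'a weyl"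
      define w where "w \<gamma> \<beta> = (if \<gamma> \<in> ?A then l (unit \<gamma> (wmono (0, \<beta>) 1)) else 0)" for \<gamma> \<beta>
      have unit_add: "unit \<gamma> (a + b) = unit \<gamma> a + unit \<gamma> b" for \<gamma> a b by (auto simp: unit_def fun_eq_iff)
      have unit_scale: "unit \<gamma> (wmono m c) = vec_scale c (unit \<gamma> (wmono m 1))" for \<gamma> m c
        by (auto simp: unit_def fun_eq_iff vec_scale_def weyl_scale_def const_times_wmono)
      have l_unit: "l (unit \<gamma> (d_operator r)) = contraction r (w \<gamma>) 0" if "\<gamma> \<in> ?A" for \<gamma> r
      proof (induction r rule: poly_mapping_induct)
        case (add r s)
        then show ?case unfolding d_operator_add unit_add l.add contraction_add by simp
      next
        case (single \<kappa> c)
        show ?case using that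
          by (simp add: d_operator_single unit_scale[of \<gamma> "(0, \<kappa>)" c] l.scale contraction_single w_def)
      qed
      have l_sum: "l u = (\<Sum>\<gamma>\<in>?A. pairing (u \<gamma>) (w \<gamma>) 0)"
        if u: "\<And>\<gamma>. \<gamma> \<notin> ?A \<Longrightarrow> u \<gamma> = 0" "\<And>\<gamma>. \<exists>r. u \<gamma> = d_operator r" for u
      proof -
        obtain r where r: "\<And>\<gamma>. u \<gamma> = d_operator (r \<gamma>)" using u(2) by metis
        have fs: "(\<Sum>x\<in>X. h x) \<gamma> = (\<Sum>x\<in>X. h x \<gamma>)" for X and h :: "3 expo \<Rightarrow> 3 expo \<Rightarrow> 'a weyl" and \<gamma>
          by (induction X rule: infinite_finite_induct) auto
        have "u = (\<Sum>\<gamma>\<in>?A. unit \<gamma> (u \<gamma>))"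
        proof
          fix \<gamma>
          have "(\<Sum>\<gamma>'\<in>?A. unit \<gamma>' (u \<gamma>') \<gamma>) = (\<Sum>\<gamma>'\<in>?A. if \<gamma>' = \<gamma> then u \<gamma>' else 0)"
            by (intro sum.cong) (auto simp: unit_def)
          then show "u \<gamma> = (\<Sum>\<gamma>\<in>?A. unit \<gamma> (u \<gamma>)) \<gamma>" using u(1)[of \<gamma>] by (simp add: fs)
        qed
        then have "l u = (\<Sum>\<gamma>\<in>?A. l (unit \<gamma> (u \<gamma>)))" by (metis l.sum)
        also have "\<dots> = (\<Sum>\<gamma>\<in>?A. pairing (u \<gamma>) (w \<gamma>) 0)"
          by (intro sum.cong refl)
             (simp add: r l_unit pairing_d_operator[of 0, folded one_weyl_def, unfolded mult_1_left])
        finally show ?thesis .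
      qed
      have times_d: "\<exists>s. wmono (0, \<eta>) 1 * d_operator r = d_operator (s :: 'a R2)" for \<eta> and r :: "'a R2"
      proof (induction r rule: poly_mapping_induct)
        case (add r r')
        then obtain s s' where "wmono (0, \<eta>) 1 * d_operator r = d_operator s" "wmono (0, \<eta>) 1 * d_operator r' = d_operator s'"
          by blast
        then have "wmono (0, \<eta>) 1 * d_operator (r + r') = d_operator (s + s')"
          unfolding d_operator_add distrib_left by simp
        then show ?case by blast
      next
        case (single \<kappa> c)
        have "wmono (0, \<eta>) 1 * d_operator (single \<kappa> c) = d_operator (single (\<kappa> + \<eta>) c)"
          unfolding d_operator_single d_power_times_wmono ..
        then show ?case by blast
      qed
      have "sym_contraction \<phi> j w \<delta> \<eta> = 0" for j \<delta> \<eta>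
      proof (cases "\<delta> \<in> T_expos (p - 1)")
        case True
        let ?u = "\<lambda>\<gamma>. wmono (0, \<eta>) 1 * H_row \<phi> p (j, \<delta>) \<gamma>"
        have "H_row \<phi> p (j, \<delta>) \<in> ?N" unfolding M_relations_def using True by (intro left_span_base) auto
        then have "?u \<in> ?N" unfolding M_relations_def by (rule left_span_closed(2)) (use \<open>_ \<in> ?N\<close> in \<open>simp add: M_relations_def\<close>)
        then have "0 = l ?u" using l(2) by simp
        also have "\<dots> = (\<Sum>\<gamma>\<in>?A. pairing (?u \<gamma>) (w \<gamma>) 0)"
        proof (rule l_sum)
          show "?u \<gamma> = 0" if "\<gamma> \<notin> ?A" for \<gamma> using that by (simp add: H_row_def)
          show "\<exists>r. ?u \<gamma> = d_operator r" for \<gamma>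
          proof (cases "\<gamma> \<in> ?A")
            case True
            have "H_row \<phi> p (j, \<delta>) \<gamma> = d_operator (\<Sum>i\<in>UNIV. if lookup \<delta> i \<noteq> 0 \<and> \<gamma> = \<delta> - single i 1 then \<phi> i j else 0)"
              unfolding H_row_eq[OF True] d_operator_sum by (intro sum.cong) auto
            then show ?thesis using times_d by simp
          next
            case False
            then show ?thesis by (intro exI[of _ 0]) (simp add: H_row_def)
          qed
        qed
        also have "\<dots> = sym_contraction \<phi> j w \<delta> \<eta>" by (simp add: pairing_H_row[OF p True])
        finally show ?thesis by simp
      next
        case False
        have "\<delta> - single i 1 \<notin> ?A" if "lookup \<delta> i \<noteq> 0" for i
        proof -
          have "\<delta> - single i 1 + single i 1 = \<delta>" using that by (intro expo_diff_add) (auto simp: lookup_single when_def)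
          then have "tdeg \<delta> = tdeg (\<delta> - single i 1) + 1" by (metis tdeg_add tdeg_single)
          then show ?thesis using False p by (auto simp: T_expos_def)
        qed
        then show ?thesis by (auto simp: sym_contraction_def contraction_def w_def intro!: sum.neutral)
      qed
      then have "w \<in> ?E" by (auto simp: inverse_system_def w_def T_expos_def)
      then have "(\<Sum>\<gamma>\<in>?A. pairing (v \<gamma>) (w \<gamma>) \<alpha>) = 0" using v by (simp add: annihilator_def)
      moreover have "pairing (v \<gamma>) (w \<gamma>) \<alpha> = pairing (sl \<alpha> \<gamma>) (w \<gamma>) 0" for \<gamma>
        unfolding sl_def pairing_sum pairing_def[of "v \<gamma>"] by (intro sum.cong) (auto simp: pairing_wmono)
      moreover have "l (sl \<alpha>) = (\<Sum>\<gamma>\<in>?A. pairing (sl \<alpha> \<gamma>) (w \<gamma>) 0)"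
      proof (rule l_sum)
        show "sl \<alpha> \<gamma> = 0" if "\<gamma> \<notin> ?A" for \<gamma> using that by (rule sl_free)
        have "sl \<alpha> \<gamma> = d_operator (\<Sum>m\<in>keys (wcoeffs (v \<gamma>)). if fst m = \<alpha> then single (snd m) (lookup (wcoeffs (v \<gamma>)) m) else 0)" for \<gamma>
          unfolding sl_def d_operator_sum by (intro sum.cong) (auto simp: d_operator_single)
        then show "\<exists>r. sl \<alpha> \<gamma> = d_operator r" for \<gamma> by blast
      qed
      ultimately show False using l(3) by simp
    qed
    define X where "X = (\<Union>\<gamma>\<in>?A. fst ` keys (wcoeffs (v \<gamma>)))"
    have finX: "finite X" by (simp add: X_def)
    have "v \<gamma> = (\<Sum>\<alpha>\<in>X. wmono (\<alpha>, 0) 1 * sl \<alpha> \<gamma>)" for \<gamma>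
    proof (cases "\<gamma> \<in> ?A")
      case True
      have "(\<Sum>\<alpha>\<in>X. wmono (\<alpha>, 0) 1 * sl \<alpha> \<gamma>)
          = (\<Sum>\<alpha>\<in>X. \<Sum>m\<in>keys (wcoeffs (v \<gamma>)). if fst m = \<alpha> then wmono m (lookup (wcoeffs (v \<gamma>)) m) else 0)"
        unfolding sl_def sum_distrib_left by (intro sum.cong refl) (auto simp: x_power_times_wmono)
      also have "\<dots> = (\<Sum>m\<in>keys (wcoeffs (v \<gamma>)). \<Sum>\<alpha>\<in>X. if fst m = \<alpha> then wmono m (lookup (wcoeffs (v \<gamma>)) m) else 0)"
        by (rule sum.swap)
      also have "\<dots> = (\<Sum>m\<in>keys (wcoeffs (v \<gamma>)). wmono m (lookup (wcoeffs (v \<gamma>)) m))"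
      proof (intro sum.cong refl)
        fix m assume "m \<in> keys (wcoeffs (v \<gamma>))"
        then have "fst m \<in> X" using True by (auto simp: X_def)
        then show "(\<Sum>\<alpha>\<in>X. if fst m = \<alpha> then wmono m (lookup (wcoeffs (v \<gamma>)) m) else 0)
            = wmono m (lookup (wcoeffs (v \<gamma>)) m)" using finX by simp
      qed
      also have "\<dots> = v \<gamma>" by (rule weyl_eq_sum_wmono[symmetric])
      finally show ?thesis by simp
    next
      case False
      then show ?thesis using v sl_free[OF False] by (simp add: annihilator_def free_module_def)
    qed
    then have "v = (\<lambda>\<gamma>. \<Sum>\<alpha>\<in>X. wmono (\<alpha>, 0) 1 * sl \<alpha> \<gamma>)" by (rule ext)
    also have "\<dots> \<in> ?N"
      unfolding M_relations_def
    proof (rule left_span_sum)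
      fix \<alpha>
      show "(\<lambda>\<gamma>. wmono (\<alpha>, 0) 1 * sl \<alpha> \<gamma>) \<in> left_span (H_row \<phi> p ` (UNIV \<times> T_expos (p - 1)))"
        using slice_in_N[of \<alpha>] unfolding M_relations_def by (intro left_span_closed(2))
    qed
    finally show "v \<in> ?N" .
  qed
qed

lemma component_ideal_annihilator:
  assumes "finite A" "i \<in> A"
  shows "l \<in> component_ideal (annihilator A E) i \<longleftrightarrow> (\<forall>w\<in>E. \<forall>\<alpha>. pairing l (w i) \<alpha> = 0)"
proof -
  have "(\<Sum>j\<in>A. pairing (if j = i then l else 0) (w j) \<alpha>) = pairing l (w i) \<alpha>" for w \<alpha>
  proof -
    have "(\<Sum>j\<in>A. pairing (if j = i then l else 0) (w j) \<alpha>) = (\<Sum>j\<in>A. if j = i then pairing l (w j) \<alpha> else 0)"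
      by (intro sum.cong) auto
    then show ?thesis using assms by simp
  qed
  then show ?thesis using assms(2) by (auto simp: component_ideal_def annihilator_def free_module_def)
qed

section \<open>The b-function\<close>

definition diagonal :: "'c::field_char_0 weyl \<Rightarrow> bool" where
  "diagonal a \<longleftrightarrow> (\<forall>m. fst m \<noteq> snd m \<longrightarrow> lookup (wcoeffs a) m = 0)"

lemma diagonalD: "diagonal a \<Longrightarrow> m \<in> keys (wcoeffs a) \<Longrightarrow> fst m = snd m"
  unfolding diagonal_def in_keys_iff by blast

lemma diagonal_add: "diagonal a \<Longrightarrow> diagonal b \<Longrightarrow> diagonal (a + b)"
  unfolding diagonal_def wcoeffs_simps lookup_add by simp

lemma diagonal_uminus: "diagonal a \<Longrightarrow> diagonal (- a)"
  unfolding diagonal_def wcoeffs_simps lookup_uminus by simp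

lemma diagonal_zero: "diagonal 0"
  by (simp add: diagonal_def)

lemma diagonal_sum: "(\<And>i. i \<in> A \<Longrightarrow> diagonal (h i)) \<Longrightarrow> diagonal (\<Sum>i\<in>A. h i)"
  by (induction A rule: infinite_finite_induct) (auto intro: diagonal_add diagonal_zero)

lemma diagonal_wmono: "diagonal (wmono (\<alpha>, \<alpha>) c)"
  by (auto simp: diagonal_def lookup_single when_def)

lemma diagonal_mult:
  assumes a: "diagonal a" and b: "diagonal b" shows "diagonal (a * b)"
proof -
  have "diagonal (wmono m c * wmono n e)" if mn: "fst m = snd m" "fst n = snd n" for m n :: wexpo and c e :: 'a
  proof -
    obtain \<alpha> \<beta> where m: "m = (\<alpha>, \<alpha>)" and n: "n = (\<beta>, \<beta>)" using mn by (cases m, cases n) simp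
    have "diagonal (wmono (\<alpha> + (\<beta> - \<kappa>), \<alpha> - \<kappa> + \<beta>) r)" if \<kappa>: "\<kappa> \<in> common_expos \<alpha> \<beta>" for \<kappa> and r :: 'a
    proof -
      have "\<alpha> + (\<beta> - \<kappa>) = \<alpha> - \<kappa> + \<beta>"
      proof (rule poly_mapping_eqI)
        fix i
        have "lookup \<kappa> i \<le> lookup \<alpha> i" "lookup \<kappa> i \<le> lookup \<beta> i" using \<kappa> by (auto simp: common_expos_def)
        then show "lookup (\<alpha> + (\<beta> - \<kappa>)) i = lookup (\<alpha> - \<kappa> + \<beta>) i"
          by (simp add: lookup_add lookup_minus)
      qed
      then show ?thesis by (simp only: diagonal_wmono)
    qed
    then show ?thesis unfolding m n wmono_times_wmono by (intro diagonal_sum)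
  qed
  then have "diagonal (\<Sum>m\<in>keys (wcoeffs a). \<Sum>n\<in>keys (wcoeffs b).
      wmono m (lookup (wcoeffs a) m) * wmono n (lookup (wcoeffs b) n))"
    using diagonalD[OF a] diagonalD[OF b] by (intro diagonal_sum) blast
  also have "\<dots> = (\<Sum>m\<in>keys (wcoeffs a). wmono m (lookup (wcoeffs a) m)) * (\<Sum>n\<in>keys (wcoeffs b). wmono n (lookup (wcoeffs b) n))"
    by (rule sum_product[symmetric])
  also have "\<dots> = a * b" by (simp only: weyl_eq_sum_wmono[symmetric])
  finally show ?thesis .
qed

lemma diagonal_weyl_poly: "diagonal (weyl_poly p)"
proof -
  have const: "diagonal (weyl_const c)" for c :: 'a unfolding weyl_const_def by (rule diagonal_wmono)
  have "weyl_x i * weyl_d i = (wmono (single i 1, single i 1) 1 :: 'a weyl)" for i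
    using x_times_wmono[of i 0 "single i 1" "1 :: 'a"] by (simp add: weyl_d_def)
  then have "diagonal (weyl_x i * weyl_d i :: 'a weyl)" for i by (simp only: diagonal_wmono)
  then have s: "diagonal (weyl_s :: 'a weyl)" unfolding weyl_s_def by (intro diagonal_sum diagonal_uminus)
  have one: "diagonal (1 :: 'a weyl)" using const[of 1] by (simp add: weyl_const_simps)
  have "diagonal (weyl_s ^ k :: 'a weyl)" for k
    by (induction k) (auto simp: one intro: diagonal_mult s)
  then show ?thesis unfolding weyl_poly_def by (intro diagonal_sum diagonal_mult const)
qed

lemma weyl_act_uminus: "weyl_act (- a) r = - weyl_act a r"
  using weyl_act_diff[of 0 a r] by simp

lemma weyl_act_s: "weyl_act weyl_s (single \<epsilon> e) = single \<epsilon> (- of_nat (tdeg \<epsilon>) * e)"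
proof -
  have "weyl_act (weyl_x i * weyl_d i) (single \<epsilon> e) = single \<epsilon> (e * of_nat (lookup \<epsilon> i))" for i
  proof (cases "lookup \<epsilon> i = 0")
    case False
    then have "\<epsilon> - single i 1 + single i 1 = \<epsilon>" by (intro expo_diff_add) (auto simp: lookup_single when_def)
    then show ?thesis by (simp add: weyl_act_mult weyl_act_gens)
  qed (simp add: weyl_act_mult weyl_act_gens)
  then have "weyl_act weyl_s (single \<epsilon> e) = (\<Sum>i\<in>UNIV. single \<epsilon> (- (e * of_nat (lookup \<epsilon> i))))"
    unfolding weyl_s_def weyl_act_sum weyl_act_uminus by (simp add: single_uminus)
  also have "\<dots> = single \<epsilon> (- of_nat (tdeg \<epsilon>) * e)"
    by (simp add: single_sum_distrib[symmetric] sum_negf sum_distrib_left[symmetric] tdeg_def mult.commute)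
  finally show ?thesis .
qed

lemma weyl_act_poly: "weyl_act (weyl_poly p) (single \<epsilon> 1) = single \<epsilon> (poly p (- of_nat (tdeg \<epsilon>)))"
proof -
  have pow: "weyl_act (weyl_s ^ k) (single \<epsilon> 1) = single \<epsilon> ((- of_nat (tdeg \<epsilon>)) ^ k)" for k
    by (induction k) (auto simp: weyl_act_one weyl_act_mult weyl_act_s)
  show ?thesis unfolding weyl_poly_def weyl_act_sum poly_altdef single_sum_distrib
    by (intro sum.cong refl) (simp add: weyl_act_mult pow weyl_act_gens)
qed

lemma diagonal_action_coefficient:
  assumes a: "diagonal a"
  shows "lookup (weyl_act a (single \<epsilon> 1)) \<epsilon> = (\<Sum>m\<in>keys (wcoeffs a). lookup (wcoeffs a) m * of_nat (ffacs \<epsilon> (snd m)))"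
proof -
  have "weyl_act a (single \<epsilon> 1) = (\<Sum>m\<in>keys (wcoeffs a). act_mono m \<epsilon> (lookup (wcoeffs a) m))"
    by (subst weyl_act_superset[of "keys (wcoeffs a)" "{\<epsilon>}"]) auto
  moreover have "lookup (act_mono m \<epsilon> (lookup (wcoeffs a) m)) \<epsilon> = lookup (wcoeffs a) m * of_nat (ffacs \<epsilon> (snd m))"
    if "m \<in> keys (wcoeffs a)" for m
  proof (cases "ffacs \<epsilon> (snd m) = 0")
    case False
    then have "\<epsilon> - snd m + snd m = \<epsilon>" by (intro expo_diff_add) (auto simp: ffacs_def not_less)
    moreover have "fst m = snd m" using diagonalD[OF a that] .
    ultimately show ?thesis by (simp add: act_mono_def)
  qed (simp add: act_mono_def)
  ultimately show ?thesis by (simp add: lookup_sum)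
qed

text \<open>Let \<open>c\<^sub>\<alpha>\<close> be the coefficient of \<open>x\<^sup>\<alpha>\<partial>\<^sup>\<alpha>\<close> in \<open>p(s)\<close>. Applied to \<open>x\<^sup>\<epsilon>\<close>, the operator \<open>p(s)\<close> gives
  \<open>p(-|\<epsilon>|) = \<Sum>\<^sub>\<alpha>\<^sub>\<le>\<^sub>\<epsilon> c\<^sub>\<alpha> [\<epsilon>]\<^sub>\<alpha>\<close> with falling factorials \<open>[\<epsilon>]\<^sub>\<alpha>\<close>. On a set of exponents closed under division
  this is a triangular system with nonzero diagonal entries \<open>[\<epsilon>]\<^sub>\<epsilon> = \<epsilon>!\<close>.\<close>

lemma weyl_poly_coefficients_vanish_iff:
  fixes p :: "'c::field_char_0 poly"
  assumes down: "\<And>\<alpha> \<zeta>. \<alpha> + \<zeta> \<in> B \<Longrightarrow> \<alpha> \<in> B"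
  shows "(\<forall>\<alpha>\<in>B. lookup (wcoeffs (weyl_poly p)) (\<alpha>, \<alpha>) = 0) \<longleftrightarrow> (\<forall>\<alpha>\<in>B. poly p (- of_nat (tdeg \<alpha>)) = 0)"
proof -
  let ?a = "weyl_poly p :: 'c weyl"
  let ?c = "\<lambda>\<alpha>. lookup (wcoeffs ?a) (\<alpha>, \<alpha>)"
  have val: "poly p (- of_nat (tdeg \<epsilon>)) = (\<Sum>m\<in>keys (wcoeffs ?a). lookup (wcoeffs ?a) m * of_nat (ffacs \<epsilon> (snd m)))" for \<epsilon>
    using diagonal_action_coefficient[OF diagonal_weyl_poly, of p \<epsilon>] by (simp add: weyl_act_poly)
  have below: "\<alpha> \<in> B \<and> (\<alpha> \<noteq> \<epsilon> \<longrightarrow> tdeg \<alpha> < tdeg \<epsilon>)" if "ffacs \<epsilon> \<alpha> \<noteq> 0" "\<epsilon> \<in> B" for \<alpha> \<epsilon>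
  proof -
    have e: "\<alpha> + (\<epsilon> - \<alpha>) = \<epsilon>" using that(1) expo_diff_add[of \<alpha> \<epsilon>] by (auto simp: ffacs_def not_less add.commute)
    then have "\<alpha> \<in> B" using down[of \<alpha> "\<epsilon> - \<alpha>"] that(2) by simp
    moreover have "tdeg \<alpha> < tdeg \<epsilon>" if "\<alpha> \<noteq> \<epsilon>"
    proof -
      have "\<epsilon> - \<alpha> \<noteq> 0" using e that by auto
      then obtain i where "lookup (\<epsilon> - \<alpha>) i \<noteq> 0" by (metis lookup_zero poly_mapping_eqI)
      then have "0 < tdeg (\<epsilon> - \<alpha>)" using lookup_le_tdeg[of "\<epsilon> - \<alpha>" i] by linarith
      moreover have "tdeg \<epsilon> = tdeg \<alpha> + tdeg (\<epsilon> - \<alpha>)" by (metis e tdeg_add)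
      ultimately show ?thesis by linarith
    qed
    ultimately show ?thesis by blast
  qed
  have diag: "m = (snd m, snd m)" if "m \<in> keys (wcoeffs ?a)" for m
    using diagonalD[OF diagonal_weyl_poly that] by (cases m) simp
  show ?thesis
  proof
    assume c: "\<forall>\<alpha>\<in>B. ?c \<alpha> = 0"
    show "\<forall>\<alpha>\<in>B. poly p (- of_nat (tdeg \<alpha>)) = 0"
    proof
      fix \<epsilon> assume \<epsilon>: "\<epsilon> \<in> B"
      show "poly p (- of_nat (tdeg \<epsilon>)) = 0" unfolding val
      proof (rule sum.neutral, rule ballI)
        fix m assume "m \<in> keys (wcoeffs ?a)"
        then have "m = (snd m, snd m)" by (rule diag)
        then show "lookup (wcoeffs ?a) m * of_nat (ffacs \<epsilon> (snd m)) = 0"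
          using below[of \<epsilon> "snd m"] \<epsilon> c by (metis mult_zero_left mult_zero_right of_nat_0)
      qed
    qed
  next
    assume v: "\<forall>\<alpha>\<in>B. poly p (- of_nat (tdeg \<alpha>)) = 0"
    have "\<epsilon> \<in> B \<longrightarrow> ?c \<epsilon> = 0" for \<epsilon>
    proof (induction "tdeg \<epsilon>" arbitrary: \<epsilon> rule: less_induct)
      case less
      show ?case
      proof
        assume \<epsilon>: "\<epsilon> \<in> B"
        have "0 = (\<Sum>m\<in>keys (wcoeffs ?a). lookup (wcoeffs ?a) m * of_nat (ffacs \<epsilon> (snd m)))"
          using v \<epsilon> val by metis
        also have "\<dots> = (\<Sum>m\<in>keys (wcoeffs ?a). if m = (\<epsilon>, \<epsilon>) then lookup (wcoeffs ?a) m * of_nat (ffacs \<epsilon> (snd m)) else 0)"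
        proof (intro sum.cong refl)
          fix m assume "m \<in> keys (wcoeffs ?a)"
          then have m: "m = (snd m, snd m)" by (rule diag)
          show "lookup (wcoeffs ?a) m * of_nat (ffacs \<epsilon> (snd m))
              = (if m = (\<epsilon>, \<epsilon>) then lookup (wcoeffs ?a) m * of_nat (ffacs \<epsilon> (snd m)) else 0)"
          proof (cases "m = (\<epsilon>, \<epsilon>) \<or> ffacs \<epsilon> (snd m) = 0")
            case False
            then have "snd m \<noteq> \<epsilon>" using m by metis
            then have "lookup (wcoeffs ?a) m = 0" using below[of \<epsilon> "snd m"] less \<epsilon> False m by metis
            then show ?thesis using False by simp
          qed auto
        qed
        also have "\<dots> = ?c \<epsilon> * of_nat (ffacs \<epsilon> \<epsilon>)" by (simp add: sum.delta in_keys_iff)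
        finally show "?c \<epsilon> = 0" by (auto simp: ffacs_def)
      qed
    qed
    then show "\<forall>\<alpha>\<in>B. ?c \<alpha> = 0" by blast
  qed
qed

lemma pairing_diagonal:
  assumes "diagonal a" shows "pairing a u \<alpha> = lookup (wcoeffs a) (\<alpha>, \<alpha>) * u \<alpha>"
proof -
  have "pairing a u \<alpha> = (\<Sum>m\<in>keys (wcoeffs a). if m = (\<alpha>, \<alpha>) then lookup (wcoeffs a) m * u (snd m) else 0)"
    unfolding pairing_def using assms
    by (intro sum.cong refl) (auto simp: prod_eq_iff dest: diagonalD)
  then show ?thesis by (simp add: sum.delta in_keys_iff)
qed

lemma initial_form_diagonal:
  assumes "diagonal a" shows "initial_form a = a"
proof -
  have "weyl_weight m = 0" if "m \<in> keys (wcoeffs a)" for m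
    using diagonalD[OF assms that] by (simp add: weyl_weight_def)
  then have "{m \<in> keys (wcoeffs a). \<forall>n\<in>keys (wcoeffs a). weyl_weight n \<le> weyl_weight m} = keys (wcoeffs a)"
    by auto
  then show ?thesis unfolding initial_form_def using weyl_eq_sum_wmono[of a] by simp
qed

text \<open>For fixed \<open>\<alpha>\<close> the terms \<open>x\<^sup>\<alpha>\<partial>\<^sup>\<beta>\<close> of maximal weight are those with a fixed \<open>|\<beta>|\<close>, so passing to the
  initial form amounts to truncating the functional. The first alternative occurs when this \<open>|\<beta>|\<close>
  would be negative.\<close>

lemma pairing_initial_form:
  fixes a :: "'c::field_char_0 weyl"
  shows "\<exists>k. \<forall>u. pairing (initial_form a) u \<alpha> = 0 \<or> pairing (initial_form a) u \<alpha> = pairing a (\<lambda>\<beta>. if tdeg \<beta> = k then u \<beta> else 0) \<alpha>"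
proof (cases "keys (wcoeffs a) = {}")
  case True
  then show ?thesis by (auto simp: initial_form_def)
next
  case False
  define t where "t = Max (weyl_weight ` keys (wcoeffs a))"
  have top: "(\<forall>n\<in>keys (wcoeffs a). weyl_weight n \<le> weyl_weight m) \<longleftrightarrow> weyl_weight m = t"
    if "m \<in> keys (wcoeffs a)" for m
  proof
    assume "\<forall>n\<in>keys (wcoeffs a). weyl_weight n \<le> weyl_weight m"
    then show "weyl_weight m = t" unfolding t_def using that by (intro Max_eqI[symmetric]) auto
  next
    assume "weyl_weight m = t"
    then show "\<forall>n\<in>keys (wcoeffs a). weyl_weight n \<le> weyl_weight m" unfolding t_def by (auto intro: Max_ge)
  qed
  have eq: "pairing (initial_form a) u \<alpha> = (\<Sum>m\<in>keys (wcoeffs a).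
      if weyl_weight m = t \<and> fst m = \<alpha> then lookup (wcoeffs a) m * u (snd m) else 0)" for u
  proof -
    have "initial_form a = (\<Sum>m\<in>keys (wcoeffs a). if weyl_weight m = t then wmono m (lookup (wcoeffs a) m) else 0)"
    proof -
      have "{m \<in> keys (wcoeffs a). \<forall>n\<in>keys (wcoeffs a). weyl_weight n \<le> weyl_weight m}
          = {m \<in> keys (wcoeffs a). weyl_weight m = t}" using top by blast
      then show ?thesis unfolding initial_form_def by (simp add: sum.inter_filter)
    qed
    then have "pairing (initial_form a) u \<alpha>
        = (\<Sum>m\<in>keys (wcoeffs a). pairing (if weyl_weight m = t then wmono m (lookup (wcoeffs a) m) else 0) u \<alpha>)"
      by (simp only: pairing_sum)
    also have "\<dots> = (\<Sum>m\<in>keys (wcoeffs a). if weyl_weight m = t \<and> fst m = \<alpha> then lookup (wcoeffs a) m * u (snd m) else 0)"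
      by (intro sum.cong refl) (auto simp: pairing_wmono)
    finally show ?thesis .
  qed
  show ?thesis
  proof (intro exI allI)
    fix u :: "2 expo \<Rightarrow> 'c"
    let ?k = "nat (int (tdeg \<alpha>) - t)"
    show "pairing (initial_form a) u \<alpha> = 0 \<or> pairing (initial_form a) u \<alpha> = pairing a (\<lambda>\<beta>. if tdeg \<beta> = ?k then u \<beta> else 0) \<alpha>"
    proof (cases "t \<le> int (tdeg \<alpha>)")
      case True
      then have "weyl_weight m = t \<and> fst m = \<alpha> \<longleftrightarrow> fst m = \<alpha> \<and> tdeg (snd m) = ?k" for m
        by (auto simp: weyl_weight_def)
      then have "pairing (initial_form a) u \<alpha> = pairing a (\<lambda>\<beta>. if tdeg \<beta> = ?k then u \<beta> else 0) \<alpha>"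
        unfolding eq pairing_def[of a] by (intro sum.cong refl) auto
      then show ?thesis ..
    next
      case False
      then have "\<not> (weyl_weight m = t \<and> fst m = \<alpha>)" for m by (auto simp: weyl_weight_def)
      then have "pairing (initial_form a) u \<alpha> = 0" unfolding eq by (intro sum.neutral) auto
      then show ?thesis ..
    qed
  qed
qed

text \<open>As \<open>E\<close> is graded, the ideal contains the initial forms of its elements. A polynomial in \<open>s\<close> is
  homogeneous of weight \<open>0\<close>, hence equal to its initial form, and so membership in the initial ideal is
  membership in the ideal itself.\<close>

lemma weyl_poly_in_initial_ideal_iff:
  fixes E :: "('i \<Rightarrow> 2 expo \<Rightarrow> 'c::field_char_0) set"
  assumes A: "finite A" "i \<in> A"
    and shift: "\<And>w \<zeta>. w \<in> E \<Longrightarrow> (\<lambda>i \<beta>. w i (\<beta> + \<zeta>)) \<in> E"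
    and part: "\<And>w k. w \<in> E \<Longrightarrow> (\<lambda>i \<beta>. if tdeg \<beta> = k then w i \<beta> else 0) \<in> E"
  shows "weyl_poly p \<in> initial_ideal (component_ideal (annihilator A E) i) \<longleftrightarrow>
    (\<forall>w\<in>E. \<forall>\<beta>. w i \<beta> \<noteq> 0 \<longrightarrow> poly p (- of_nat (tdeg \<beta>)) = 0)"
proof -
  let ?J = "component_ideal (annihilator A E) i"
  note J = component_ideal_annihilator[OF A, of _ E]
  have sub: "weyl_vs.subspace ?J"
    by (rule weyl_vs.subspaceI) (auto simp: J pairing_add pairing_const weyl_scale_def)
  have "initial_form l \<in> ?J" if l: "l \<in> ?J" for l
    unfolding J
  proof (intro ballI allI)
    fix w \<alpha> assume w: "w \<in> E"
    obtain k where k: "pairing (initial_form l) (w i) \<alpha> = 0 \<or>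
        pairing (initial_form l) (w i) \<alpha> = pairing l (\<lambda>\<beta>. if tdeg \<beta> = k then w i \<beta> else 0) \<alpha>"
      using pairing_initial_form[of l \<alpha>] by blast
    have "\<forall>w\<in>E. pairing l (w i) \<alpha> = 0" using l unfolding J by blast
    then have "pairing l (\<lambda>\<beta>. if tdeg \<beta> = k then w i \<beta> else 0) \<alpha> = 0" by (rule bspec[OF _ part[OF w]])
    then show "pairing (initial_form l) (w i) \<alpha> = 0" using k by auto
  qed
  then have "initial_ideal ?J \<subseteq> ?J" unfolding initial_ideal_def by (intro weyl_vs.span_minimal sub) auto
  moreover have "weyl_poly p \<in> initial_ideal ?J" if "weyl_poly p \<in> ?J"
  proof -
    have "initial_form (weyl_poly p) \<in> initial_ideal ?J"
      unfolding initial_ideal_def using that by (intro weyl_vs.span_base imageI)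
    then show ?thesis by (simp only: initial_form_diagonal[OF diagonal_weyl_poly])
  qed
  ultimately have "weyl_poly p \<in> initial_ideal ?J \<longleftrightarrow> weyl_poly p \<in> ?J" by blast
  also have "\<dots> \<longleftrightarrow> (\<forall>\<alpha>\<in>{\<alpha>. \<exists>w\<in>E. w i \<alpha> \<noteq> 0}. lookup (wcoeffs (weyl_poly p)) (\<alpha>, \<alpha>) = 0)"
    unfolding J pairing_diagonal[OF diagonal_weyl_poly] by auto
  also have "\<dots> \<longleftrightarrow> (\<forall>\<alpha>\<in>{\<alpha>. \<exists>w\<in>E. w i \<alpha> \<noteq> 0}. poly p (- of_nat (tdeg \<alpha>)) = 0)"
  proof (rule weyl_poly_coefficients_vanish_iff)
    fix \<alpha> \<zeta> assume "\<alpha> + \<zeta> \<in> {\<alpha>. \<exists>w\<in>E. w i \<alpha> \<noteq> 0}"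
    then obtain w where "w \<in> E" "w i (\<alpha> + \<zeta>) \<noteq> 0" by blast
    then show "\<alpha> \<in> {\<alpha>. \<exists>w\<in>E. w i \<alpha> \<noteq> 0}"
      by (intro CollectI bexI[OF _ shift[of w \<zeta>]])
  qed
  finally show ?thesis by blast
qed

definition root_product :: "nat set \<Rightarrow> 'c::field_char_0 poly" where
  "root_product K = (\<Prod>k\<in>K. [:of_nat k, 1:])"

lemma poly_root_product: "finite K \<Longrightarrow> poly (root_product K) x = (\<Prod>k\<in>K. of_nat k + x)"
  by (simp add: root_product_def poly_prod)

lemma monic_root_product: "monic (root_product K :: 'c::field_char_0 poly)"
proof -
  have "lead_coeff (\<Prod>k\<in>K. [:of_nat k, 1 :: 'c:]) = (\<Prod>k\<in>K. lead_coeff [:of_nat k, 1 :: 'c:])"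
    by (rule lead_coeff_prod)
  then show ?thesis by (simp add: monic_def root_product_def)
qed

lemma root_product_dvd_iff:
  assumes "finite K"
  shows "root_product K dvd (p :: 'c::field_char_0 poly) \<longleftrightarrow> (\<forall>k\<in>K. poly p (- of_nat k) = 0)"
  using assms
proof (induction K arbitrary: p rule: finite_induct)
  case (insert k K)
  let ?b = "root_product K :: 'c poly"
  have eq: "root_product (insert k K) = [:of_nat k, 1:] * ?b"
    unfolding root_product_def by (rule prod.insert) (use insert.hyps in auto)
  have nz: "poly ?b (- of_nat k) \<noteq> 0"
    using insert.hyps by (auto simp: poly_root_product)
  show ?case
  proof
    assume d: "root_product (insert k K) dvd p"
    have "?b dvd p" using d unfolding eq by (rule dvd_mult_right)
    moreover have "[:of_nat k, 1:] dvd p" using d unfolding eq by (rule dvd_mult_left)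
    ultimately show "\<forall>l\<in>insert k K. poly p (- of_nat l) = 0"
      using insert.IH poly_eq_0_iff_dvd[of p "- of_nat k"] by simp
  next
    assume z: "\<forall>l\<in>insert k K. poly p (- of_nat l) = 0"
    then have "?b dvd p" using insert.IH by simp
    then obtain q where q: "p = ?b * q" by (rule dvdE)
    then have "poly q (- of_nat k) = 0" using z nz by simp
    then have "[:of_nat k, 1:] dvd q" using poly_eq_0_iff_dvd[of q "- of_nat k"] by simp
    then show "root_product (insert k K) dvd p" unfolding eq q mult.commute[of ?b q] by (intro mult_dvd_mono dvd_refl)
  qed
qed (simp add: root_product_def)

text \<open>The condition at the index \<open>i\<close> says that \<open>p\<close> vanishes at the negatives of the degrees occurring in \<open>E\<close>
  at \<open>i\<close>. So each \<open>b\<^sub>i\<close> is squarefree, and the least common multiple collects the roots.\<close>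

theorem is_b_function_annihilator:
  fixes E :: "('i \<Rightarrow> 2 expo \<Rightarrow> 'c::field_char_0) set"
  assumes A: "finite A"
    and shift: "\<And>w \<zeta>. w \<in> E \<Longrightarrow> (\<lambda>i \<beta>. w i (\<beta> + \<zeta>)) \<in> E"
    and part: "\<And>w k. w \<in> E \<Longrightarrow> (\<lambda>i \<beta>. if tdeg \<beta> = k then w i \<beta> else 0) \<in> E"
    and supp: "\<And>w i \<beta>. w \<in> E \<Longrightarrow> w i \<beta> \<noteq> 0 \<Longrightarrow> i \<in> A"
    and K: "K = {tdeg \<beta> | \<beta>. \<exists>w\<in>E. \<exists>i. w i \<beta> \<noteq> 0}" and fin: "finite K"
  shows "is_b_function A (annihilator A E) (root_product K)"
proof -
  let ?K = "\<lambda>i. {tdeg \<beta> | \<beta>. \<exists>w\<in>E. w i \<beta> \<noteq> 0}"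
  have finK: "finite (?K i)" for i by (rule finite_subset[OF _ fin]) (auto simp: K)
  have "is_ideal_b_function (component_ideal (annihilator A E) i) (root_product (?K i))" if "i \<in> A" for i
  proof -
    have "weyl_poly p \<in> initial_ideal (component_ideal (annihilator A E) i) \<longleftrightarrow> root_product (?K i) dvd p" for p
      unfolding root_product_dvd_iff[OF finK]
      by (subst weyl_poly_in_initial_ideal_iff[OF A that shift part]) auto
    then show ?thesis unfolding is_ideal_b_function_def using monic_root_product by simp
  qed
  moreover have "is_lcm A (\<lambda>i. root_product (?K i)) (root_product K :: 'c poly)"
  proof -
    have "K = (\<Union>i\<in>A. ?K i)"
    proof (intro equalityI subsetI)
      fix k assume "k \<in> K"
      then obtain \<beta> w i where "k = tdeg \<beta>" "w \<in> E" "w i \<beta> \<noteq> 0" unfolding K by blast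
      then show "k \<in> (\<Union>i\<in>A. ?K i)" using supp[of w i \<beta>] by blast
    qed (auto simp: K)
    then have "(\<forall>k\<in>K. poly p (- of_nat k) = 0) \<longleftrightarrow> (\<forall>i\<in>A. \<forall>k\<in>?K i. poly p (- of_nat k) = 0)" for p :: "'c poly"
      by (simp only: ball_UN)
    then show ?thesis
      unfolding is_lcm_def root_product_dvd_iff[OF finK] root_product_dvd_iff[OF fin]
      using monic_root_product by blast
  qed
  ultimately show ?thesis unfolding is_b_function_def by (intro exI[of _ "\<lambda>i. root_product (?K i)"]) simp
qed

section \<open>The Bernstein dimension\<close>

definition function_scale :: "'c::field \<Rightarrow> ('x \<Rightarrow> 'c) \<Rightarrow> 'x \<Rightarrow> 'c" where
  "function_scale c u = (\<lambda>x. c * u x)"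

interpretation function_vs: vector_space "function_scale :: 'c::field \<Rightarrow> ('x \<Rightarrow> 'c) \<Rightarrow> _"
  by unfold_locales (auto simp: function_scale_def fun_eq_iff algebra_simps)

interpretation vec_function: vector_space_pair
  "vec_scale :: 'c::field_char_0 \<Rightarrow> ('i \<Rightarrow> 'c weyl) \<Rightarrow> _" "function_scale :: 'c \<Rightarrow> ('x \<Rightarrow> 'c) \<Rightarrow> _" ..

text \<open>The reduced echelon form of a finite-dimensional space of functions: the values at the pivots \<open>B\<close> are
  coordinates, with dual basis \<open>W\<close>.\<close>

lemma echelon_basis:
  fixes E :: "('x \<Rightarrow> 'c::field) set"
  assumes "finite X" "function_vs.subspace E" "\<And>u x. u \<in> E \<Longrightarrow> x \<notin> X \<Longrightarrow> u x = 0"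
  shows "\<exists>B W. B \<subseteq> X \<and> (\<forall>b\<in>B. W b \<in> E \<and> (\<forall>b'\<in>B. W b b' = (if b' = b then 1 else 0))) \<and>
    (\<forall>u\<in>E. (\<forall>b\<in>B. u b = 0) \<longrightarrow> (\<forall>x. u x = 0))"
  using assms
proof (induction X arbitrary: E rule: finite_induct)
  case empty
  then show ?case by (intro exI[of _ "{}"]) auto
next
  case (insert x X)
  note E = insert.prems(1)
  define E' where "E' = {u \<in> E. u x = 0}"
  have "function_vs.subspace E'" unfolding E'_def
    using function_vs.subspace_0[OF E] function_vs.subspace_add[OF E] function_vs.subspace_scale[OF E]
    by (intro function_vs.subspaceI) (auto simp: function_scale_def)
  moreover have "u y = 0" if "u \<in> E'" "y \<notin> X" for u y
    using that insert.prems(2)[of u y] by (cases "y = x") (auto simp: E'_def)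
  ultimately have "\<exists>B W. B \<subseteq> X \<and> (\<forall>b\<in>B. W b \<in> E' \<and> (\<forall>b'\<in>B. W b b' = (if b' = b then 1 else 0))) \<and>
    (\<forall>u\<in>E'. (\<forall>b\<in>B. u b = 0) \<longrightarrow> (\<forall>x. u x = 0))"
    by (rule insert.IH)
  then obtain B W where B: "B \<subseteq> X"
      and BW: "\<forall>b\<in>B. W b \<in> E' \<and> (\<forall>b'\<in>B. W b b' = (if b' = b then 1 else 0))"
      and inj: "\<forall>u\<in>E'. (\<forall>b\<in>B. u b = 0) \<longrightarrow> (\<forall>x. u x = 0)"
    by (elim exE conjE)
  have W: "\<And>b. b \<in> B \<Longrightarrow> W b \<in> E'" "\<And>b b'. b \<in> B \<Longrightarrow> b' \<in> B \<Longrightarrow> W b b' = (if b' = b then 1 else 0)"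
    using BW by blast+
  show ?case
  proof (cases "E' = E")
    case True
    show ?thesis using B BW inj unfolding True by (intro exI[of _ B] exI[of _ W]) blast
  next
    case False
    then obtain u where u: "u \<in> E" "u x \<noteq> 0" by (auto simp: E'_def)
    have WE: "W b \<in> E" "W b x = 0" if "b \<in> B" for b using W(1)[OF that] by (auto simp: E'_def)
    have finB: "finite B" using B insert.hyps(1) by (rule finite_subset)
    have xB: "x \<notin> B" using B insert.hyps(2) by blast
    define v where "v = function_scale (inverse (u x)) u"
    have v: "v \<in> E" "v x = 1" using u function_vs.subspace_scale[OF E] by (auto simp: v_def function_scale_def)
    define w where "w = v - (\<Sum>b\<in>B. function_scale (v b) (W b))"
    have fs: "(\<Sum>b\<in>B. function_scale (v b) (W b)) y = (\<Sum>b\<in>B. v b * W b y)" for y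
      using finB by (induction B) (auto simp: function_scale_def)
    have "w \<in> E" unfolding w_def
      by (intro function_vs.subspace_diff[OF E] v(1) function_vs.subspace_sum[OF E] function_vs.subspace_scale[OF E] WE(1))
    have wx: "w x = 1" by (simp add: w_def fs v WE(2))
    have wB: "w b = 0" if "b \<in> B" for b
    proof -
      have "(\<Sum>b'\<in>B. v b' * W b' b) = (\<Sum>b'\<in>B. if b' = b then v b' else 0)"
        using W(2) that by (intro sum.cong) auto
      then show ?thesis using that finB by (simp add: w_def fs)
    qed
    have "\<forall>x. t x = 0" if t: "t \<in> E" "\<forall>b\<in>insert x B. t b = 0" for t
    proof -
      have "t \<in> E'" using t by (simp add: E'_def)
      then show ?thesis using inj t(2) by blast
    qed
    moreover have "(W(x := w)) b \<in> E \<and> (\<forall>b'\<in>insert x B. (W(x := w)) b b' = (if b' = b then 1 else 0))"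
      if b: "b \<in> insert x B" for b
    proof (cases "b = x")
      case True
      then show ?thesis using \<open>w \<in> E\<close> wx wB xB by auto
    next
      case False
      then show ?thesis using b WE W(2) xB by auto
    qed
    ultimately show ?thesis
      using B by (intro exI[of _ "insert x B"] exI[of _ "W(x := w)"] conjI ballI impI) blast+
  qed
qed

lemma pairing_linear:
  assumes "finite B"
  shows "pairing a (\<lambda>\<beta>. \<Sum>b\<in>B. c b * u b \<beta>) \<alpha> = (\<Sum>b\<in>B. c b * pairing a (u b) \<alpha>)"
proof -
  have "pairing a (\<lambda>\<beta>. \<Sum>b\<in>B. c b * u b \<beta>) \<alpha> = (\<Sum>m\<in>keys (wcoeffs a). \<Sum>b\<in>B.
      c b * (if fst m = \<alpha> then lookup (wcoeffs a) m * u b (snd m) else 0))"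
    unfolding pairing_def by (intro sum.cong refl) (auto simp: sum_distrib_left mult_ac)
  also have "\<dots> = (\<Sum>b\<in>B. \<Sum>m\<in>keys (wcoeffs a).
      c b * (if fst m = \<alpha> then lookup (wcoeffs a) m * u b (snd m) else 0))" by (rule sum.swap)
  finally show ?thesis unfolding pairing_def sum_distrib_left .
qed

lemma card_expos_tdeg_le: "card {\<alpha> :: 2 expo. tdeg \<alpha> \<le> n} = (n + 1) * (n + 2) div 2"
proof (induction n)
  case 0
  have "{\<alpha> :: 2 expo. tdeg \<alpha> \<le> 0} = {\<alpha>. tdeg \<alpha> = 0}" by auto
  then show ?case using card_expos_tdeg[of 0] by simp
next
  case (Suc n)
  have "{\<alpha> :: 2 expo. tdeg \<alpha> \<le> Suc n} = {\<alpha>. tdeg \<alpha> \<le> n} \<union> {\<alpha>. tdeg \<alpha> = Suc n}" by auto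
  also have "card \<dots> = card {\<alpha> :: 2 expo. tdeg \<alpha> \<le> n} + card {\<alpha> :: 2 expo. tdeg \<alpha> = Suc n}"
    by (rule card_Un_disjoint) (auto simp: finite_expos_tdeg_le finite_expos_tdeg)
  also have "\<dots> = (n + 1) * (n + 2) div 2 + (n + 2)" unfolding Suc card_expos_tdeg by simp
  also have "\<dots> = (Suc n + 1) * (Suc n + 2) div 2" by (simp add: algebra_simps)
  finally show ?case .
qed

lemma rat_card_expos_tdeg_le:
  assumes "m \<le> k"
  shows "(of_nat (card {\<alpha> :: 2 expo. tdeg \<alpha> + m \<le> k}) :: rat)
    = poly [:(1 - of_nat m) * (2 - of_nat m) / 2, (3 - 2 * of_nat m) / 2, 1 / 2:] (of_nat k)"
proof -
  have "{\<alpha> :: 2 expo. tdeg \<alpha> + m \<le> k} = {\<alpha>. tdeg \<alpha> \<le> k - m}" using assms by auto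
  then have c: "card {\<alpha> :: 2 expo. tdeg \<alpha> + m \<le> k} = (k - m + 1) * (k - m + 2) div 2" by (simp only: card_expos_tdeg_le)
  have half: "(of_nat (n div 2) :: rat) = of_nat n / 2" if "even n" for n
    using that by (auto elim: evenE)
  have "(of_nat ((k - m + 1) * (k - m + 2) div 2) :: rat) = of_nat ((k - m + 1) * (k - m + 2)) / 2"
    by (rule half) simp
  also have "\<dots> = (of_nat k - of_nat m + 1) * (of_nat k - of_nat m + 2) / 2" 
    using assms by (simp only: of_nat_mult of_nat_add of_nat_diff of_nat_1 of_nat_numeral)
  also have "\<dots> = poly [:(1 - of_nat m) * (2 - of_nat m) / 2, (3 - 2 * of_nat m) / 2, 1 / 2:] (of_nat k)"
    by (simp add: field_simps)
  finally show ?thesis unfolding c .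
qed

lemma bernstein_filtration_iff:
  "v \<in> bernstein_filtration A k \<longleftrightarrow>
    v \<in> free_module A \<and> (\<forall>i. \<forall>m\<in>keys (wcoeffs (v i)). tdeg (fst m) + tdeg (snd m) \<le> k)"
  unfolding bernstein_filtration_def free_module_def by (fastforce split: prod.splits)

lemma bernstein_filtration_finite_dimensional:
  fixes A :: "'i set"
  assumes A: "finite A"
  shows "vec_vs.subspace (bernstein_filtration A k :: ('i \<Rightarrow> 'c::field_char_0 weyl) set)"
    and "\<exists>C. finite C \<and> (bernstein_filtration A k :: ('i \<Rightarrow> 'c weyl) set) \<subseteq> vec_vs.span C"
proof -
  have wcoeffs_scale: "lookup (wcoeffs (weyl_const c * a)) m = c * lookup (wcoeffs a) m" for c and a :: "'c weyl" and m
  proof (induction a rule: weyl_induct)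
    case (mono n d)
    show ?case by (auto simp: const_times_wmono lookup_single when_def)
  qed (simp add: distrib_left lookup_add)
  show "vec_vs.subspace (bernstein_filtration A k :: ('i \<Rightarrow> 'c weyl) set)"
  proof (rule vec_vs.subspaceI)
    show "0 \<in> bernstein_filtration A k" by (auto simp: bernstein_filtration_iff free_module_def)
    show "u + v \<in> bernstein_filtration A k" if "u \<in> bernstein_filtration A k" "v \<in> bernstein_filtration A k"
      for u v :: "'i \<Rightarrow> 'c weyl"
      using that Poly_Mapping.keys_add[of "wcoeffs (u i)" "wcoeffs (v i)" for i]
      by (fastforce simp: bernstein_filtration_iff free_module_def)
    show "vec_scale c v \<in> bernstein_filtration A k" if "v \<in> bernstein_filtration A k" for c and v :: "'i \<Rightarrow> 'c weyl"
    proof -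
      have sub: "m \<in> keys (wcoeffs (weyl_const c * v i)) \<Longrightarrow> m \<in> keys (wcoeffs (v i))" for i m
        by (auto simp: in_keys_iff wcoeffs_scale)
      show ?thesis
        using that unfolding bernstein_filtration_iff free_module_def vec_scale_def weyl_scale_def
        by (auto dest!: sub)
    qed
  qed
  let ?M = "{m :: wexpo. tdeg (fst m) + tdeg (snd m) \<le> k}"
  have "finite ?M"
    by (rule finite_subset[of _ "{\<alpha>. tdeg \<alpha> \<le> k} \<times> {\<alpha>. tdeg \<alpha> \<le> k}"]) (auto simp: finite_expos_tdeg_le)
  let ?u = "\<lambda>(i, m) j. if j = i then wmono m (1 :: 'c) else 0"
  have "finite (?u ` (A \<times> ?M))" using A \<open>finite ?M\<close> by simp
  moreover have "bernstein_filtration A k \<subseteq> vec_vs.span (?u ` (A \<times> ?M))"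
  proof
    fix v :: "'i \<Rightarrow> 'c weyl" assume v: "v \<in> bernstein_filtration A k"
    have fs: "(\<Sum>x\<in>X. h x) j = (\<Sum>x\<in>X. h x j)" for X :: "'y set" and h :: "'y \<Rightarrow> 'i \<Rightarrow> 'c weyl" and j
      by (induction X rule: infinite_finite_induct) auto
    have "v = (\<Sum>i\<in>A. \<Sum>m\<in>keys (wcoeffs (v i)). vec_scale (lookup (wcoeffs (v i)) m) (?u (i, m)))"
    proof
      fix j
      have "(\<Sum>i\<in>A. \<Sum>m\<in>keys (wcoeffs (v i)). vec_scale (lookup (wcoeffs (v i)) m) (?u (i, m))) j
          = (\<Sum>i\<in>A. if i = j then \<Sum>m\<in>keys (wcoeffs (v i)). wmono m (lookup (wcoeffs (v i)) m) else 0)"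
        unfolding fs by (intro sum.cong refl) (auto simp: vec_scale_def weyl_scale_def const_times_wmono)
      also have "\<dots> = (\<Sum>i\<in>A. if i = j then v i else 0)" by (simp only: weyl_eq_sum_wmono[symmetric])
      also have "\<dots> = v j" using A v by (auto simp: bernstein_filtration_iff free_module_def)
      finally show "v j = (\<Sum>i\<in>A. \<Sum>m\<in>keys (wcoeffs (v i)). vec_scale (lookup (wcoeffs (v i)) m) (?u (i, m))) j" by simp
    qed
    moreover have "vec_scale (lookup (wcoeffs (v i)) m) (?u (i, m)) \<in> vec_vs.span (?u ` (A \<times> ?M))"
      if "i \<in> A" "m \<in> keys (wcoeffs (v i))" for i m
      using that v by (intro vec_vs.span_scale vec_vs.span_base imageI) (auto simp: bernstein_filtration_iff)
    ultimately show "v \<in> vec_vs.span (?u ` (A \<times> ?M))"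
      by (metis (no_types, lifting) vec_vs.span_sum)
  qed
  ultimately show "\<exists>C. finite C \<and> (bernstein_filtration A k :: ('i \<Rightarrow> 'c weyl) set) \<subseteq> vec_vs.span C" by blast
qed

text \<open>The dual basis is required to be homogeneous, each \<open>W b\<close> having the degree of its pivot \<open>b\<close>.\<close>

definition is_echelon_basis ::
    "('i \<Rightarrow> 2 expo \<Rightarrow> 'c::field_char_0) set \<Rightarrow> ('i \<times> 2 expo) set \<Rightarrow> ('i \<times> 2 expo \<Rightarrow> 'i \<Rightarrow> 2 expo \<Rightarrow> 'c) \<Rightarrow> bool" where
  "is_echelon_basis E B W \<longleftrightarrow>
    (\<forall>b\<in>B. W b \<in> E \<and> (\<forall>(i, \<beta>)\<in>B. W b i \<beta> = (if (i, \<beta>) = b then 1 else 0)) \<and>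
       (\<forall>i \<beta>. W b i \<beta> \<noteq> 0 \<longrightarrow> tdeg \<beta> = tdeg (snd b))) \<and>
    (\<forall>w\<in>E. w = (\<lambda>i \<beta>. \<Sum>b\<in>B. w (fst b) (snd b) * W b i \<beta>))"

text \<open>The pairings of the coefficient of \<open>x\<^sup>\<alpha>\<close> with the basis elements \<open>W b\<close> define an injection of \<open>D\<^sup>A/N\<close> into
  the functions of \<open>(\<alpha>, b)\<close>. The step \<open>k\<close> of the filtration is mapped onto the functions supported on
  \<open>|\<alpha>| + |b| \<le> k\<close>: if \<open>b = (i, \<beta>)\<close>, the generator \<open>x\<^sup>\<alpha>\<partial>\<^sup>\<beta>e\<^sub>i\<close> is mapped to the indicator of \<open>(\<alpha>, b)\<close>.\<close>

lemma bernstein_hilbert_annihilator: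
  fixes E :: "('i \<Rightarrow> 2 expo \<Rightarrow> 'c::field_char_0) set"
  assumes A: "finite A" and B: "finite B" "B \<subseteq> A \<times> UNIV" and W: "is_echelon_basis E B W"
  shows "bernstein_hilbert A (annihilator A E) k = (\<Sum>b\<in>B. card {\<alpha> :: 2 expo. tdeg \<alpha> + tdeg (snd b) \<le> k})"
proof -
  define \<Theta> :: "('i \<Rightarrow> 'c weyl) \<Rightarrow> 2 expo \<times> ('i \<times> 2 expo) \<Rightarrow> 'c" where
    "\<Theta> v = (\<lambda>(\<alpha>, b). if b \<in> B then \<Sum>i\<in>A. pairing (v i) (W b i) \<alpha> else 0)" for v
  let ?F = "bernstein_filtration A k :: ('i \<Rightarrow> 'c weyl) set"
  have lin: "Vector_Spaces.linear vec_scale function_scale \<Theta>"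
    unfolding Vector_Spaces.linear_iff
    by (auto simp: \<Theta>_def fun_eq_iff pairing_add sum.distrib vec_scale_def weyl_scale_def pairing_const
        function_scale_def sum_distrib_left intro: vec_vs.vector_space_axioms function_vs.vector_space_axioms)
  have WE: "W b \<in> E" if "b \<in> B" for b using W that by (simp add: is_echelon_basis_def)
  have W1: "W b i \<beta> = (if (i, \<beta>) = b then 1 else 0)" if "b \<in> B" "(i, \<beta>) \<in> B" for b i \<beta>
  proof -
    have "\<forall>x\<in>B. case x of (i, \<beta>) \<Rightarrow> W b i \<beta> = (if (i, \<beta>) = b then 1 else 0)"
      using W that(1) unfolding is_echelon_basis_def by blast
    from bspec[OF this that(2)] show ?thesis by simp
  qed
  have Wdeg: "tdeg \<beta> = tdeg (snd b)" if "b \<in> B" "W b i \<beta> \<noteq> 0" for b i \<beta>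
    using W that unfolding is_echelon_basis_def by blast
  have Wgen: "w = (\<lambda>i \<beta>. \<Sum>b\<in>B. w (fst b) (snd b) * W b i \<beta>)" if "w \<in> E" for w
    using W that unfolding is_echelon_basis_def by blast
  have ker: "?F \<inter> {v. \<Theta> v = 0} = ?F \<inter> annihilator A E"
  proof -
    have "\<Theta> v = 0 \<longleftrightarrow> v \<in> annihilator A E" if v: "v \<in> free_module A" for v
    proof
      assume \<Theta>v: "\<Theta> v = 0"
      have z: "(\<Sum>i\<in>A. pairing (v i) (W b i) \<alpha>) = 0" if "b \<in> B" for b \<alpha>
      proof -
        have "\<Theta> v (\<alpha>, b) = 0" unfolding \<Theta>v by simp
        then show ?thesis using that by (simp add: \<Theta>_def)
      qed
      have "(\<Sum>i\<in>A. pairing (v i) (w i) \<alpha>) = 0" if "w \<in> E" for w \<alpha>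
      proof -
        have "(\<Sum>i\<in>A. pairing (v i) (w i) \<alpha>) = (\<Sum>i\<in>A. pairing (v i) (\<lambda>\<beta>. \<Sum>b\<in>B. w (fst b) (snd b) * W b i \<beta>) \<alpha>)"
          by (subst Wgen[OF that]) (rule refl)
        also have "\<dots> = (\<Sum>i\<in>A. \<Sum>b\<in>B. w (fst b) (snd b) * pairing (v i) (W b i) \<alpha>)"
          using pairing_linear[OF B(1), where u = "\<lambda>b. W b i" for i] by (intro sum.cong refl) simp
        also have "\<dots> = (\<Sum>b\<in>B. w (fst b) (snd b) * (\<Sum>i\<in>A. pairing (v i) (W b i) \<alpha>))"
          unfolding sum_distrib_left by (rule sum.swap)
        also have "\<dots> = 0" using z by simp
        finally show ?thesis .
      qed
      then show "v \<in> annihilator A E" using v by (auto simp: annihilator_def)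
    next
      assume "v \<in> annihilator A E"
      then show "\<Theta> v = 0" using WE by (auto simp: annihilator_def \<Theta>_def fun_eq_iff)
    qed
    then show ?thesis by (auto simp: bernstein_filtration_iff)
  qed
  let ?X = "{(\<alpha> :: 2 expo, b). b \<in> B \<and> tdeg \<alpha> + tdeg (snd b) \<le> k}"
  have X_eq: "?X = (\<lambda>(b, \<alpha>). (\<alpha>, b)) ` (SIGMA b:B. {\<alpha> :: 2 expo. tdeg \<alpha> + tdeg (snd b) \<le> k})" by force
  have fin: "finite {\<alpha> :: 2 expo. tdeg \<alpha> + m \<le> k}" for m
    by (rule finite_subset[OF _ finite_expos_tdeg_le[of k]]) auto
  have finX: "finite ?X" unfolding X_eq using B fin by (intro finite_imageI finite_SigmaI) auto
  have cardX: "card ?X = (\<Sum>b\<in>B. card {\<alpha> :: 2 expo. tdeg \<alpha> + tdeg (snd b) \<le> k})"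
    unfolding X_eq using B(1) fin by (subst card_image) (auto simp: inj_on_def card_SigmaI)
  let ?G = "{g :: 2 expo \<times> ('i \<times> 2 expo) \<Rightarrow> 'c. \<forall>x. x \<notin> ?X \<longrightarrow> g x = 0}"
  have image: "\<Theta> ` ?F = ?G"
  proof (intro equalityI subsetI)
    fix g assume "g \<in> \<Theta> ` ?F"
    then obtain v where v: "v \<in> ?F" "g = \<Theta> v" by blast
    have inX: "(\<alpha>, b) \<in> ?X" if nz: "\<Theta> v (\<alpha>, b) \<noteq> 0" for \<alpha> b
    proof -
      have b: "b \<in> B" using nz by (auto simp: \<Theta>_def split: if_splits)
      then have "(\<Sum>i\<in>A. pairing (v i) (W b i) \<alpha>) \<noteq> 0" using nz by (simp add: \<Theta>_def)
      then obtain i where "pairing (v i) (W b i) \<alpha> \<noteq> 0" by (rule sum.not_neutral_contains_not_neutral)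
      then obtain m where m: "m \<in> keys (wcoeffs (v i))"
          "(if fst m = \<alpha> then lookup (wcoeffs (v i)) m * W b i (snd m) else 0) \<noteq> 0"
        unfolding pairing_def by (rule sum.not_neutral_contains_not_neutral)
      then have "fst m = \<alpha>" "W b i (snd m) \<noteq> 0" by (auto split: if_splits)
      moreover from this have "tdeg (snd m) = tdeg (snd b)" by (intro Wdeg[OF b])
      moreover have "tdeg (fst m) + tdeg (snd m) \<le> k" using v(1) m(1) unfolding bernstein_filtration_iff by blast
      ultimately show ?thesis using b by simp
    qed
    have "\<Theta> v x = 0" if "x \<notin> ?X" for x
    proof -
      obtain \<alpha> b where x: "x = (\<alpha>, b)" by (cases x)
      show ?thesis using that inX[of \<alpha> b] unfolding x by blast
    qed
    then show "g \<in> ?G" unfolding v(2) by blast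
  next
    fix g assume g: "g \<in> ?G"
    define v where "v i = (\<Sum>x\<in>?X. if fst (snd x) = i then wmono (fst x, snd (snd x)) (g x) else 0)" for i
    have "v \<in> ?F" unfolding bernstein_filtration_iff
    proof (intro conjI allI ballI)
      show "v \<in> free_module A" unfolding free_module_def v_def using B(2) by (auto intro!: sum.neutral)
      fix i m assume "m \<in> keys (wcoeffs (v i))"
      then have "(\<Sum>x\<in>?X. lookup (wcoeffs (if fst (snd x) = i then wmono (fst x, snd (snd x)) (g x) else 0)) m) \<noteq> 0"
        by (simp add: v_def wcoeffs_sum lookup_sum in_keys_iff)
      then obtain x where x: "x \<in> ?X" "lookup (wcoeffs (if fst (snd x) = i then wmono (fst x, snd (snd x)) (g x) else 0)) m \<noteq> 0"
        by (rule sum.not_neutral_contains_not_neutral)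
      then have "m = (fst x, snd (snd x))" by (auto simp: lookup_single when_def split: if_splits)
      then show "tdeg (fst m) + tdeg (snd m) \<le> k" using x(1) by auto
    qed
    moreover have "\<Theta> v = g"
    proof
      fix y :: "2 expo \<times> ('i \<times> 2 expo)"
      obtain \<alpha> b where y: "y = (\<alpha>, b)" by (cases y)
      show "\<Theta> v y = g y"
      proof (cases "b \<in> B")
        case True
        have "(\<Sum>i\<in>A. pairing (v i) (W b i) \<alpha>)
            = (\<Sum>i\<in>A. \<Sum>x\<in>?X. if fst (snd x) = i then (if fst x = \<alpha> then g x * W b i (snd (snd x)) else 0) else 0)"
          unfolding v_def pairing_sum by (intro sum.cong refl) (auto simp: pairing_wmono)
        also have "\<dots> = (\<Sum>x\<in>?X. \<Sum>i\<in>A. if fst (snd x) = i then (if fst x = \<alpha> then g x * W b i (snd (snd x)) else 0) else 0)"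
          by (rule sum.swap)
        also have "\<dots> = (\<Sum>x\<in>?X. if x = (\<alpha>, b) then g x else 0)"
        proof (intro sum.cong refl)
          fix x assume x: "x \<in> ?X"
          then have xB: "(fst (snd x), snd (snd x)) \<in> B" "fst (snd x) \<in> A" using B(2) by auto
          have "(\<Sum>i\<in>A. if fst (snd x) = i then (if fst x = \<alpha> then g x * W b i (snd (snd x)) else 0) else 0)
              = (if fst x = \<alpha> then g x * W b (fst (snd x)) (snd (snd x)) else 0)"
            using A xB(2) by simp
          also have "\<dots> = (if x = (\<alpha>, b) then g x else 0)"
            unfolding W1[OF True xB(1)] by (auto simp: prod_eq_iff)
          finally show "(\<Sum>i\<in>A. if fst (snd x) = i then (if fst x = \<alpha> then g x * W b i (snd (snd x)) else 0) else 0)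
              = (if x = (\<alpha>, b) then g x else 0)" .
        qed
        also have "\<dots> = (if (\<alpha>, b) \<in> ?X then g (\<alpha>, b) else 0)" by (rule sum.delta[OF finX])
        also have "\<dots> = g y"
        proof -
          have "g (\<alpha>, b) = 0" if "(\<alpha>, b) \<notin> ?X" using g that by blast
          then show ?thesis unfolding y by argo
        qed
        finally show ?thesis using True by (simp add: \<Theta>_def y)
      next
        case False
        then have "(\<alpha>, b) \<notin> ?X" by simp
        then have "g (\<alpha>, b) = 0" using g by blast
        then show ?thesis using False by (simp add: \<Theta>_def y)
      qed
    qed
    ultimately show "g \<in> \<Theta> ` ?F" by blast
  qed
  have "function_vs.dim ?G = card ?X"
  proof (rule function_vs.dim_eq_card_coordinates(1)[OF finX, where c = "\<lambda>x u. u x" and e = "\<lambda>x y. if y = x then 1 else 0"])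
    fix u assume u: "u \<in> ?G"
    have fs: "(\<Sum>x\<in>Y. h x) y = (\<Sum>x\<in>Y. h x y)" for Y :: "'z set" and h :: "'z \<Rightarrow> 2 expo \<times> ('i \<times> 2 expo) \<Rightarrow> 'c" and y
      by (induction Y rule: infinite_finite_induct) auto
    show "u = (\<Sum>x\<in>?X. function_scale (u x) (\<lambda>y. if y = x then 1 else 0))"
    proof
      fix y
      have "(\<Sum>x\<in>?X. function_scale (u x) (\<lambda>y. if y = x then 1 else 0)) y = (\<Sum>x\<in>?X. if x = y then u x else 0)"
        unfolding fs by (intro sum.cong refl) (auto simp: function_scale_def)
      also have "\<dots> = (if y \<in> ?X then u y else 0)" by (rule sum.delta[OF finX])
      also have "\<dots> = u y"
      proof -
        have "u y = 0" if "y \<notin> ?X" using u that by blast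
        then show ?thesis by argo
      qed
      finally show "u y = (\<Sum>x\<in>?X. function_scale (u x) (\<lambda>y. if y = x then 1 else 0)) y" by simp
    qed
  qed (auto simp: function_scale_def)
  moreover obtain C where "finite C" "?F \<subseteq> vec_vs.span C"
    using bernstein_filtration_finite_dimensional(2)[OF A] by blast
  then have "vec_vs.dim ?F = function_vs.dim (\<Theta> ` ?F) + vec_vs.dim (?F \<inter> {v. \<Theta> v = 0})"
    by (rule vec_function.rank_nullity[OF lin bernstein_filtration_finite_dimensional(1)[OF A]])
  ultimately show ?thesis unfolding bernstein_hilbert_def ker image cardX by simp
qed

text \<open>Each element of \<open>B\<close> contributes a binomial coefficient \<open>(k - m + 2 choose 2)\<close>, where \<open>m\<close> is its degree,
  so the leading coefficient is half the size of \<open>B\<close>.\<close>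

theorem has_bernstein_dim_annihilator:
  fixes E :: "('i \<Rightarrow> 2 expo \<Rightarrow> 'c::field_char_0) set"
  assumes A: "finite A" and B: "finite B" "B \<noteq> {}" "B \<subseteq> A \<times> UNIV" and W: "is_echelon_basis E B W"
  shows "has_bernstein_dim A (annihilator A E) 2"
proof -
  define \<chi> :: "rat poly" where
    "\<chi> = (\<Sum>b\<in>B. let m = of_nat (tdeg (snd b)) in [:(1 - m) * (2 - m) / 2, (3 - 2 * m) / 2, 1 / 2:])"
  have "coeff \<chi> 2 = of_nat (card B) / 2"
    by (simp add: \<chi>_def coeff_sum Let_def numeral_2_eq_2)
  then have c2: "coeff \<chi> 2 \<noteq> 0" using B(1,2) by (simp only: divide_eq_0_iff) (simp add: card_eq_0_iff)
  have "degree \<chi> \<le> 2" unfolding \<chi>_def by (intro degree_sum_le B(1)) (simp add: Let_def numeral_2_eq_2)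
  moreover have "2 \<le> degree \<chi>" using c2 by (rule le_degree)
  ultimately have deg: "degree \<chi> = 2" by simp
  have "of_nat (bernstein_hilbert A (annihilator A E) k) = poly \<chi> (of_nat k)"
    if k: "Max ((\<lambda>b. tdeg (snd b)) ` B) \<le> k" for k
  proof -
    have "tdeg (snd b) \<le> k" if "b \<in> B" for b
    proof -
      have "tdeg (snd b) \<le> Max ((\<lambda>b. tdeg (snd b)) ` B)" using that B(1) by (intro Max_ge) auto
      then show ?thesis using k by (rule order_trans)
    qed
    then have "of_nat (card {\<alpha> :: 2 expo. tdeg \<alpha> + tdeg (snd b) \<le> k})
        = poly (let m = of_nat (tdeg (snd b)) in [:(1 - m) * (2 - m) / 2, (3 - 2 * m) / 2, 1 / 2:]) (of_nat k :: rat)"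
      if "b \<in> B" for b
      unfolding Let_def using that by (intro rat_card_expos_tdeg_le)
    then show ?thesis unfolding bernstein_hilbert_annihilator[OF A B(1,3) W] \<chi>_def poly_sum of_nat_sum
      by (intro sum.cong refl)
  qed
  then have "\<forall>\<^sub>F k in sequentially. of_nat (bernstein_hilbert A (annihilator A E) k) = poly \<chi> (of_nat k)"
    unfolding eventually_sequentially by blast
  then show ?thesis unfolding has_bernstein_dim_def using deg c2 by (intro exI[of _ \<chi>]) auto
qed

text \<open>Truncating an element of the dual basis to the degree of its pivot does not change its values at
  the pivots.\<close>

lemma graded_echelon_basis:
  fixes E :: "('i \<Rightarrow> 2 expo \<Rightarrow> 'c::field_char_0) set"
  assumes A: "finite A"
    and E: "(\<lambda>i \<beta>. 0) \<in> E" "\<And>u v. u \<in> E \<Longrightarrow> v \<in> E \<Longrightarrow> (\<lambda>i \<beta>. u i \<beta> + v i \<beta>) \<in> E" "\<And>c u. u \<in> E \<Longrightarrow> (\<lambda>i \<beta>. c * u i \<beta>) \<in> E"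
    and part: "\<And>w k. w \<in> E \<Longrightarrow> (\<lambda>i \<beta>. if tdeg \<beta> = k then w i \<beta> else 0) \<in> E"
    and supp: "\<And>w i \<beta>. w \<in> E \<Longrightarrow> w i \<beta> \<noteq> 0 \<Longrightarrow> i \<in> A \<and> tdeg \<beta> \<le> d"
  shows "\<exists>B W. finite B \<and> B \<subseteq> A \<times> UNIV \<and> is_echelon_basis E B W"
proof -
  let ?X = "A \<times> {\<beta> :: 2 expo. tdeg \<beta> \<le> d}"
  let ?E = "{u. (\<lambda>i \<beta>. u (i, \<beta>)) \<in> E}"
  have finX: "finite ?X" using A finite_expos_tdeg_le by blast
  have sub: "function_vs.subspace ?E"
    using E by (intro function_vs.subspaceI) (auto simp: function_scale_def)
  have "u x = 0" if "u \<in> ?E" "x \<notin> ?X" for u x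
    using supp[of "\<lambda>i \<beta>. u (i, \<beta>)" "fst x" "snd x"] that by (cases x) auto
  then have "\<exists>B V. B \<subseteq> ?X \<and> (\<forall>b\<in>B. V b \<in> ?E \<and> (\<forall>b'\<in>B. V b b' = (if b' = b then 1 else 0))) \<and>
    (\<forall>u\<in>?E. (\<forall>b\<in>B. u b = 0) \<longrightarrow> (\<forall>x. u x = 0))"
    by (rule echelon_basis[OF finX sub])
  then obtain B V where B: "B \<subseteq> ?X"
      and BV: "\<forall>b\<in>B. V b \<in> ?E \<and> (\<forall>b'\<in>B. V b b' = (if b' = b then 1 else 0))"
      and inj: "\<forall>u\<in>?E. (\<forall>b\<in>B. u b = 0) \<longrightarrow> (\<forall>x. u x = 0)"
    by (elim exE conjE)
  have V: "V b \<in> ?E" "b' \<in> B \<Longrightarrow> V b b' = (if b' = b then 1 else 0)" if "b \<in> B" for b b'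
    using BV that by blast+
  have finB: "finite B" using B finX by (rule finite_subset)
  define W where "W b = (\<lambda>i \<beta>. if tdeg \<beta> = tdeg (snd b) then V b (i, \<beta>) else 0)" for b
  have WE: "W b \<in> E" if "b \<in> B" for b unfolding W_def using V(1)[OF that] by (intro part) simp
  have W1: "W b i \<beta> = (if (i, \<beta>) = b then 1 else 0)" if "b \<in> B" "(i, \<beta>) \<in> B" for b i \<beta>
    using V(2)[OF that] by (auto simp: W_def)
  have Wgen: "w = (\<lambda>i \<beta>. \<Sum>b\<in>B. w (fst b) (snd b) * W b i \<beta>)" if w: "w \<in> E" for w
  proof -
    have sum: "(\<lambda>i \<beta>. \<Sum>b\<in>C. c b * W b i \<beta>) \<in> E" if "finite C" "C \<subseteq> B" for C and c :: "'i \<times> 2 expo \<Rightarrow> 'c"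
      using that
    proof (induction C rule: finite_induct)
      case (insert b C)
      then have "(\<lambda>i \<beta>. c b * W b i \<beta>) \<in> E" using WE E(3) by simp
      moreover have "(\<lambda>i \<beta>. \<Sum>b\<in>C. c b * W b i \<beta>) \<in> E" using insert by simp
      ultimately have "(\<lambda>i \<beta>. c b * W b i \<beta> + (\<Sum>b\<in>C. c b * W b i \<beta>)) \<in> E" by (rule E(2))
      then show ?case using insert.hyps by simp
    qed (simp add: E(1))
    define s where "s i \<beta> = (\<Sum>b\<in>B. w (fst b) (snd b) * W b i \<beta>)" for i \<beta>
    have "s \<in> E" using sum[OF finB subset_refl, of "\<lambda>b. w (fst b) (snd b)"] by (simp add: s_def[abs_def])
    then have "(\<lambda>i \<beta>. w i \<beta> + (- 1) * s i \<beta>) \<in> E" by (intro E(2,3) w)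
    then have diff: "(\<lambda>(i, \<beta>). w i \<beta> - s i \<beta>) \<in> ?E" by simp
    have "w i \<beta> - s i \<beta> = 0" if b: "(i, \<beta>) \<in> B" for i \<beta>
    proof -
      have "s i \<beta> = (\<Sum>b\<in>B. if b = (i, \<beta>) then w (fst b) (snd b) else 0)"
        unfolding s_def using W1 b by (intro sum.cong) auto
      then show ?thesis using b finB by simp
    qed
    then have "\<forall>b\<in>B. (case b of (i, \<beta>) \<Rightarrow> w i \<beta> - s i \<beta>) = 0" by auto
    then have "\<forall>x. (case x of (i, \<beta>) \<Rightarrow> w i \<beta> - s i \<beta>) = 0" by (rule bspec[OF inj diff, THEN mp])
    then have "(case (i, \<beta>) of (i, \<beta>) \<Rightarrow> w i \<beta> - s i \<beta>) = 0" for i \<beta> by (rule spec)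
    then have "w i \<beta> = s i \<beta>" for i \<beta> by simp
    then show ?thesis unfolding s_def by (intro ext)
  qed
  have "is_echelon_basis E B W"
    unfolding is_echelon_basis_def
  proof (intro conjI ballI allI impI)
    show "case x of (i, \<beta>) \<Rightarrow> W b i \<beta> = (if (i, \<beta>) = b then 1 else 0)" if "b \<in> B" "x \<in> B" for b x
      using W1[of b "fst x" "snd x"] that by (simp add: case_prod_unfold)
    show "tdeg \<beta> = tdeg (snd b)" if "W b i \<beta> \<noteq> 0" for b i \<beta>
      using that unfolding W_def by (auto split: if_splits)
  qed (fact WE, fact Wgen)
  then show ?thesis using finB B by blast
qed

section \<open>The roots of the b-function and the kernel\<close>

lemma tdeg_eq_0_iff: "tdeg \<alpha> = 0 \<longleftrightarrow> \<alpha> = 0"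
  by (auto simp: tdeg_def intro!: poly_mapping_eqI)

lemma homogeneous_0_imp_constant: "homogeneous 0 r \<Longrightarrow> r = single 0 (lookup r 0)"
  unfolding homogeneous_iff tdeg_eq_0_iff
  by (rule poly_mapping_eqI) (auto simp: lookup_single when_def)

text \<open>A nonzero constant entry of \<open>\<phi>\<close> would express \<open>f\<^sub>i\<close> by the other generators.\<close>

lemma minimal_generators_column_degree:
  fixes f :: "3 \<Rightarrow> 'a::field_char_0 R2"
  assumes minimal: "\<And>i. f i \<notin> ideal_gen (f ` (- {i}))" and hb: "hilbert_burch f d \<mu> \<phi>"
    and i: "\<phi> i j \<noteq> 0"
  shows "\<not> homogeneous 0 (\<phi> i j)"
proof
  assume "homogeneous 0 (\<phi> i j)"
  then have "\<phi> i j = single 0 (lookup (\<phi> i j) 0)" by (rule homogeneous_0_imp_constant)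
  then obtain c where c: "\<phi> i j = single 0 c" by blast
  then have c0: "c \<noteq> 0" using i by auto
  have "(\<Sum>i\<in>UNIV. \<phi> i j * f i) = 0" by (rule hilbert_burch_column_syzygy[OF hb])
  then have "single 0 c * f i = - (\<Sum>k\<in>- {i}. \<phi> k j * f k)"
    using sum.remove[of UNIV i "\<lambda>k. \<phi> k j * f k"] by (simp add: c Compl_eq_Diff_UNIV eq_neg_iff_add_eq_0)
  then have "single 0 (inverse c) * (single 0 c * f i) = single 0 (- inverse c) * (\<Sum>k\<in>- {i}. \<phi> k j * f k)"
    by (simp add: single_uminus)
  then have "f i = (\<Sum>k\<in>- {i}. (single 0 (- inverse c) * \<phi> k j) * f k)"
    using c0 by (simp add: mult_single sum_distrib_left mult.assoc[symmetric])
  also have "\<dots> \<in> ideal_gen (f ` (- {i}))"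
    unfolding ideal_gen_def by (intro self_module.span_sum self_module.span_scale self_module.span_base imageI)
  finally show False using minimal by blast
qed

text \<open>A contraction by a form of positive degree does not reach the constant term.\<close>

lemma constant_in_inverse_system:
  fixes f :: "3 \<Rightarrow> 'a::field_char_0 R2"
  assumes minimal: "\<And>i. f i \<notin> ideal_gen (f ` (- {i}))" and hb: "hilbert_burch f d \<mu> \<phi>" and \<gamma>\<^sub>0: "tdeg \<gamma>\<^sub>0 = n"
  shows "(\<lambda>\<gamma> \<beta>. if \<gamma> = \<gamma>\<^sub>0 \<and> \<beta> = 0 then 1 else 0) \<in> inverse_system \<phi> n"
proof -
  have "lookup (\<phi> i j) \<kappa> * (if \<delta> - single i 1 = \<gamma>\<^sub>0 \<and> \<kappa> + \<eta> = 0 then 1 else 0) = 0" for i j \<delta> \<eta> \<kappa>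
  proof (cases "lookup (\<phi> i j) \<kappa> = 0")
    case False
    then have nz: "\<phi> i j \<noteq> 0" by (rule nonzero_if_lookup_nonzero)
    have "\<kappa> \<noteq> 0"
    proof
      assume "\<kappa> = 0"
      have h: "homogeneous (if j = 0 then \<mu> else d - \<mu>) (\<phi> i j)" by (rule hilbert_burch_column_degree[OF hb])
      then have "tdeg \<kappa> = (if j = 0 then \<mu> else d - \<mu>)" using False unfolding homogeneous_iff by blast
      then have "homogeneous 0 (\<phi> i j)" using h \<open>\<kappa> = 0\<close> by simp
      then show False using minimal_generators_column_degree[OF minimal hb nz] by blast
    qed
    then obtain k where "lookup \<kappa> k \<noteq> 0" by (metis lookup_zero poly_mapping_eqI)
    then have "lookup (\<kappa> + \<eta>) k \<noteq> 0" by (simp add: lookup_add)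
    then have "\<kappa> + \<eta> \<noteq> 0" by (metis lookup_zero)
    then show ?thesis by simp
  qed simp
  then have "sym_contraction \<phi> j (\<lambda>\<gamma> \<beta>. if \<gamma> = \<gamma>\<^sub>0 \<and> \<beta> = 0 then 1 else 0) \<delta> \<eta> = 0" for j \<delta> \<eta>
    unfolding sym_contraction_def contraction_def by (intro sum.neutral ballI) (auto intro!: sum.neutral)
  then show ?thesis using \<gamma>\<^sub>0 by (auto simp: inverse_system_def)
qed

lemma inverse_system_closed:
  "(\<lambda>\<gamma> \<beta>. 0) \<in> inverse_system \<phi> n"
  "u \<in> inverse_system \<phi> n \<Longrightarrow> v \<in> inverse_system \<phi> n \<Longrightarrow> (\<lambda>\<gamma> \<beta>. u \<gamma> \<beta> + v \<gamma> \<beta>) \<in> inverse_system \<phi> n"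
  "u \<in> inverse_system \<phi> n \<Longrightarrow> (\<lambda>\<gamma> \<beta>. c * u \<gamma> \<beta>) \<in> inverse_system \<phi> n"
proof -
  show "(\<lambda>\<gamma> \<beta>. 0) \<in> inverse_system \<phi> n"
    by (auto simp: inverse_system_def sym_contraction_def contraction_def intro!: sum.neutral)
  have "contraction r (\<lambda>\<beta>. a \<beta> + b \<beta>) \<eta> = contraction r a \<eta> + contraction r b \<eta>" for r :: "'a R2" and a b \<eta>
    by (simp add: contraction_def distrib_left sum.distrib)
  then have add: "sym_contraction \<phi> j (\<lambda>\<gamma> \<beta>. u \<gamma> \<beta> + v \<gamma> \<beta>) \<delta> \<eta> = sym_contraction \<phi> j u \<delta> \<eta> + sym_contraction \<phi> j v \<delta> \<eta>" for j \<delta> \<eta>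
    unfolding sym_contraction_def sum.distrib[symmetric] by (intro sum.cong) auto
  show "(\<lambda>\<gamma> \<beta>. u \<gamma> \<beta> + v \<gamma> \<beta>) \<in> inverse_system \<phi> n"
    if uv: "u \<in> inverse_system \<phi> n" "v \<in> inverse_system \<phi> n"
  proof -
    have support: "tdeg \<gamma> = n" if "u \<gamma> \<beta> + v \<gamma> \<beta> \<noteq> 0" for \<gamma> \<beta>
    proof -
      have "u \<gamma> \<beta> \<noteq> 0 \<or> v \<gamma> \<beta> \<noteq> 0" using that by auto
      then show ?thesis using uv unfolding inverse_system_def by blast
    qed
    have "sym_contraction \<phi> j (\<lambda>\<gamma> \<beta>. u \<gamma> \<beta> + v \<gamma> \<beta>) \<delta> \<eta> = 0" for j \<delta> \<eta>
      using uv by (simp add: add inverse_system_def)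
    then show ?thesis unfolding inverse_system_def using support by blast
  qed
  have "contraction r (\<lambda>\<beta>. c * a \<beta>) \<eta> = c * contraction r a \<eta>" for r :: "'a R2" and a \<eta>
    by (simp add: contraction_def sum_distrib_left mult.left_commute)
  then have scale: "sym_contraction \<phi> j (\<lambda>\<gamma> \<beta>. c * u \<gamma> \<beta>) \<delta> \<eta> = c * sym_contraction \<phi> j u \<delta> \<eta>" for j \<delta> \<eta>
    unfolding sym_contraction_def sum_distrib_left by (intro sum.cong) auto
  have support: "tdeg \<gamma> = n" if "u \<in> inverse_system \<phi> n" "c * u \<gamma> \<beta> \<noteq> 0" for \<gamma> \<beta>
  proof -
    have "u \<gamma> \<beta> \<noteq> 0" using that(2) by auto
    then show ?thesis using that(1) unfolding inverse_system_def by blast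
  qed
  show "(\<lambda>\<gamma> \<beta>. c * u \<gamma> \<beta>) \<in> inverse_system \<phi> n" if u: "u \<in> inverse_system \<phi> n"
  proof -
    have "sym_contraction \<phi> j (\<lambda>\<gamma> \<beta>. c * u \<gamma> \<beta>) \<delta> \<eta> = 0" for j \<delta> \<eta>
      using u by (simp add: scale inverse_system_def)
    then show ?thesis unfolding inverse_system_def using support[OF u] by blast
  qed
qed

theorem theorem2:
  fixes f :: "3 \<Rightarrow> 'a::field_char_0 R2" and \<phi> :: "3 \<Rightarrow> 2 \<Rightarrow> 'a R2" and d \<mu> p :: nat
  assumes homogeneous: "\<And>i. homogeneous d (f i)"
    and minimal: "\<And>i. f i \<notin> ideal_gen (f ` (- {i}))"
    and height: "ideal_height (ideal_gen (range f)) = 2"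
    and resolution: "hilbert_burch f d \<mu> \<phi>"
    and p: "p \<ge> 2"
  shows "holonomic (T_expos (p - 2)) (M_relations \<phi> p) \<and>
    (\<exists>b. is_b_function (T_expos (p - 2)) (M_relations \<phi> p) b \<and> b \<noteq> 0 \<and>
      (\<forall>q::int. kernel_piece_nonzero f p q \<longleftrightarrow> poly b (of_int (- int d + 2 + q)) = 0) \<and>
      finite {q. kernel_piece_nonzero f p q} \<and>
      b = (\<Prod>q\<in>{q. kernel_piece_nonzero f p q}. [:of_int (int d - 2 - q), 1:]))"
proof -
  let ?A = "T_expos (p - 2)"
  define E where "E = inverse_system \<phi> (p - 2)"
  have N: "M_relations \<phi> p = annihilator ?A E" unfolding E_def by (rule M_relations_eq_annihilator[OF p])
  have shift: "(\<lambda>\<gamma> \<beta>. w \<gamma> (\<beta> + \<zeta>)) \<in> E" if "w \<in> E" for w \<zeta>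
    using that unfolding E_def by (rule shift_inverse_system)
  have part: "(\<lambda>\<gamma> \<beta>. if tdeg \<beta> = k then w \<gamma> \<beta> else 0) \<in> E" if "w \<in> E" for w k
    using degree_part_inverse_system[OF resolution] that unfolding E_def degree_part_def by blast
  have supp: "\<gamma> \<in> ?A \<and> tdeg \<beta> \<le> d" if "w \<in> E" "w \<gamma> \<beta> \<noteq> 0" for w \<gamma> \<beta>
    using that inverse_system_degree_bound[OF homogeneous resolution p, of w \<gamma> \<beta>]
    by (auto simp: E_def inverse_system_def T_expos_def)
  define \<gamma>\<^sub>0 :: "3 expo" where "\<gamma>\<^sub>0 = single 0 (p - 2)"
  have \<gamma>0: "\<gamma>\<^sub>0 \<in> ?A" by (simp add: \<gamma>\<^sub>0_def T_expos_def)
  let ?w = "\<lambda>\<gamma> (\<beta> :: 2 expo). if \<gamma> = \<gamma>\<^sub>0 \<and> \<beta> = 0 then 1 else 0 :: 'a"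
  have w0: "?w \<in> E" unfolding E_def
    by (rule constant_in_inverse_system[OF minimal resolution]) (simp add: \<gamma>\<^sub>0_def)
  have "\<not> free_module ?A \<subseteq> annihilator ?A E"
  proof
    assume "free_module ?A \<subseteq> annihilator ?A E"
    moreover have "(\<lambda>\<gamma>. if \<gamma> = \<gamma>\<^sub>0 then 1 else 0 :: 'a weyl) \<in> free_module ?A" using \<gamma>0 by (auto simp: free_module_def)
    ultimately have "1 \<in> component_ideal (annihilator ?A E) \<gamma>\<^sub>0" by (auto simp: component_ideal_def)
    then have "\<forall>w\<in>E. \<forall>\<alpha>. pairing 1 (w \<gamma>\<^sub>0) \<alpha> = 0"
      using component_ideal_annihilator[OF finite_T_expos \<gamma>0, of 1 E] by blast
    then have "\<forall>\<alpha>. pairing 1 (?w \<gamma>\<^sub>0) \<alpha> = 0" by (rule bspec[OF _ w0])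
    then have "pairing 1 (?w \<gamma>\<^sub>0) 0 = 0" by (rule spec)
    then show False by (simp add: one_weyl_def pairing_wmono)
  qed
  moreover have "\<exists>B W. finite B \<and> B \<subseteq> ?A \<times> UNIV \<and> is_echelon_basis E B W"
    by (rule graded_echelon_basis[where d = d])
       (use part supp inverse_system_closed[where \<phi> = \<phi> and n = "p - 2"] in \<open>auto simp: E_def\<close>)
  then obtain B W where B: "finite B" "B \<subseteq> ?A \<times> UNIV" "is_echelon_basis E B W" by blast
  have "B \<noteq> {}"
  proof
    assume "B = {}"
    then have "\<forall>w\<in>E. w = (\<lambda>i \<beta>. 0)" using B(3) unfolding is_echelon_basis_def by simp
    then have "?w = (\<lambda>i \<beta>. 0)" by (rule bspec[OF _ w0])
    then have "?w \<gamma>\<^sub>0 0 = 0" by (rule fun_cong[OF fun_cong])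
    then show False by simp
  qed
  then have "has_bernstein_dim ?A (annihilator ?A E) 2"
    by (intro has_bernstein_dim_annihilator[OF finite_T_expos B(1) _ B(2,3)])
  ultimately have holonomic: "holonomic ?A (M_relations \<phi> p)" unfolding holonomic_def N by blast
  define K where "K = {tdeg \<beta> | \<beta>. \<exists>w\<in>E. \<exists>\<gamma>. w \<gamma> \<beta> \<noteq> 0}"
  have finK: "finite K"
    by (rule finite_subset[of _ "{..d}"]) (use supp in \<open>auto simp: K_def\<close>)
  have b: "is_b_function ?A (M_relations \<phi> p) (root_product K)"
    unfolding N by (rule is_b_function_annihilator[OF finite_T_expos shift part _ K_def finK]) (use supp in auto)
  have kernel: "kernel_piece_nonzero f p q \<longleftrightarrow> (\<exists>k\<in>K. q = int d - 2 - int k)" for q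
  proof -
    have "kernel_piece_nonzero f p q \<longleftrightarrow> (\<exists>w\<in>E. \<exists>\<gamma> \<beta>. w \<gamma> \<beta> \<noteq> 0 \<and> int (tdeg \<beta>) = int d - 2 - q)"
      unfolding E_def by (rule kernel_piece_nonzero_iff_inverse_system[OF homogeneous resolution p])
    also have "\<dots> \<longleftrightarrow> (\<exists>k\<in>K. q = int d - 2 - int k)"
    proof
      assume "\<exists>w\<in>E. \<exists>\<gamma> \<beta>. w \<gamma> \<beta> \<noteq> 0 \<and> int (tdeg \<beta>) = int d - 2 - q"
      then obtain w \<gamma> \<beta> where w: "w \<in> E" "w \<gamma> \<beta> \<noteq> 0" "int (tdeg \<beta>) = int d - 2 - q" by blast
      then have "tdeg \<beta> \<in> K" unfolding K_def by blast
      moreover have "q = int d - 2 - int (tdeg \<beta>)" using w(3) by simp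
      ultimately show "\<exists>k\<in>K. q = int d - 2 - int k" by blast
    next
      assume "\<exists>k\<in>K. q = int d - 2 - int k"
      then obtain k where k: "k \<in> K" "q = int d - 2 - int k" by blast
      then obtain w \<gamma> \<beta> where "w \<in> E" "w \<gamma> \<beta> \<noteq> 0" "k = tdeg \<beta>" unfolding K_def by blast
      moreover from this have "int (tdeg \<beta>) = int d - 2 - q" using k(2) by simp
      ultimately show "\<exists>w\<in>E. \<exists>\<gamma> \<beta>. w \<gamma> \<beta> \<noteq> 0 \<and> int (tdeg \<beta>) = int d - 2 - q" by blast
    qed
    finally show ?thesis .
  qed
  then have Q: "{q. kernel_piece_nonzero f p q} = (\<lambda>k. int d - 2 - int k) ` K" by auto
  have "poly (root_product K) (of_int (- int d + 2 + q) :: 'a) = 0 \<longleftrightarrow> (\<exists>k\<in>K. q = int d - 2 - int k)" for q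
  proof -
    have "of_nat k + of_int (- int d + 2 + q) = (0 :: 'a) \<longleftrightarrow> q = int d - 2 - int k" for k
    proof -
      have "of_nat k + of_int (- int d + 2 + q) = (of_int (int k - int d + 2 + q) :: 'a)" by simp
      then have "of_nat k + of_int (- int d + 2 + q) = (0 :: 'a) \<longleftrightarrow> int k - int d + 2 + q = 0"
        by (simp only: of_int_eq_0_iff)
      then show ?thesis by linarith
    qed
    then show ?thesis unfolding poly_root_product[OF finK] using finK by simp
  qed
  moreover have "root_product K = (\<Prod>q\<in>{q. kernel_piece_nonzero f p q}. [:of_int (int d - 2 - q), 1 :: 'a:])"
    unfolding Q root_product_def by (subst prod.reindex) (auto simp: inj_on_def)
  moreover have "root_product K \<noteq> (0 :: 'a poly)" using monic_root_product[of K, where 'c = 'a] by (auto simp: monic_def)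
  moreover have "finite {q. kernel_piece_nonzero f p q}" unfolding Q using finK by simp
  ultimately show ?thesis using holonomic b kernel by blast
qed

end
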